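(* Given positive integers $e$ and $f$, there exists a dense Zariski open subset $U$ of $X_{e,f}$ such that any random walk whose shape $\chi(t)=\sum_{k=-e}^f\kappa_k t^k$ lies in $U$ is determined up to equivalence by its spectrum.
   Context: A random walk is the sequence of partial sums of a series $\mathsf{X}_1+\mathsf{X}_2+\cdots$ of independent identically distributed finitely supported $\mathbb{Z}$-valued random variables. Its shape is the common distribution of the $\mathsf{X}_i$, encoded in the Laurent polynomial $\chi(t)=\sum_k \kappa_k t^k$ with $\kappa_k=\Pr[\mathsf{X}_i=k]\ge 0$ (so $\chi(1)=1$). The $n$th return probability is $I_n=\Pr[\mathsf{X}_1+\cdots+\mathsf{X}_n=0]$, and the spectrum of the walk is the sequence $I_1,I_2,I_3,\ldots$. Two walks are equivalent if they are the same up to an automorphism of $\mathbb{Z}$, i.e. if their shapes are the same up to possibly replacing $t$ by $t^{-1}$. $X_{e,f}$ denotes the (complex) affine space of tuples $(\kappa_{-e},\ldots,\kappa_f)$, identified with Laurent polynomials $\sum_{k=-e}^f\kappa_kt^k$, satisfying $\sum_{k=-e}^f\kappa_k=1$ and $\sum_{k=-e}^f k\kappa_k=0$.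
   Formalization: The walk is determined up to equivalence only among random walks whose steps generate ℤ (gcd of the support is 1); without this the claim fails, since χ(t) and χ(t^m) have the same spectrum but are not equivalent for m ≥ 2. *)

theory Defs
  imports "HOL-Probability.Probability" "HOL-Library.Poly_Mapping"
begin

section \<open>Random walks, their spectra, and equivalence\<close>

text \<open>A random walk enters only through the common law of its steps. Its shape, the Laurent
  polynomial with coefficients \<open>\<kappa>\<^sub>k = Pr[X\<^sub>i = k]\<close>, is represented by the coefficient function.\<close>

definition is_random_walk :: "int pmf \<Rightarrow> bool" where
  "is_random_walk p \<longleftrightarrow> finite (set_pmf p)"

definition shape :: "int pmf \<Rightarrow> int \<Rightarrow> complex" where
  "shape p k = complex_of_real (pmf p k)"

definition return_prob :: "int pmf \<Rightarrow> nat \<Rightarrow> real" where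
  "return_prob p n = measure_pmf.prob (Pi_pmf {1..n} 0 (\<lambda>_. p)) {x. (\<Sum>i=1..n. x i) = 0}"

text \<open>\<open>return_prob p n\<close> is the return probability of every realisation of the walk as partial sums
  of independent variables with law \<open>p\<close>.\<close>

lemma (in prob_space) return_prob_iid:
  fixes X :: "nat \<Rightarrow> 'a \<Rightarrow> int"
  assumes indep: "indep_vars (\<lambda>_. count_space UNIV) X UNIV"
    and law: "\<And>i. distr M (count_space UNIV) (X i) = measure_pmf p"
  shows "prob {\<omega> \<in> space M. (\<Sum>i=1..n. X i \<omega>) = 0} = return_prob p n"
proof (cases "n = 0")
  case True
  then show ?thesis by (simp add: return_prob_def prob_space)
next
  case False
  define I where "I = {1..n}"
  have I: "I \<noteq> {}" "finite I" using False by (auto simp: I_def)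
  define C :: "nat \<Rightarrow> int measure" where "C = (\<lambda>_. count_space UNIV)"
  define S where "S = {x \<in> space (PiM I C). (\<Sum>i\<in>I. x i) = 0}"
  have S: "S \<in> sets (PiM I C)"
  proof -
    have [measurable]: "(\<lambda>x. \<Sum>i\<in>I. real_of_int (x i)) \<in> borel_measurable (PiM I C)"
      unfolding C_def by measurable
    have "S = {x \<in> space (PiM I C). (\<Sum>i\<in>I. real_of_int (x i)) = 0}"
      unfolding S_def by (simp flip: of_int_sum)
    then show ?thesis by simp
  qed
  have key: "measure N {\<omega> \<in> space N. (\<Sum>i\<in>I. Y i \<omega>) = 0} = measure (PiM I (\<lambda>_. measure_pmf p)) S"
    if N: "prob_space N" and ind: "prob_space.indep_vars N (\<lambda>_. count_space UNIV) Y I"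
      and lawY: "\<And>i. i \<in> I \<Longrightarrow> distr N (count_space UNIV) (Y i) = measure_pmf p"
    for N :: "'b measure" and Y :: "nat \<Rightarrow> 'b \<Rightarrow> int"
  proof -
    interpret N: prob_space N by fact
    have rv: "Y i \<in> measurable N (C i)" if "i \<in> I" for i
      using ind that by (simp add: N.indep_vars_def C_def)
    then have Ym: "(\<lambda>\<omega>. \<lambda>i\<in>I. Y i \<omega>) \<in> measurable N (PiM I C)"
      by (rule measurable_restrict)
    have "distr N (PiM I C) (\<lambda>\<omega>. \<lambda>i\<in>I. Y i \<omega>) = PiM I (\<lambda>i. distr N (C i) (Y i))"
      using N.indep_vars_iff_distr_eq_PiM'[where I = I and M' = C and X = Y] I rv ind by (simp add: C_def)
    also have "\<dots> = PiM I (\<lambda>_. measure_pmf p)"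
      by (rule PiM_cong) (auto simp: C_def lawY)
    finally have "measure (PiM I (\<lambda>_. measure_pmf p)) S
        = measure N ((\<lambda>\<omega>. \<lambda>i\<in>I. Y i \<omega>) -` S \<inter> space N)"
      using measure_distr[OF Ym S] by simp
    also have "(\<lambda>\<omega>. \<lambda>i\<in>I. Y i \<omega>) -` S \<inter> space N = {\<omega> \<in> space N. (\<Sum>i\<in>I. Y i \<omega>) = 0}"
      by (auto simp: S_def space_PiM C_def)
    finally show ?thesis by simp
  qed
  have "prob {\<omega> \<in> space M. (\<Sum>i\<in>I. X i \<omega>) = 0} = measure (PiM I (\<lambda>_. measure_pmf p)) S"
    using indep_vars_subset[OF indep, of I] law by (intro key prob_space_axioms) auto
  also have "\<dots> = measure_pmf.prob (Pi_pmf I 0 (\<lambda>_. p))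
      {x \<in> space (measure_pmf (Pi_pmf I 0 (\<lambda>_. p))). (\<Sum>i\<in>I. x i) = 0}"
  proof (rule key[symmetric])
    show "distr (measure_pmf (Pi_pmf I 0 (\<lambda>_. p))) (count_space UNIV) (\<lambda>x. x i) = measure_pmf p"
      if "i \<in> I" for i
      using Pi_pmf_component[OF I(2), of i 0 "\<lambda>_. p"] that by (simp flip: map_pmf_rep_eq)
  qed (use I in \<open>auto intro: indep_vars_Pi_pmf measure_pmf.prob_space_axioms\<close>)
  finally show ?thesis by (simp add: return_prob_def I_def)
qed

definition spectrum :: "int pmf \<Rightarrow> nat \<Rightarrow> real" where
  "spectrum p n = return_prob p (Suc n)"

definition walk_equiv :: "int pmf \<Rightarrow> int pmf \<Rightarrow> bool" where
  "walk_equiv p q \<longleftrightarrow> q = p \<or> q = map_pmf uminus p"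

lemma spectrum_dilate:
  assumes "m \<noteq> 0"
  shows "spectrum (map_pmf ((*) m) p) = spectrum p"
proof -
  have "return_prob (map_pmf ((*) m) p) n = return_prob p n" for n
  proof -
    have *: "Pi_pmf {1..n} 0 (\<lambda>_. map_pmf ((*) m) p)
        = map_pmf (\<lambda>g. (*) m \<circ> g) (Pi_pmf {1..n} 0 (\<lambda>_. p))"
      by (rule Pi_pmf_map) auto
    have "(\<lambda>g. (*) m \<circ> g) -` {x. (\<Sum>i=1..n. x i) = 0} = {x. (\<Sum>i=1..n. x i) = 0}"
      using assms by (simp add: vimage_def flip: sum_distrib_left)
    then show ?thesis by (simp only: return_prob_def * measure_map_pmf)
  qed
  then show ?thesis by (simp add: spectrum_def fun_eq_iff)
qed

text \<open>By the preceding lemma \<open>\<chi>(t)\<close> and \<open>\<chi>(t\<^sup>m)\<close> always have the same spectrum, although for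
  \<open>m \<ge> 2\<close> they are not equivalent (unless \<open>\<chi> = 1\<close>). Being determined by the spectrum therefore
  only makes sense against competitors whose steps generate the group of integers; nothing else is
  assumed about the competitor's support, degree or drift.\<close>

definition generates_Z :: "int pmf \<Rightarrow> bool" where
  "generates_Z q \<longleftrightarrow> Gcd (set_pmf q) = 1"

definition determined_by_spectrum :: "int pmf \<Rightarrow> bool" where
  "determined_by_spectrum p \<longleftrightarrow>
     (\<forall>q. is_random_walk q \<longrightarrow> generates_Z q \<longrightarrow> spectrum q = spectrum p \<longrightarrow> walk_equiv p q)"

section \<open>The affine space of shapes and its Zariski topology\<close>

definition X_space :: "nat \<Rightarrow> nat \<Rightarrow> (int \<Rightarrow> complex) set" where
  "X_space e f = {\<kappa>. (\<forall>k. k \<notin> {- int e..int f} \<longrightarrow> \<kappa> k = 0) \<and>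
     (\<Sum>k = - int e..int f. \<kappa> k) = 1 \<and> (\<Sum>k = - int e..int f. of_int k * \<kappa> k) = 0}"

text \<open>Polynomials in the coordinates \<open>\<kappa>\<^sub>k\<close> are finitely supported maps from monomials
  (exponent vectors) to coefficients.\<close>

type_synonym coord_poly = "(int \<Rightarrow>\<^sub>0 nat) \<Rightarrow>\<^sub>0 complex"

definition monom_value :: "(int \<Rightarrow>\<^sub>0 nat) \<Rightarrow> (int \<Rightarrow> complex) \<Rightarrow> complex" where
  "monom_value m \<kappa> = (\<Prod>k\<in>Poly_Mapping.keys m. \<kappa> k ^ Poly_Mapping.lookup m k)"

definition poly_value :: "coord_poly \<Rightarrow> (int \<Rightarrow> complex) \<Rightarrow> complex" where
  "poly_value P \<kappa> =
     (\<Sum>m\<in>Poly_Mapping.keys P. Poly_Mapping.lookup P m * monom_value m \<kappa>)"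

definition zariski :: "(int \<Rightarrow> complex) set \<Rightarrow> (int \<Rightarrow> complex) topology" where
  "zariski X = topology_generated_by {{\<kappa> \<in> X. poly_value P \<kappa> \<noteq> 0} | P. True}"

lemma poly_value_superset:
  assumes "finite A" "Poly_Mapping.keys P \<subseteq> A"
  shows "poly_value P \<kappa> = (\<Sum>m\<in>A. Poly_Mapping.lookup P m * monom_value m \<kappa>)"
  unfolding poly_value_def using assms
  by (intro sum.mono_neutral_left) (auto simp: in_keys_iff)

lemma poly_value_add: "poly_value (P + Q) \<kappa> = poly_value P \<kappa> + poly_value Q \<kappa>"
proof -
  let ?A = "Poly_Mapping.keys P \<union> Poly_Mapping.keys Q"
  have "poly_value (P + Q) \<kappa> = (\<Sum>m\<in>?A. Poly_Mapping.lookup (P + Q) m * monom_value m \<kappa>)"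
    by (rule poly_value_superset) (simp_all add: keys_add)
  also have "\<dots> = (\<Sum>m\<in>?A. Poly_Mapping.lookup P m * monom_value m \<kappa>)
      + (\<Sum>m\<in>?A. Poly_Mapping.lookup Q m * monom_value m \<kappa>)"
    by (simp only: lookup_add distrib_right sum.distrib)
  also have "\<dots> = poly_value P \<kappa> + poly_value Q \<kappa>"
    using poly_value_superset[of ?A P] poly_value_superset[of ?A Q] by simp
  finally show ?thesis .
qed

lemma poly_value_zero [simp]: "poly_value 0 \<kappa> = 0"
  by (simp add: poly_value_def)

lemma monom_value_add: "monom_value (m + n) \<kappa> = monom_value m \<kappa> * monom_value n \<kappa>"
proof -
  let ?A = "Poly_Mapping.keys m \<union> Poly_Mapping.keys n"
  have *: "monom_value l \<kappa> = (\<Prod>k\<in>?A. \<kappa> k ^ Poly_Mapping.lookup l k)"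
    if "Poly_Mapping.keys l \<subseteq> ?A" for l
    unfolding monom_value_def
    using that by (intro prod.mono_neutral_left) (auto simp: in_keys_iff)
  have "monom_value (m + n) \<kappa> = (\<Prod>k\<in>?A. \<kappa> k ^ Poly_Mapping.lookup (m + n) k)"
    by (rule *) (rule keys_add)
  also have "\<dots> = (\<Prod>k\<in>?A. \<kappa> k ^ Poly_Mapping.lookup m k) * (\<Prod>k\<in>?A. \<kappa> k ^ Poly_Mapping.lookup n k)"
    by (simp only: lookup_add power_add prod.distrib)
  also have "\<dots> = monom_value m \<kappa> * monom_value n \<kappa>"
    using *[of m] *[of n] by simp
  finally show ?thesis .
qed

lemma poly_value_single [simp]:
  "poly_value (Poly_Mapping.single m c) \<kappa> = c * monom_value m \<kappa>"
  by (simp add: poly_value_def)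

lemma coord_poly_induct [case_names zero single add]:
  fixes P :: coord_poly
  assumes "Q 0" "\<And>m c. Q (Poly_Mapping.single m c)" "\<And>A B. Q A \<Longrightarrow> Q B \<Longrightarrow> Q (A + B)"
  shows "Q P"
proof -
  have "Q (\<Sum>m\<in>A. Poly_Mapping.single m (Poly_Mapping.lookup P m))" if "finite A" for A
    using that by induction (auto intro: assms)
  moreover have "P = (\<Sum>m\<in>Poly_Mapping.keys P. Poly_Mapping.single m (Poly_Mapping.lookup P m))"
    by (rule poly_mapping_eqI)
       (auto simp: lookup_sum lookup_single when_def in_keys_iff sum.delta)
  ultimately show ?thesis using finite_keys by metis
qed

lemma poly_value_mult: "poly_value (P * Q) \<kappa> = poly_value P \<kappa> * poly_value Q \<kappa>"
proof (induction P rule: coord_poly_induct)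
  case (single m c)
  show ?case
    by (induction Q rule: coord_poly_induct)
       (simp_all add: mult_single monom_value_add poly_value_add algebra_simps)
qed (simp_all add: poly_value_add distrib_right)

lemma openin_zariski_iff:
  "openin (zariski X) U \<longleftrightarrow> (\<exists>S. U = {\<kappa> \<in> X. \<exists>P\<in>S. poly_value P \<kappa> \<noteq> 0})"
proof
  assume "openin (zariski X) U"
  then have "generate_topology_on {{\<kappa> \<in> X. poly_value P \<kappa> \<noteq> 0} | P. True} U"
    by (simp add: zariski_def openin_topology_generated_by_iff)
  then show "\<exists>S. U = {\<kappa> \<in> X. \<exists>P\<in>S. poly_value P \<kappa> \<noteq> 0}"
  proof induction
    case Empty
    show ?case by (rule exI[of _ "{}"]) simp
  next
    case (Int a b)
    then obtain S T where "a = {\<kappa> \<in> X. \<exists>P\<in>S. poly_value P \<kappa> \<noteq> 0}"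
      "b = {\<kappa> \<in> X. \<exists>P\<in>T. poly_value P \<kappa> \<noteq> 0}" by blast
    then have "a \<inter> b = {\<kappa> \<in> X. \<exists>P\<in>S. \<exists>Q\<in>T. poly_value P \<kappa> * poly_value Q \<kappa> \<noteq> 0}"
      by auto
    also have "\<dots> = {\<kappa> \<in> X. \<exists>R\<in>(\<lambda>(P, Q). P * Q) ` (S \<times> T). poly_value R \<kappa> \<noteq> 0}"
      by (simp add: poly_value_mult)
    finally show ?case by blast
  next
    case (UN K)
    then have "\<forall>k\<in>K. \<exists>S. k = {\<kappa> \<in> X. \<exists>P\<in>S. poly_value P \<kappa> \<noteq> 0}" by blast
    then obtain S where S: "\<forall>k\<in>K. k = {\<kappa> \<in> X. \<exists>P\<in>S k. poly_value P \<kappa> \<noteq> 0}"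
      by (rule bchoice[elim_format]) blast
    have "\<Union>K = (\<Union>k\<in>K. {\<kappa> \<in> X. \<exists>P\<in>S k. poly_value P \<kappa> \<noteq> 0})"
      using S by (metis (no_types, lifting) SUP_cong image_ident)
    also have "\<dots> = {\<kappa> \<in> X. \<exists>P\<in>\<Union>(S ` K). poly_value P \<kappa> \<noteq> 0}" by blast
    finally show ?case by (rule exI)
  next
    case (Basis s)
    then obtain P where "s = {\<kappa> \<in> X. poly_value P \<kappa> \<noteq> 0}" by blast
    then show ?case by (intro exI[of _ "{P}"]) simp
  qed
next
  assume "\<exists>S. U = {\<kappa> \<in> X. \<exists>P\<in>S. poly_value P \<kappa> \<noteq> 0}"
  then obtain S where "U = (\<Union>P\<in>S. {\<kappa> \<in> X. poly_value P \<kappa> \<noteq> 0})" by blast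
  then show "openin (zariski X) U"
    unfolding zariski_def by (blast intro: topology_generated_by_Basis)
qed

lemma topspace_zariski [simp]: "topspace (zariski X) = X"
proof -
  have "poly_value (Poly_Mapping.single 0 1) \<kappa> = 1" for \<kappa>
    by (simp only: poly_value_single) (simp add: monom_value_def)
  then have "{\<kappa> \<in> X. poly_value (Poly_Mapping.single 0 1) \<kappa> \<noteq> 0} = X" by (simp del: single_one)
  then show ?thesis unfolding zariski_def topology_generated_by_topspace by blast
qed

lemma closedin_zariski_iff:
  "closedin (zariski X) Z \<longleftrightarrow> (\<exists>S. Z = {\<kappa> \<in> X. \<forall>P\<in>S. poly_value P \<kappa> = 0})"
proof
  assume "closedin (zariski X) Z"
  then obtain S where "Z \<subseteq> X" "X - Z = {\<kappa> \<in> X. \<exists>P\<in>S. poly_value P \<kappa> \<noteq> 0}"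
    by (auto simp: closedin_def openin_zariski_iff)
  then have "Z = {\<kappa> \<in> X. \<forall>P\<in>S. poly_value P \<kappa> = 0}" by blast
  then show "\<exists>S. Z = {\<kappa> \<in> X. \<forall>P\<in>S. poly_value P \<kappa> = 0}" by blast
next
  assume "\<exists>S. Z = {\<kappa> \<in> X. \<forall>P\<in>S. poly_value P \<kappa> = 0}"
  then obtain S where S: "Z = {\<kappa> \<in> X. \<forall>P\<in>S. poly_value P \<kappa> = 0}" by blast
  then have "X - Z = {\<kappa> \<in> X. \<exists>P\<in>S. poly_value P \<kappa> \<noteq> 0}" by blast
  with S show "closedin (zariski X) Z"
    by (auto simp: closedin_def openin_zariski_iff)
qed

end

theory Submission
  imports Defs "HOL-Computational_Algebra.Computational_Algebra" "HOL-Computational_Algebra.Field_as_Ring"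
    "Jordan_Normal_Form.Determinant"
begin

hide_const (open) Module.smult
no_notation vec_index (infixl "$" 100)
no_notation index_mat (infixl "$$" 100)
no_notation vec_nth (infixl "$" 90)
unbundle fps_syntax

text \<open>Write \<open>\<chi>(t) = w\<close> and \<open>\<psi>(s) = w\<close> for the equations of the two walks, solved in Laurent series in \<open>u\<close>
  with \<open>w = u\<^sup>-\<^sup>M\<close>. The return probabilities are, up to a factor, the coefficients of the sum of the
  logarithmic derivatives of the roots that vanish at \<open>u = 0\<close>. Equality of the spectra is therefore
  a linear relation between the logarithmic derivatives of the roots \<open>t\<close> and of the roots \<open>s\<close>, which
  remains true under the Galois group over \<open>\<complex>(w)\<close>.

  For generic \<open>\<chi>\<close> of drift zero the branch point of \<open>\<chi>\<close> at \<open>t = 1\<close> is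
  simple and produces a transposition of two roots \<open>t\<close>; a further generic condition makes all
  transpositions of the roots \<open>t\<close> Galois, so that the logarithmic derivatives of the \<open>t\<close>
  satisfy no relation besides their vanishing sum. Averaging the spectral relation over stabilisers shows that the
  stabiliser of some \<open>s\<close> is not transitive on the roots \<open>t\<close>. The product of the conjugates
  of \<open>t\<close> over \<open>\<complex>(s)\<close> is a monomial in \<open>s\<close>, so a power of every
  \<open>s\<close> is, up to a constant, the product of a set of \<open>k\<close> roots \<open>t\<close>, and all sets
  of \<open>k\<close> roots occur. The order of \<open>s\<close> at \<open>u = 0\<close> takes only two values, which
  forces the sets or their complements to be singletons (apart from one small case, excluded by positivity). Hence
  \<open>\<psi>(t) = \<chi>(c t)\<close> or \<open>\<psi>(t) = \<chi>(c / t)\<close>, and zero drift together with the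
  convexity of the exponential function gives \<open>c = 1\<close>.\<close>

section \<open>Extending field homomorphisms\<close>

text \<open>The field of Laurent series in \<open>u\<close> is not algebraically closed. What
  replaces closedness is the choice of \<open>M\<close> as a common multiple of the four end degrees
  of the two walks: all roots of both equations are then series in \<open>u\<close>, so both
  equations split and a homomorphism fixing \<open>w\<close> can be prolonged root by root. The
  Galois group is only the finite set of permutations of the roots obtained in this way. It is fed
  by the rotations of \<open>u\<close> (monodromy at infinity), by the isomorphisms between C(a) and
  C(b) for two roots of one equation, and by the involution u -> -u at the place w = 1 + u^2. The
  last one is known on the roots t alone; its effect on the roots s stays unknown throughout.

  Logarithmic derivatives turn monomial relations up to constants into integral linear relations,
  with orders at u = 0 as residues. Constants are lost, hence the scaling c at the end.

  The generic conditions are finitely many polynomial inequations: nonzero coordinates, a nonzero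
  discriminant and value at 1 of (P - t^e) / (t - 1)^2, and for each m >= 2 dividing
  \<open>e\<close> and \<open>f\<close> an inequation that fails as soon as P is an m-th power of a
  polynomial.\<close>

definition is_subfield :: "'a::field set \<Rightarrow> bool" where
  "is_subfield R \<longleftrightarrow> 0 \<in> R \<and> 1 \<in> R \<and> (\<forall>x\<in>R. \<forall>y\<in>R. x + y \<in> R \<and> x * y \<in> R) \<and>
     (\<forall>x\<in>R. - x \<in> R \<and> inverse x \<in> R)"

lemma is_subfieldI:
  assumes "0 \<in> R" "1 \<in> R" "\<And>x y. x \<in> R \<Longrightarrow> y \<in> R \<Longrightarrow> x + y \<in> R"
    "\<And>x y. x \<in> R \<Longrightarrow> y \<in> R \<Longrightarrow> x * y \<in> R" "\<And>x. x \<in> R \<Longrightarrow> - x \<in> R"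
    "\<And>x. x \<in> R \<Longrightarrow> x \<noteq> 0 \<Longrightarrow> inverse x \<in> R"
  shows "is_subfield R"
  unfolding is_subfield_def using assms by (metis inverse_zero)

context
  fixes R :: "'a::field set"
  assumes R: "is_subfield R"
begin

lemma subfield_0: "0 \<in> R" and subfield_1: "1 \<in> R"
  and subfield_add: "x \<in> R \<Longrightarrow> y \<in> R \<Longrightarrow> x + y \<in> R"
  and subfield_mult: "x \<in> R \<Longrightarrow> y \<in> R \<Longrightarrow> x * y \<in> R"
  and subfield_uminus: "x \<in> R \<Longrightarrow> - x \<in> R"
  and subfield_inverse: "x \<in> R \<Longrightarrow> inverse x \<in> R"
  using R by (auto simp: is_subfield_def)

lemma subfield_diff: "x \<in> R \<Longrightarrow> y \<in> R \<Longrightarrow> x - y \<in> R"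
  using subfield_add[of x "- y"] subfield_uminus[of y] by simp

lemma subfield_divide: "x \<in> R \<Longrightarrow> y \<in> R \<Longrightarrow> x / y \<in> R"
  using subfield_mult[of x "inverse y"] subfield_inverse[of y] by (simp add: field_simps)

lemma subfield_power: "x \<in> R \<Longrightarrow> x ^ n \<in> R"
  by (induction n) (auto intro: subfield_1 subfield_mult)

lemma subfield_power_int: "x \<in> R \<Longrightarrow> x powi n \<in> R"
  by (auto simp: power_int_def intro: subfield_power subfield_inverse)

lemma subfield_sum: "(\<And>i. i \<in> A \<Longrightarrow> f i \<in> R) \<Longrightarrow> sum f A \<in> R"
  by (induction A rule: infinite_finite_induct) (auto intro: subfield_0 subfield_add)

lemma subfield_prod: "(\<And>i. i \<in> A \<Longrightarrow> f i \<in> R) \<Longrightarrow> prod f A \<in> R"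
  by (induction A rule: infinite_finite_induct) (auto intro: subfield_1 subfield_mult)

end

definition gen_field :: "'a::field set \<Rightarrow> 'a set" where
  "gen_field A = \<Inter>{R. is_subfield R \<and> A \<subseteq> R}"

lemma is_subfield_gen_field: "is_subfield (gen_field A)"
  by (auto simp: gen_field_def is_subfield_def)

lemma gen_field_superset: "A \<subseteq> gen_field A"
  by (auto simp: gen_field_def)

lemma gen_field_least: "is_subfield R \<Longrightarrow> A \<subseteq> R \<Longrightarrow> gen_field A \<subseteq> R"
  by (auto simp: gen_field_def)

text \<open>A total function constrained on \<open>R\<close> only, so that restricting and
  prolonging a homomorphism never changes its type.\<close>

definition hom_on :: "'a::field set \<Rightarrow> ('a \<Rightarrow> 'b::field) \<Rightarrow> bool" where
  "hom_on R \<phi> \<longleftrightarrow> \<phi> 1 = 1 \<and> (\<forall>x\<in>R. \<forall>y\<in>R. \<phi> (x + y) = \<phi> x + \<phi> y \<and> \<phi> (x * y) = \<phi> x * \<phi> y)"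

lemma hom_on_subset: "hom_on R \<phi> \<Longrightarrow> R' \<subseteq> R \<Longrightarrow> hom_on R' \<phi>"
  by (auto simp: hom_on_def)

lemma hom_on_id: "hom_on R (\<lambda>x. x)"
  by (simp add: hom_on_def)

context
  fixes R :: "'a::field set" and \<phi> :: "'a \<Rightarrow> 'b::field"
  assumes R: "is_subfield R" and hom: "hom_on R \<phi>"
begin

lemma hom_on_1: "\<phi> 1 = 1"
  and hom_on_add: "x \<in> R \<Longrightarrow> y \<in> R \<Longrightarrow> \<phi> (x + y) = \<phi> x + \<phi> y"
  and hom_on_mult: "x \<in> R \<Longrightarrow> y \<in> R \<Longrightarrow> \<phi> (x * y) = \<phi> x * \<phi> y"
  using hom by (auto simp: hom_on_def)

lemma hom_on_0: "\<phi> 0 = 0"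
proof -
  have "\<phi> 0 + \<phi> 0 = \<phi> 0 + 0" using hom_on_add[of 0 0] subfield_0[OF R] by simp
  then show ?thesis by (rule add_left_imp_eq)
qed

lemma hom_on_uminus: "x \<in> R \<Longrightarrow> \<phi> (- x) = - \<phi> x"
  using hom_on_add[of x "- x"] subfield_uminus[OF R] hom_on_0 by (simp add: eq_neg_iff_add_eq_0 add.commute)

lemma hom_on_diff: "x \<in> R \<Longrightarrow> y \<in> R \<Longrightarrow> \<phi> (x - y) = \<phi> x - \<phi> y"
  using hom_on_add[of x "- y"] hom_on_uminus[of y] subfield_uminus[OF R, of y] by simp

lemma hom_on_inverse: "x \<in> R \<Longrightarrow> \<phi> (inverse x) = inverse (\<phi> x)"
proof (cases "x = 0")
  case False
  assume "x \<in> R"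
  then have "\<phi> x * \<phi> (inverse x) = 1"
    using hom_on_mult[of x "inverse x"] subfield_inverse[OF R, of x] hom_on_1 False by simp
  then show ?thesis by (metis inverse_unique)
qed (simp add: hom_on_0)

lemma hom_on_eq_0_iff: "x \<in> R \<Longrightarrow> \<phi> x = 0 \<longleftrightarrow> x = 0"
  using hom_on_mult[of x "inverse x"] subfield_inverse[OF R, of x] hom_on_1 hom_on_0
  by (metis mult_zero_left right_inverse zero_neq_one)

lemma hom_on_inj: "inj_on \<phi> R"
  by (rule inj_onI) (metis R eq_iff_diff_eq_0 hom_on_diff hom_on_eq_0_iff subfield_diff)

lemma hom_on_divide: "x \<in> R \<Longrightarrow> y \<in> R \<Longrightarrow> \<phi> (x / y) = \<phi> x / \<phi> y"
  using hom_on_mult[of x "inverse y"] hom_on_inverse[of y] subfield_inverse[OF R, of y]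
  by (simp add: field_simps)

lemma hom_on_power: "x \<in> R \<Longrightarrow> \<phi> (x ^ n) = \<phi> x ^ n"
  by (induction n) (auto simp: hom_on_1 hom_on_mult subfield_power[OF R])

lemma hom_on_power_int: "x \<in> R \<Longrightarrow> \<phi> (x powi n) = \<phi> x powi n"
  by (auto simp: power_int_def hom_on_power hom_on_inverse subfield_inverse[OF R])

lemma hom_on_sum: "(\<And>i. i \<in> A \<Longrightarrow> f i \<in> R) \<Longrightarrow> \<phi> (sum f A) = (\<Sum>i\<in>A. \<phi> (f i))"
  by (induction A rule: infinite_finite_induct)
     (auto simp: hom_on_0 hom_on_add subfield_sum[OF R])

lemma hom_on_prod: "(\<And>i. i \<in> A \<Longrightarrow> f i \<in> R) \<Longrightarrow> \<phi> (prod f A) = (\<Prod>i\<in>A. \<phi> (f i))"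
  by (induction A rule: infinite_finite_induct)
     (auto simp: hom_on_1 hom_on_mult subfield_prod[OF R])

lemma is_subfield_hom_image: "is_subfield (\<phi> ` R)"
proof (rule is_subfieldI)
  show "0 \<in> \<phi> ` R" "1 \<in> \<phi> ` R"
    using hom_on_0 hom_on_1 subfield_0[OF R] subfield_1[OF R] by (metis imageI)+
next
  fix x y assume "x \<in> \<phi> ` R" "y \<in> \<phi> ` R"
  then obtain x' y' where xy: "x' \<in> R" "y' \<in> R" "x = \<phi> x'" "y = \<phi> y'" by auto
  show "x + y \<in> \<phi> ` R" "x * y \<in> \<phi> ` R" "- x \<in> \<phi> ` R" "inverse x \<in> \<phi> ` R"
    using xy by (metis hom_on_add hom_on_mult hom_on_uminus hom_on_inverse imageI
        subfield_add[OF R] subfield_mult[OF R] subfield_uminus[OF R] subfield_inverse[OF R])+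
qed

end

subsection \<open>Polynomials over a subfield\<close>

definition polys :: "'a::zero set \<Rightarrow> 'a poly set" where
  "polys R = {f. \<forall>i. coeff f i \<in> R}"

lemma polys_mono: "R \<subseteq> R' \<Longrightarrow> polys R \<subseteq> polys R'"
  by (auto simp: polys_def)

context
  fixes R :: "'a::field set"
  assumes R: "is_subfield R"
begin

lemma polys_0: "0 \<in> polys R"
  and polys_add: "f \<in> polys R \<Longrightarrow> g \<in> polys R \<Longrightarrow> f + g \<in> polys R"
  and polys_uminus: "f \<in> polys R \<Longrightarrow> - f \<in> polys R"
  and polys_diff: "f \<in> polys R \<Longrightarrow> g \<in> polys R \<Longrightarrow> f - g \<in> polys R"
  and polys_monom: "c \<in> R \<Longrightarrow> monom c n \<in> polys R"
  and polys_mult: "f \<in> polys R \<Longrightarrow> g \<in> polys R \<Longrightarrow> f * g \<in> polys R"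
  by (auto simp: polys_def coeff_mult intro: subfield_0[OF R] subfield_add[OF R]
      subfield_uminus[OF R] subfield_diff[OF R] subfield_mult[OF R] subfield_sum[OF R])

lemma polys_const: "c \<in> R \<Longrightarrow> [:c:] \<in> polys R"
  using polys_monom[of c 0] by (simp add: monom_0)

lemma polys_linear: "c \<in> R \<Longrightarrow> [:c, 1:] \<in> polys R"
  by (auto simp: polys_def coeff_pCons subfield_0[OF R] subfield_1[OF R] split: nat.split)

lemma polys_lead_coeff: "f \<in> polys R \<Longrightarrow> lead_coeff f \<in> R"
  by (simp add: polys_def)

text \<open>The usual reduction of leading terms; the point is that quotient and remainder keep
  their coefficients in \<open>R\<close>.\<close>

lemma polys_division:
  assumes "m \<in> polys R" "m \<noteq> 0" "f \<in> polys R"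
  shows "\<exists>q\<in>polys R. \<exists>r\<in>polys R. f = q * m + r \<and> (r = 0 \<or> degree r < degree m)"
  using \<open>f \<in> polys R\<close>
proof (induction "degree f" arbitrary: f rule: less_induct)
  case less
  show ?case
  proof (cases "f = 0 \<or> degree f < degree m")
    case True
    then show ?thesis using less.prems polys_0
      by (intro bexI[of _ 0] bexI[of _ f]) auto
  next
    case False
    then have f: "f \<noteq> 0" "degree m \<le> degree f" by auto
    define c where "c = lead_coeff f / lead_coeff m"
    define n where "n = degree f - degree m"
    define f' where "f' = f - monom c n * m"
    have c: "c \<in> R" "c \<noteq> 0" using assms less.prems f
      by (auto simp: c_def polys_lead_coeff subfield_divide[OF R])
    have f': "f' \<in> polys R" unfolding f'_def
      using c less.prems assms by (intro polys_diff polys_mult polys_monom) auto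
    have deg: "degree (monom c n * m) = degree f"
      using c(2) f assms(2) by (subst degree_mult_eq) (auto simp: degree_monom_eq n_def)
    have "lead_coeff (monom c n * m) = lead_coeff f"
      using assms(2) c(2) unfolding lead_coeff_mult by (simp add: degree_monom_eq) (simp add: c_def)
    then have z: "coeff f' (degree f) = 0" using deg by (simp add: f'_def)
    have le: "degree f' \<le> degree f" unfolding f'_def using deg by (intro degree_diff_le) auto
    show ?thesis
    proof (cases "f' = 0")
      case True
      then have "f = monom c n * m + 0" by (simp add: f'_def)
      then show ?thesis using polys_0 polys_monom[OF c(1)] by blast
    next
      case f'0: False
      have "degree f' < degree f"
        using le z f'0 by (metis le_neq_implies_less leading_coeff_0_iff)
      then obtain q r where qr: "q \<in> polys R" "r \<in> polys R" "f' = q * m + r" "r = 0 \<or> degree r < degree m"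
        using less.hyps[of f'] f' by blast
      then have "f = (q + monom c n) * m + r" by (simp add: f'_def algebra_simps)
      then show ?thesis using qr polys_add[OF qr(1) polys_monom[OF c(1)]] by blast
    qed
  qed
qed

end

text \<open>A linear factor whose root is not a root of \<open>p\<close> must divide the cofactor
  and can be cancelled there, until \<open>p\<close> divides 1.\<close>

lemma degree_eq_0_if_no_root:
  fixes p :: "'a::field poly"
  assumes "finite B" "p dvd (\<Prod>b\<in>B. [:- b, 1:])" "\<And>b. b \<in> B \<Longrightarrow> poly p b \<noteq> 0"
  shows "degree p = 0"
  using assms
proof (induction B rule: finite_induct)
  case empty
  then show ?case by (metis degree_0 is_unit_iff_degree prod.empty)
next
  case (insert b B)
  then obtain k where k: "[:- b, 1:] * (\<Prod>b\<in>B. [:- b, 1:]) = p * k"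
    unfolding prod.insert[OF insert.hyps] by (elim dvdE)
  have "poly (p * k) b = 0" unfolding k[symmetric] poly_mult by simp
  then have "poly k b = 0" using insert.prems(2)[of b] by simp
  then obtain k' where k': "k = [:- b, 1:] * k'" by (auto simp: poly_eq_0_iff_dvd)
  have "[:- b, 1:] * (\<Prod>b\<in>B. [:- b, 1:]) = [:- b, 1:] * (p * k')"
    unfolding k k' by (simp only: ac_simps)
  moreover have "[:- b, 1:] \<noteq> 0" by simp
  ultimately have "(\<Prod>b\<in>B. [:- b, 1:]) = p * k'"
    using mult_left_cancel by blast
  then show ?case using insert by auto
qed

section \<open>Prolonging a homomorphism to an algebraic element\<close>

context
  fixes R :: "'a::field set" and \<phi> :: "'a \<Rightarrow> 'b::field"
  assumes R: "is_subfield R" and hom: "hom_on R \<phi>"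
begin

lemma coeff_hom_poly: "coeff (map_poly \<phi> f) i = \<phi> (coeff f i)"
  by (simp add: coeff_map_poly hom_on_0[OF R hom])

lemma hom_poly_add: "f \<in> polys R \<Longrightarrow> g \<in> polys R \<Longrightarrow> map_poly \<phi> (f + g) = map_poly \<phi> f + map_poly \<phi> g"
  by (rule poly_eqI) (simp add: coeff_hom_poly hom_on_add[OF R hom] polys_def)

lemma hom_poly_diff: "f \<in> polys R \<Longrightarrow> g \<in> polys R \<Longrightarrow> map_poly \<phi> (f - g) = map_poly \<phi> f - map_poly \<phi> g"
  by (rule poly_eqI) (simp add: coeff_hom_poly hom_on_diff[OF R hom] polys_def)

lemma hom_poly_mult: "f \<in> polys R \<Longrightarrow> g \<in> polys R \<Longrightarrow> map_poly \<phi> (f * g) = map_poly \<phi> f * map_poly \<phi> g"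
  by (rule poly_eqI)
     (simp add: coeff_hom_poly coeff_mult hom_on_sum[OF R hom] hom_on_mult[OF R hom] polys_def subfield_mult[OF R])

lemma hom_poly_eval: "f \<in> polys R \<Longrightarrow> a \<in> R \<Longrightarrow> \<phi> (poly f a) = poly (map_poly \<phi> f) (\<phi> a)"
proof -
  assume f: "f \<in> polys R" and a: "a \<in> R"
  have deg: "degree (map_poly \<phi> f) = degree f"
    using f by (cases "f = 0") (auto intro!: map_poly_degree_eq simp: hom_on_eq_0_iff[OF R hom] polys_def)
  show ?thesis unfolding poly_altdef deg
    using f a by (subst hom_on_sum[OF R hom])
      (simp_all add: coeff_hom_poly hom_on_mult[OF R hom] hom_on_power[OF R hom] polys_def
        subfield_mult[OF R] subfield_power[OF R])
qed

lemma degree_hom_poly: "f \<in> polys R \<Longrightarrow> degree (map_poly \<phi> f) = degree f"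
  by (cases "f = 0") (auto intro!: map_poly_degree_eq simp: hom_on_eq_0_iff[OF R hom] polys_def)

lemma hom_poly_eq_0_iff: "f \<in> polys R \<Longrightarrow> map_poly \<phi> f = 0 \<longleftrightarrow> f = 0"
  by (auto simp: poly_eq_iff coeff_hom_poly hom_on_eq_0_iff[OF R hom] polys_def)

text \<open>The extension is R[a], already a field because \<open>a\<close> is algebraic. Sending
  g(a) to the value at \<open>b\<close> of the image of g is well defined exactly when
  \<open>b\<close> satisfies the images of all relations of \<open>a\<close>. Stating this for all
  relations, not through a minimal polynomial, makes it applicable to any description of
  conjugacy.\<close>

lemma hom_on_adjoin:
  assumes f: "f \<in> polys R" "f \<noteq> 0" "poly f a = 0"
    and b: "\<And>g. g \<in> polys R \<Longrightarrow> poly g a = 0 \<Longrightarrow> poly (map_poly \<phi> g) b = 0"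
  shows "\<exists>R' \<psi>. is_subfield R' \<and> R \<subseteq> R' \<and> a \<in> R' \<and> hom_on R' \<psi> \<and> (\<forall>x\<in>R. \<psi> x = \<phi> x) \<and> \<psi> a = b"
proof -
  define R' where "R' = (\<lambda>g. poly g a) ` polys R"
  \<comment> \<open>The representing polynomial is chosen arbitrarily; by the hypothesis on
    \<open>b\<close> the value does not depend on it.\<close>
  define \<psi> where "\<psi> = (\<lambda>x. poly (map_poly \<phi> (SOME g. g \<in> polys R \<and> poly g a = x)) b)"
  have \<psi>: "\<psi> (poly g a) = poly (map_poly \<phi> g) b" if g: "g \<in> polys R" for g
  proof -
    define h where "h = (SOME h. h \<in> polys R \<and> poly h a = poly g a)"
    have h: "h \<in> polys R" "poly h a = poly g a"
      unfolding h_def using someI[of "\<lambda>h. h \<in> polys R \<and> poly h a = poly g a" g] g by auto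
    have "poly (map_poly \<phi> (h - g)) b = 0"
      using h g by (intro b polys_diff[OF R]) auto
    then show ?thesis using h(1) g by (simp add: hom_poly_diff \<psi>_def h_def)
  qed
  have const: "poly [:x:] a = x" "poly (map_poly \<phi> [:x:]) b = \<phi> x" for x
    by (simp_all add: map_poly_pCons hom_on_0[OF R hom])
  have sub: "R \<subseteq> R'" "\<forall>x\<in>R. \<psi> x = \<phi> x"
    using const polys_const[OF R] \<psi> unfolding R'_def by (metis image_eqI subsetI, metis)
  have X: "[:0, 1:] \<in> polys R" using polys_linear[OF R subfield_0[OF R]] .
  have a: "a \<in> R'" unfolding R'_def by (rule image_eqI[OF _ X]) simp
  have mX: "map_poly \<phi> [:0, 1:] = [:0, 1:]"
    by (simp add: map_poly_pCons hom_on_0[OF R hom] hom_on_1[OF R hom])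
  have \<psi>a: "\<psi> a = b" using \<psi>[OF X] by (simp add: mX)
  obtain m where m: "m \<in> polys R" "m \<noteq> 0" "poly m a = 0"
    and min: "\<And>g. g \<in> polys R \<Longrightarrow> g \<noteq> 0 \<Longrightarrow> poly g a = 0 \<Longrightarrow> degree m \<le> degree g"
    using ex_has_least_nat[of "\<lambda>g. g \<in> polys R \<and> g \<noteq> 0 \<and> poly g a = 0" f degree] f by blast
  \<comment> \<open>Euclidean descent on the degree: m = q g + r gives r(a) = - q(a) g(a), where
    q(a) is nonzero since q has smaller degree than the minimal polynomial \<open>m\<close>. An
    inverse of r(a) then yields one of g(a).\<close>
  have inv: "\<exists>k\<in>polys R. poly k a * poly g a = 1"
    if "g \<in> polys R" "poly g a \<noteq> 0" "degree g < degree m" for g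
    using that
  proof (induction "degree g" arbitrary: g rule: less_induct)
    case less
    show ?case
    proof (cases "degree g = 0")
      case True
      then obtain c where c: "g = [:c:]" by (metis degree_eq_zeroE)
      then have "c \<in> R" "c \<noteq> 0" using less.prems by (auto simp: polys_def dest: spec[of _ 0])
      then show ?thesis using polys_const[OF R subfield_inverse[OF R]] c
        by (intro bexI[of _ "[:inverse c:]"]) auto
    next
      case False
      have g0: "g \<noteq> 0" using less.prems by auto
      obtain q r where qr: "q \<in> polys R" "r \<in> polys R" "m = q * g + r" "r = 0 \<or> degree r < degree g"
        using polys_division[OF R less.prems(1) g0 m(1)] by blast
      have q0: "q \<noteq> 0" using qr less.prems(3) m(2) by auto
      have "degree m = degree q + degree g"
      proof -
        have "degree (q * g) = degree q + degree g" using q0 g0 by (rule degree_mult_eq)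
        then have "degree (q * g + r) = degree (q * g)"
          using qr(4) degree_add_eq_left[of r "q * g"] by (cases "r = 0") auto
        then show ?thesis using qr(3) q0 g0 by (simp add: degree_mult_eq)
      qed
      then have "degree q < degree m" using False by simp
      then have qa: "poly q a \<noteq> 0" using min[OF qr(1) q0] by force
      have ra: "poly r a = - (poly q a * poly g a)"
        using m(3) qr(3) by (simp add: eq_neg_iff_add_eq_0 add.commute)
      then have ra0: "poly r a \<noteq> 0" using qa less.prems(2) by simp
      then have "degree r < degree g" using qr(4) by auto
      then obtain k where k: "k \<in> polys R" "poly k a * poly r a = 1"
        using less.hyps[of r] qr(2) ra0 less.prems(3) by auto
      have "poly (- k * q) a * poly g a = 1" using k(2) ra by (simp add: algebra_simps)
      then show ?thesis using polys_mult[OF R polys_uminus[OF R k(1)] qr(1)] by blast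
    qed
  qed
  have R': "is_subfield R'"
  proof (rule is_subfieldI)
    show "0 \<in> R'" "1 \<in> R'" using sub(1) subfield_0[OF R] subfield_1[OF R] by auto
  next
    fix x y assume "x \<in> R'" "y \<in> R'"
    then obtain g h where gh: "g \<in> polys R" "h \<in> polys R" "x = poly g a" "y = poly h a"
      unfolding R'_def by auto
    show "x + y \<in> R'" "x * y \<in> R'" "- x \<in> R'"
      using gh polys_add[OF R gh(1,2)] polys_mult[OF R gh(1,2)] polys_uminus[OF R gh(1)]
      unfolding R'_def by (metis (no_types, lifting) image_eqI poly_add poly_mult poly_minus)+
  next
    fix x assume "x \<in> R'" "x \<noteq> 0"
    then obtain g where g: "g \<in> polys R" "x = poly g a" unfolding R'_def by auto
    obtain q r where qr: "q \<in> polys R" "r \<in> polys R" "g = q * m + r" "r = 0 \<or> degree r < degree m"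
      using polys_division[OF R m(1,2) g(1)] by blast
    have x: "x = poly r a" using g qr(3) m(3) by simp
    then have "degree r < degree m" using qr(4) \<open>x \<noteq> 0\<close> by auto
    then obtain k where "k \<in> polys R" "poly k a * x = 1"
      using inv[of r] qr(2) x \<open>x \<noteq> 0\<close> by auto
    then show "inverse x \<in> R'" unfolding R'_def
      using \<open>x \<noteq> 0\<close> by (metis (no_types, lifting) image_eqI inverse_unique mult.commute)
  qed
  have "hom_on R' \<psi>"
    unfolding hom_on_def
  proof (intro conjI ballI)
    show "\<psi> 1 = 1" using sub(2) subfield_1[OF R] hom_on_1[OF R hom] by auto
  next
    fix x y assume "x \<in> R'" "y \<in> R'"
    then obtain g h where gh: "g \<in> polys R" "h \<in> polys R" "x = poly g a" "y = poly h a"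
      unfolding R'_def by auto
    show "\<psi> (x + y) = \<psi> x + \<psi> y"
      using \<psi>[OF polys_add[OF R gh(1,2)]] \<psi>[OF gh(1)] \<psi>[OF gh(2)] gh
      by (simp add: hom_poly_add)
    show "\<psi> (x * y) = \<psi> x * \<psi> y"
      using \<psi>[OF polys_mult[OF R gh(1,2)]] \<psi>[OF gh(1)] \<psi>[OF gh(2)] gh
      by (simp add: hom_poly_mult)
  qed
  then show ?thesis using R' sub a \<psi>a by blast
qed

text \<open>Splitting of the image of \<open>f\<close> takes the place of algebraic closedness of
  the target: the minimal polynomial of \<open>a\<close> divides \<open>f\<close>, so its image
  divides a product of linear factors and has a root to which \<open>a\<close> can be sent.\<close>

lemma hom_on_extend_root:
  assumes f: "f \<in> polys R" "f \<noteq> 0" "poly f a = 0"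
    and split: "map_poly \<phi> f = smult c (\<Prod>b\<in>B. [:- b, 1:])" and "finite B"
  shows "\<exists>R' \<psi>. is_subfield R' \<and> R \<subseteq> R' \<and> a \<in> R' \<and> hom_on R' \<psi> \<and> (\<forall>x\<in>R. \<psi> x = \<phi> x)"
proof -
  obtain m where m: "m \<in> polys R" "m \<noteq> 0" "poly m a = 0"
    and min: "\<And>g. g \<in> polys R \<Longrightarrow> g \<noteq> 0 \<Longrightarrow> poly g a = 0 \<Longrightarrow> degree m \<le> degree g"
    using ex_has_least_nat[of "\<lambda>g. g \<in> polys R \<and> g \<noteq> 0 \<and> poly g a = 0" f degree] f by blast
  have dvd: "\<exists>q\<in>polys R. g = q * m" if g: "g \<in> polys R" "poly g a = 0" for g
  proof -
    obtain q r where qr: "q \<in> polys R" "r \<in> polys R" "g = q * m + r" "r = 0 \<or> degree r < degree m"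
      using polys_division[OF R m(1,2) g(1)] by blast
    then have "poly r a = 0" using g(2) m(3) by simp
    then have "r = 0" using min[of r] qr by force
    then show ?thesis using qr by auto
  qed
  have "degree m \<noteq> 0"
  proof
    assume "degree m = 0"
    then obtain c where "m = [:c:]" by (rule degree_eq_zeroE)
    then show False using m(2,3) by simp
  qed
  obtain q where q: "q \<in> polys R" "f = q * m" using dvd f by blast
  have fac: "smult c (\<Prod>b\<in>B. [:- b, 1:]) = map_poly \<phi> q * map_poly \<phi> m"
    using split q m by (simp add: hom_poly_mult)
  have nz: "map_poly \<phi> q * map_poly \<phi> m \<noteq> 0"
    using hom_poly_eq_0_iff f split fac by metis
  have "\<exists>b. poly (map_poly \<phi> m) b = 0"
  proof (rule ccontr)
    assume no: "\<not> (\<exists>b. poly (map_poly \<phi> m) b = 0)"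
    have "c \<noteq> 0" using nz fac by auto
    have "map_poly \<phi> m dvd smult c (\<Prod>b\<in>B. [:- b, 1:])" unfolding fac by simp
    then have "map_poly \<phi> m dvd (\<Prod>b\<in>B. [:- b, 1:])"
      using \<open>c \<noteq> 0\<close> by (simp add: dvd_smult_iff)
    then have "degree (map_poly \<phi> m) = 0"
      using degree_eq_0_if_no_root[OF \<open>finite B\<close>] no by blast
    then show False using \<open>degree m \<noteq> 0\<close> degree_hom_poly[OF m(1)] by simp
  qed
  then obtain b where b: "poly (map_poly \<phi> m) b = 0" by blast
  have "poly (map_poly \<phi> g) b = 0" if "g \<in> polys R" "poly g a = 0" for g
    using dvd[OF that] b m(1) by (auto simp: hom_poly_mult)
  then show ?thesis using hom_on_adjoin[OF f] by blast
qed

end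

lemma hom_on_extend_finite:
  assumes "finite A" "is_subfield R" "hom_on R \<phi>"
    and "\<And>a. a \<in> A \<Longrightarrow> \<exists>f c B. f \<in> polys R \<and> f \<noteq> 0 \<and> poly f a = 0 \<and> finite B \<and>
            map_poly \<phi> f = smult c (\<Prod>b\<in>B. [:- b, 1:])"
  shows "\<exists>R' \<psi>. is_subfield R' \<and> R \<subseteq> R' \<and> A \<subseteq> R' \<and> hom_on R' \<psi> \<and> (\<forall>x\<in>R. \<psi> x = \<phi> x)"
  using assms(1,4)
proof (induction A rule: finite_induct)
  case empty
  then show ?case using assms by blast
next
  case (insert a A)
  then obtain R' \<psi> where R': "is_subfield R'" "R \<subseteq> R'" "A \<subseteq> R'" "hom_on R' \<psi>" "\<forall>x\<in>R. \<psi> x = \<phi> x"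
    by auto
  obtain f c B where f: "f \<in> polys R" "f \<noteq> 0" "poly f a = 0" "finite B"
    "map_poly \<phi> f = smult c (\<Prod>b\<in>B. [:- b, 1:])" using insert.prems[of a] by auto
  \<comment> \<open>The coefficients of \<open>f\<close> lie in the original \<open>R\<close>, where
    \<open>\<psi>\<close> and \<open>\<phi>\<close> agree, so the splitting survives every
    adjunction.\<close>
  have "map_poly \<psi> f = map_poly \<phi> f"
    using f(1) R'(5) by (intro poly_eqI)
      (simp add: coeff_hom_poly[OF R'(1,4)] coeff_hom_poly[OF assms(2,3)] polys_def)
  then obtain R'' \<psi>' where "is_subfield R''" "R' \<subseteq> R''" "a \<in> R''" "hom_on R'' \<psi>'" "\<forall>x\<in>R'. \<psi>' x = \<psi> x"
    using hom_on_extend_root[OF R'(1,4), of f a c B] f polys_mono[OF R'(2)] by force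
  then show ?case using R' by (intro exI[of _ R''] exI[of _ \<psi>']) auto
qed

section \<open>Rational functions of a non-constant Laurent series\<close>

abbreviation cst :: "complex \<Rightarrow> complex fls" where "cst \<equiv> fls_const"

lemma hom_on_cst: "hom_on UNIV cst"
  by (simp add: hom_on_def fls_plus_const fls_const_mult_const)

lemma is_subfield_UNIV: "is_subfield UNIV"
  by (simp add: is_subfield_def)

definition ev :: "complex poly \<Rightarrow> complex fls \<Rightarrow> complex fls" where
  "ev p x = poly (map_poly cst p) x"

lemma ev_0 [simp]: "ev 0 x = 0" and ev_1 [simp]: "ev 1 x = 1"
  and ev_pCons: "ev (pCons c p) x = cst c + x * ev p x"
  and ev_const [simp]: "ev [:c:] x = cst c"
  and ev_X [simp]: "ev [:0, 1:] x = x"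
  by (simp_all add: ev_def map_poly_pCons)

lemma ev_add [simp]: "ev (p + q) x = ev p x + ev q x"
  and ev_diff [simp]: "ev (p - q) x = ev p x - ev q x"
  and ev_mult [simp]: "ev (p * q) x = ev p x * ev q x"
  using hom_poly_add[OF is_subfield_UNIV hom_on_cst, of p q]
    hom_poly_diff[OF is_subfield_UNIV hom_on_cst, of p q]
    hom_poly_mult[OF is_subfield_UNIV hom_on_cst, of p q]
  by (simp_all add: ev_def polys_def)

lemma ev_uminus [simp]: "ev (- p) x = - ev p x"
  using ev_diff[of 0 p x] by simp

lemma ev_power [simp]: "ev (p ^ n) x = ev p x ^ n"
  by (induction n) simp_all

lemma ev_sum: "ev (sum f A) x = (\<Sum>i\<in>A. ev (f i) x)"
  by (induction A rule: infinite_finite_induct) simp_all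

lemma ev_monom [simp]: "ev (monom c n) x = cst c * x ^ n"
  by (simp add: ev_def map_poly_monom poly_monom)

lemma ev_altdef: "ev p x = (\<Sum>i\<le>degree p. cst (coeff p i) * x ^ i)"
  by (subst poly_as_sum_of_monoms[of p, symmetric]) (simp only: ev_sum ev_monom)

text \<open>A nonconstant series is transcendental over the complex numbers: a polynomial splits
  into linear factors, none of which vanishes at \<open>x\<close>.\<close>

lemma ev_eq_0_iff:
  assumes "x \<notin> range cst"
  shows "ev p x = 0 \<longleftrightarrow> p = 0"
proof
  assume "ev p x = 0"
  then show "p = 0"
  proof (induction "degree p" arbitrary: p rule: less_induct)
    case less
    show ?case
    proof (cases "degree p = 0")
      case True
      then obtain c where "p = [:c:]" by (rule degree_eq_zeroE)
      then show ?thesis using less.prems by simp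
    next
      case False
      then have "\<not> constant (poly p)" by (simp add: constant_degree)
      then obtain z where "poly p z = 0" using fundamental_theorem_of_algebra by blast
      then obtain q where q: "p = [:- z, 1:] * q" by (auto simp: poly_eq_0_iff_dvd)
      have "ev [:- z, 1:] x = x - cst z"
        by (simp add: ev_pCons)
      then have "ev [:- z, 1:] x \<noteq> 0" using assms by auto
      moreover have "ev [:- z, 1:] x * ev q x = 0" using less.prems unfolding q ev_mult .
      ultimately have "ev q x = 0" by simp
      have "q \<noteq> 0" using False q by auto
      then have "degree p = Suc (degree q)" unfolding q by (subst degree_mult_eq) auto
      then have "q = 0" using less.hyps[of q] \<open>ev q x = 0\<close> by simp
      then show ?thesis using q by simp
    qed
  qed
qed simp

section \<open>The field C(x) of rational functions of a series\<close>

definition ratf :: "complex fls \<Rightarrow> complex fls set" where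
  "ratf x = {ev p x / ev q x | p q. ev q x \<noteq> 0}"

lemma ratfI: "ev q x \<noteq> 0 \<Longrightarrow> ev p x / ev q x \<in> ratf x"
  by (auto simp: ratf_def)

lemma ev_in_ratf: "ev p x \<in> ratf x"
  using ratfI[of 1 x p] by simp

lemma cst_in_ratf: "cst c \<in> ratf x" and X_in_ratf: "x \<in> ratf x"
  using ev_in_ratf[of "[:c:]" x] ev_in_ratf[of "[:0, 1:]" x] by simp_all

lemma is_subfield_ratf: "is_subfield (ratf x)"
proof (rule is_subfieldI)
  show "0 \<in> ratf x" "1 \<in> ratf x" using ev_in_ratf[of 0 x] ev_in_ratf[of 1 x] by simp_all
next
  fix y z assume "y \<in> ratf x" "z \<in> ratf x"
  then obtain p q p' q' where e: "y = ev p x / ev q x" "z = ev p' x / ev q' x" "ev q x \<noteq> 0" "ev q' x \<noteq> 0"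
    unfolding ratf_def by blast
  have "y + z = ev (p * q' + p' * q) x / ev (q * q') x"
    unfolding e(1,2) using e(3,4) by (simp add: add_frac_eq)
  then show "y + z \<in> ratf x" using e(3,4) ratfI[of "q * q'" x "p * q' + p' * q"] by simp
  have "y * z = ev (p * p') x / ev (q * q') x" unfolding e(1,2) by simp
  then show "y * z \<in> ratf x" using e(3,4) ratfI[of "q * q'" x "p * p'"] by simp
next
  fix y assume "y \<in> ratf x"
  then obtain p q where e: "y = ev p x / ev q x" "ev q x \<noteq> 0" unfolding ratf_def by blast
  then have "- y = ev (- p) x / ev q x" by simp
  then show "- y \<in> ratf x" using e ratfI by metis
  assume "y \<noteq> 0"
  then have "inverse y = ev q x / ev p x" "ev p x \<noteq> 0" using e by auto
  then show "inverse y \<in> ratf x" using ratfI by metis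
qed

lemma ev_in_subfield:
  assumes "is_subfield R" "range cst \<subseteq> R" "x \<in> R"
  shows "ev p x \<in> R"
  using assms unfolding ev_altdef
  by (intro subfield_sum subfield_mult subfield_power) auto

lemma hom_ev:
  assumes "is_subfield R" "hom_on R \<phi>" "range cst \<subseteq> R" "x \<in> R" "\<And>c. \<phi> (cst c) = cst c"
  shows "\<phi> (ev p x) = ev p (\<phi> x)"
proof -
  have "cst c \<in> R" for c using assms(3) by auto
  then show ?thesis unfolding ev_altdef
    using assms by (subst hom_on_sum[OF assms(1,2)])
      (simp_all add: hom_on_mult[OF assms(1,2)] hom_on_power[OF assms(1,2)] subfield_power subfield_mult)
qed

text \<open>Both series are transcendental, so C(a) and C(b) are copies of the rational function
  field. The value is read off from any representing fraction; a relation between two fractions at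
  \<open>a\<close> is an identity of polynomials and therefore holds at \<open>b\<close>
  too.\<close>

lemma hom_on_ratf:
  assumes a: "a \<notin> range cst" and b: "b \<notin> range cst"
  shows "\<exists>\<phi>. hom_on (ratf a) \<phi> \<and> (\<forall>c. \<phi> (cst c) = cst c) \<and> \<phi> a = b"
proof -
  define S where "S z pq \<longleftrightarrow> ev (snd pq) a \<noteq> 0 \<and> z = ev (fst pq) a / ev (snd pq) a" for z pq
  define \<phi> where "\<phi> z = (let pq = SOME pq. S z pq in ev (fst pq) b / ev (snd pq) b)" for z
  have \<phi>: "\<phi> (ev p a / ev q a) = ev p b / ev q b" if "ev q a \<noteq> 0" for p q
  proof -
    let ?z = "ev p a / ev q a"
    define pq where "pq = (SOME pq. S ?z pq)"
    have "S ?z (p, q)" using that by (simp add: S_def)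
    then have "S ?z pq" unfolding pq_def by (rule someI)
    then have *: "ev (snd pq) a \<noteq> 0" "ev p a / ev q a = ev (fst pq) a / ev (snd pq) a"
      by (simp_all add: S_def)
    then have "ev (p * snd pq - fst pq * q) a = 0" using that by (simp add: field_simps)
    then have "p * snd pq - fst pq * q = 0" using ev_eq_0_iff[OF a] by blast
    then have "p * snd pq = fst pq * q" by simp
    then have "ev p b * ev (snd pq) b = ev (fst pq) b * ev q b" by (metis ev_mult)
    moreover have "ev (snd pq) b \<noteq> 0" "ev q b \<noteq> 0"
      using * that ev_eq_0_iff[OF a] ev_eq_0_iff[OF b] by auto
    ultimately have "ev (fst pq) b / ev (snd pq) b = ev p b / ev q b" by (simp add: frac_eq_eq)
    then show ?thesis by (simp add: \<phi>_def Let_def pq_def)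
  qed
  have \<phi>_ev: "\<phi> (ev p a) = ev p b" for p using \<phi>[of 1 p] by simp
  have "hom_on (ratf a) \<phi>"
    unfolding hom_on_def
  proof (intro conjI ballI)
    show "\<phi> 1 = 1" using \<phi>_ev[of 1] by simp
  next
    fix y z assume "y \<in> ratf a" "z \<in> ratf a"
    then obtain p q p' q' where e: "y = ev p a / ev q a" "z = ev p' a / ev q' a"
      and nz: "ev q a \<noteq> 0" "ev q' a \<noteq> 0"
      unfolding ratf_def by blast
    have nzb: "ev q b \<noteq> 0" "ev q' b \<noteq> 0" "ev (q * q') a \<noteq> 0"
      using nz ev_eq_0_iff[OF a] ev_eq_0_iff[OF b] by auto
    have 1: "y + z = ev (p * q' + p' * q) a / ev (q * q') a"
      unfolding e using nz by (simp add: add_frac_eq)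
    have 2: "y * z = ev (p * p') a / ev (q * q') a" unfolding e by simp
    show "\<phi> (y + z) = \<phi> y + \<phi> z" unfolding 1 \<phi>[OF nzb(3)] unfolding e
      using nz nzb by (simp add: \<phi> add_frac_eq)
    show "\<phi> (y * z) = \<phi> y * \<phi> z" unfolding 2 \<phi>[OF nzb(3)] unfolding e
      using nz nzb by (simp add: \<phi>)
  qed
  moreover have "\<phi> (cst c) = cst c" for c using \<phi>_ev[of "[:c:]"] by simp
  moreover have "\<phi> a = b" using \<phi>_ev[of "[:0, 1:]"] by simp
  ultimately show ?thesis by blast
qed

subsection \<open>Conjugacy over the field of rational functions\<close>

text \<open>For a polynomial in Y with coefficients in C[X], only X is specialised, to the series
  \<open>x\<close>.\<close>

definition ev2 :: "complex poly poly \<Rightarrow> complex fls \<Rightarrow> complex fls poly" where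
  "ev2 Q x = map_poly (\<lambda>c. ev c x) Q"

lemma coeff_ev2: "coeff (ev2 Q x) i = ev (coeff Q i) x"
  by (simp add: ev2_def coeff_map_poly)

lemma ev2_0 [simp]: "ev2 0 x = 0"
  by (simp add: ev2_def)

lemma ev2_add: "ev2 (P + Q) x = ev2 P x + ev2 Q x"
  and ev2_smult: "ev2 (Polynomial.smult c P) x = Polynomial.smult (ev c x) (ev2 P x)"
  by (rule poly_eqI; simp add: coeff_ev2)+

lemma ev2_mult: "ev2 (P * Q) x = ev2 P x * ev2 Q x"
  by (rule poly_eqI) (simp add: coeff_ev2 coeff_mult ev_sum)

lemma ev2_1 [simp]: "ev2 1 x = 1"
  by (rule poly_eqI) (simp add: coeff_ev2 coeff_1)

lemma ev2_pCons: "ev2 (pCons c P) x = pCons (ev c x) (ev2 P x)"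
  by (rule poly_eqI) (simp add: coeff_ev2 coeff_pCons split: nat.split)

context
  fixes x :: "complex fls"
  assumes x: "x \<notin> range cst"
begin

lemma degree_ev2: "degree (ev2 Q x) = degree Q"
  by (cases "Q = 0") (auto simp: ev2_def ev_eq_0_iff[OF x] intro!: map_poly_degree_eq)

lemma ev2_eq_0_iff: "ev2 Q x = 0 \<longleftrightarrow> Q = 0"
  by (auto simp: poly_eq_iff coeff_ev2 ev_eq_0_iff[OF x])

end

lemma polys_ratf_clear_denominators:
  assumes "g \<in> polys (ratf x)"
  shows "\<exists>c Q. ev c x \<noteq> 0 \<and> Polynomial.smult (ev c x) g = ev2 Q x"
  using assms
proof (induction g)
  case 0
  show ?case by (intro exI[of _ 1] exI[of _ 0]) simp
next
  case (pCons a g)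
  have co: "coeff (pCons a g) i \<in> ratf x" for i using pCons.prems by (simp add: polys_def)
  have "coeff g i \<in> ratf x" for i using co[of "Suc i"] by simp
  then have "a \<in> ratf x" "g \<in> polys (ratf x)" using co[of 0] by (simp_all add: polys_def)
  then obtain c Q p q where *: "ev c x \<noteq> 0" "Polynomial.smult (ev c x) g = ev2 Q x" "a = ev p x / ev q x" "ev q x \<noteq> 0"
    using pCons.IH unfolding ratf_def by blast
  have "Polynomial.smult (ev (c * q) x) (pCons a g) = pCons (ev (c * p) x) (Polynomial.smult (ev q x) (Polynomial.smult (ev c x) g))"
    using *(3,4) by (simp add: mult.commute)
  also have "\<dots> = ev2 (pCons (c * p) (Polynomial.smult q Q)) x"
    by (simp only: * ev2_pCons ev2_smult)
  finally show ?case using * by (intro exI[of _ "c * q"]) auto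
qed

text \<open>As long as such a divisor is not constant it has a root, which can only be 0, and a
  factor X splits off.\<close>

lemma dvd_monom_complex:
  fixes p :: "complex poly"
  assumes "p dvd monom c n" "c \<noteq> 0"
  shows "\<exists>d k. d \<noteq> 0 \<and> p = monom d k"
  using assms(1)
proof (induction "degree p" arbitrary: p rule: less_induct)
  case less
  have p0: "p \<noteq> 0" using less.prems assms(2) by auto
  show ?case
  proof (cases "degree p = 0")
    case True
    then obtain d where "p = [:d:]" by (rule degree_eq_zeroE)
    then show ?thesis using p0 by (intro exI[of _ d] exI[of _ 0]) (auto simp: monom_0)
  next
    case False
    then have "\<not> constant (poly p)" by (simp add: constant_degree)
    then obtain z where z: "poly p z = 0" using fundamental_theorem_of_algebra by blast
    then have "poly (monom c n) z = 0" using less.prems by (auto simp: dvd_def)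
    then have "z = 0" using assms(2) by (simp add: poly_monom)
    then obtain q where q: "p = [:0, 1:] * q" using z by (auto simp: poly_eq_0_iff_dvd)
    then have "q dvd p" by (metis dvd_triv_right)
    moreover have "q \<noteq> 0" using p0 q by auto
    then have "degree q < degree p" using q by (simp add: degree_pCons_eq)
    ultimately obtain d k where "d \<noteq> 0" "q = monom d k" using less dvd_trans by blast
    then have "d \<noteq> 0 \<and> p = monom d (Suc k)" using q by (simp add: monom_Suc)
    then show ?thesis by blast
  qed
qed

lemma dvd_prod_linear:
  fixes p :: "'a::field poly"
  assumes "finite T" "p dvd (\<Prod>b\<in>T. [:- b, 1:])"
  shows "p = Polynomial.smult (lead_coeff p) (\<Prod>b\<in>{b\<in>T. poly p b = 0}. [:- b, 1:])"
  using assms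
proof (induction T arbitrary: p rule: finite_induct)
  case empty
  then have "degree p = 0" by (metis degree_eq_0_if_no_root empty_iff finite.emptyI)
  then obtain c where "p = [:c:]" by (rule degree_eq_zeroE)
  then show ?case by simp
next
  case (insert b T)
  obtain k where k: "[:- b, 1:] * (\<Prod>b\<in>T. [:- b, 1:]) = p * k"
    using insert.prems unfolding prod.insert[OF insert.hyps] by (elim dvdE)
  have nz: "[:- b, 1:] \<noteq> 0" by simp
  show ?case
  proof (cases "poly p b = 0")
    case True
    then obtain p' where p': "p = [:- b, 1:] * p'" by (auto simp: poly_eq_0_iff_dvd)
    have "[:- b, 1:] * (\<Prod>b\<in>T. [:- b, 1:]) = [:- b, 1:] * (p' * k)"
      unfolding k p' by (simp only: ac_simps)
    then have "p' dvd (\<Prod>b\<in>T. [:- b, 1:])" using nz mult_left_cancel dvd_triv_left by metis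
    then have IH: "p' = Polynomial.smult (lead_coeff p') (\<Prod>b\<in>{b\<in>T. poly p' b = 0}. [:- b, 1:])" (is "_ = ?rhs")
      by (rule insert.IH)
    have "lead_coeff p = lead_coeff p'" unfolding p' lead_coeff_mult by simp
    moreover have "{c \<in> insert b T. poly p c = 0} = insert b {b\<in>T. poly p' b = 0}"
      using insert.hyps unfolding p' by auto
    moreover have "(\<Prod>c\<in>insert b {b\<in>T. poly p' b = 0}. [:- c, 1:]) = [:- b, 1:] * (\<Prod>c\<in>{b\<in>T. poly p' b = 0}. [:- c, 1:])"
      using insert.hyps by (intro prod.insert) auto
    ultimately have "Polynomial.smult (lead_coeff p) (\<Prod>c\<in>{c \<in> insert b T. poly p c = 0}. [:- c, 1:]) = [:- b, 1:] * ?rhs"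
      by (simp only: mult_smult_right)
    also have "\<dots> = p" using IH p' by metis
    finally show ?thesis by (rule sym)
  next
    case False
    have "poly (p * k) b = 0" unfolding k[symmetric] poly_mult by simp
    then have "poly k b = 0" using False by simp
    then obtain k' where k': "k = [:- b, 1:] * k'" by (auto simp: poly_eq_0_iff_dvd)
    have "[:- b, 1:] * (\<Prod>b\<in>T. [:- b, 1:]) = [:- b, 1:] * (p * k')"
      unfolding k k' by (simp only: ac_simps)
    then have "p dvd (\<Prod>b\<in>T. [:- b, 1:])" using nz mult_left_cancel dvd_triv_left by metis
    then have "p = Polynomial.smult (lead_coeff p) (\<Prod>b\<in>{b\<in>T. poly p b = 0}. [:- b, 1:])" by (rule insert.IH)
    moreover have "{c \<in> insert b T. poly p c = 0} = {b\<in>T. poly p b = 0}" using False by auto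
    ultimately show ?thesis by simp
  qed
qed

text \<open>Conjugacy over C(x) is read off in the factorial ring C[X][Y]: a prime factor
  \<open>m\<close> of \<open>F\<close> vanishing at \<open>a\<close> serves as minimal polynomial.
  Its extreme coefficients divide those of \<open>F\<close>, hence become monomials in
  \<open>x\<close>, and by Vieta the product of its roots is a constant times a power of
  \<open>x\<close>.\<close>

lemma conjugates_prod:
  fixes F :: "complex poly poly"
  assumes x: "x \<notin> range cst"
    and F: "ev2 F x = Polynomial.smult c (\<Prod>b\<in>T. [:- b, 1:])" "c \<noteq> 0" "finite T"
    and lc: "lead_coeff F = monom \<beta> n" "\<beta> \<noteq> 0" and cc: "coeff F 0 = monom \<alpha> n'" "\<alpha> \<noteq> 0"
    and a: "a \<in> T"
  shows "\<exists>C. C \<subseteq> T \<and> a \<in> C \<and> (\<exists>\<gamma> k. \<gamma> \<noteq> 0 \<and> \<Prod>C = cst \<gamma> * x powi k) \<and>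
    (\<forall>b\<in>T. b \<in> C \<longleftrightarrow> (\<forall>G. poly (ev2 G x) a = 0 \<longrightarrow> poly (ev2 G x) b = 0))"
proof -
  have x0: "x \<noteq> 0" using x by (metis fls_const_0 rangeI)
  have F0: "F \<noteq> 0" using lc by auto
  have Fa: "poly (ev2 F x) a = 0" unfolding F using a F(3) by (simp add: poly_prod)
  obtain A where A: "\<And>m. m \<in># A \<Longrightarrow> prime_elem m" "normalize (prod_mset A) = normalize F"
    using prime_factorization_exists[OF F0] by blast
  have dvd: "F dvd prod_mset A" "prod_mset A dvd F" using A(2) by (auto simp: associated_iff_dvd)
  have "poly (ev2 (prod_mset A) x) a = 0" using dvd(1) Fa by (auto simp: dvd_def ev2_mult)
  then have "\<exists>m\<in>#A. poly (ev2 m x) a = 0"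
    by (induction A) (auto simp: ev2_mult)
  then obtain m where m: "m \<in># A" "poly (ev2 m x) a = 0" by blast
  have pm: "prime_elem m" using A m by blast
  have "m dvd F" using m(1) dvd(2) by (meson dvd_prod_mset dvd_trans)
  then obtain k where k: "F = m * k" by (elim dvdE)
  have m0: "m \<noteq> 0" using k F0 by auto
  define p where "p = ev2 m x"
  define O' where "O' = {b\<in>T. poly p b = 0}"
  have p0: "p \<noteq> 0" using ev2_eq_0_iff[OF x] m0 by (simp add: p_def)
  have "p dvd Polynomial.smult c (\<Prod>b\<in>T. [:- b, 1:])" unfolding F(1)[symmetric] k ev2_mult p_def by simp
  then have "p dvd (\<Prod>b\<in>T. [:- b, 1:])" using F(2) by (simp add: dvd_smult_iff)
  then have peq: "p = Polynomial.smult (lead_coeff p) (\<Prod>b\<in>O'. [:- b, 1:])"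
    unfolding O'_def by (rule dvd_prod_linear[OF F(3)])
  have "lead_coeff F = lead_coeff m * lead_coeff k" unfolding k by (rule lead_coeff_mult)
  then obtain \<beta>' i where i: "\<beta>' \<noteq> 0" "lead_coeff m = monom \<beta>' i"
    using dvd_monom_complex[of "lead_coeff m" \<beta> n] lc by (metis dvd_triv_left)
  have "coeff F 0 = coeff m 0 * coeff k 0" unfolding k by (rule coeff_mult_0)
  then obtain \<alpha>' j where j: "\<alpha>' \<noteq> 0" "coeff m 0 = monom \<alpha>' j"
    using dvd_monom_complex[of "coeff m 0" \<alpha> n'] cc by (metis dvd_triv_left)
  have lp: "lead_coeff p = cst \<beta>' * x ^ i"
    unfolding p_def degree_ev2[OF x] coeff_ev2 i by simp
  have cp: "poly p 0 = cst \<alpha>' * x ^ j"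
    unfolding poly_0_coeff_0 p_def coeff_ev2 j by simp
  have "poly p 0 = lead_coeff p * (\<Prod>b\<in>O'. - b)" by (subst peq) (simp add: poly_prod)
  then have "cst \<alpha>' * x ^ j = cst \<beta>' * x ^ i * ((-1) ^ card O' * \<Prod>O')"
    unfolding lp cp by (simp add: prod_uminus)
  then have "\<Prod>O' = cst \<alpha>' * x ^ j / (cst \<beta>' * x ^ i * (-1) ^ card O')"
    using i x0 by (simp add: field_simps)
  also have "\<dots> = cst (\<alpha>' / (\<beta>' * (-1) ^ card O')) * x powi (int j - int i)"
  proof -
    have "cst (\<alpha>' / (\<beta>' * (-1) ^ card O')) = cst \<alpha>' / (cst \<beta>' * (-1) ^ card O')"
      by (simp add: fls_const_divide_const[symmetric] fls_const_mult_const[symmetric] fls_const_power fls_const_uminus)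
    moreover have "x powi (int j - int i) = x ^ j / x ^ i" using x0 by (simp add: power_int_diff)
    ultimately show ?thesis by simp
  qed
  finally have "\<exists>\<gamma> k. \<gamma> \<noteq> 0 \<and> \<Prod>O' = cst \<gamma> * x powi k"
    using i j by (intro exI conjI) auto
  moreover have "(\<forall>G. poly (ev2 G x) a = 0 \<longrightarrow> poly (ev2 G x) b = 0)" if b: "b \<in> O'" for b
  proof (intro allI impI)
    \<comment> \<open>\<open>\<mu>\<close> has least degree in Y among all relations of
      \<open>a\<close>, but may carry a factor from C[X]. Pseudo-division by it avoids fractions,
      and primality of \<open>m\<close> gives that \<open>m\<close> divides \<open>\<mu>\<close>; so
      every relation of \<open>a\<close> holds at every root of \<open>m\<close>.\<close>
    obtain \<mu> where \<mu>: "\<mu> \<noteq> 0" "poly (ev2 \<mu> x) a = 0"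
      and min: "\<And>g. g \<noteq> 0 \<Longrightarrow> poly (ev2 g x) a = 0 \<Longrightarrow> degree \<mu> \<le> degree g"
      using ex_has_least_nat[of "\<lambda>g. g \<noteq> 0 \<and> poly (ev2 g x) a = 0" m degree] m0 m(2) by blast
    have div: "\<exists>k. \<mu> dvd Polynomial.smult (lead_coeff \<mu> ^ k) g" if g: "poly (ev2 g x) a = 0" for g
    proof -
      obtain q r where qr: "pseudo_divmod g \<mu> = (q, r)" by force
      define k where "k = Suc (degree g) - degree \<mu>"
      have eq: "Polynomial.smult (lead_coeff \<mu> ^ k) g = \<mu> * q + r" and r: "r = 0 \<or> degree r < degree \<mu>"
        using pseudo_divmod[OF \<mu>(1) qr] by (auto simp: k_def)
      have "poly (ev2 (\<mu> * q + r) x) a = 0" unfolding eq[symmetric] ev2_smult using g by simp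
      then have "poly (ev2 r x) a = 0" using \<mu>(2) by (simp add: ev2_add ev2_mult)
      then have "r = 0" using min[of r] r by force
      then show ?thesis using eq by (intro exI[of _ k]) simp
    qed
    have l\<mu>: "ev (lead_coeff \<mu>) x \<noteq> 0" using \<mu>(1) ev_eq_0_iff[OF x] by simp
    have deg\<mu>: "degree \<mu> \<noteq> 0"
    proof
      assume "degree \<mu> = 0"
      then obtain d where "\<mu> = [:d:]" by (rule degree_eq_zeroE)
      then show False using \<mu> ev_eq_0_iff[OF x] by (simp add: ev2_pCons)
    qed
    have m\<mu>: "m dvd \<mu>"
    proof -
      obtain k where "\<mu> dvd Polynomial.smult (lead_coeff \<mu> ^ k) m" using div[OF m(2)] by blast
      then obtain q where q: "Polynomial.smult (lead_coeff \<mu> ^ k) m = \<mu> * q" by (elim dvdE)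
      have "m dvd \<mu> * q" unfolding q[symmetric] by (simp add: dvd_smult)
      then have "m dvd \<mu> \<or> m dvd q" using pm by (simp add: prime_elem_dvd_mult_iff)
      moreover have False if mq: "m dvd q"
      proof -
        obtain q' where q': "q = m * q'" using mq by (elim dvdE)
        have "m * [:lead_coeff \<mu> ^ k:] = m * (\<mu> * q')" using q unfolding q' by (simp add: ac_simps)
        then have "[:lead_coeff \<mu> ^ k:] = \<mu> * q'" using m0 mult_left_cancel by blast
        moreover have "[:lead_coeff \<mu> ^ k:] \<noteq> 0" using \<mu>(1) by simp
        ultimately have "degree [:lead_coeff \<mu> ^ k:] = degree \<mu> + degree q'" by (metis degree_mult_eq mult_eq_0_iff)
        then show False using deg\<mu> by simp
      qed
      ultimately show ?thesis by blast
    qed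
    fix G assume "poly (ev2 G x) a = 0"
    then obtain k where "\<mu> dvd Polynomial.smult (lead_coeff \<mu> ^ k) G" using div by blast
    then have "m dvd Polynomial.smult (lead_coeff \<mu> ^ k) G" using m\<mu> dvd_trans by blast
    then obtain q where "Polynomial.smult (lead_coeff \<mu> ^ k) G = m * q" by (elim dvdE)
    then have "poly (ev2 (Polynomial.smult (lead_coeff \<mu> ^ k) G) x) b = poly (ev2 m x) b * poly (ev2 q x) b"
      by (simp add: ev2_mult)
    also have "poly (ev2 m x) b = 0" using b by (simp add: O'_def p_def)
    finally show "poly (ev2 G x) b = 0" using l\<mu> by (simp add: ev2_smult)
  qed
  moreover have "b \<in> O'" if "b \<in> T" "\<forall>G. poly (ev2 G x) a = 0 \<longrightarrow> poly (ev2 G x) b = 0" for b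
    using that m(2) by (simp add: O'_def p_def)
  moreover have "O' \<subseteq> T" "a \<in> O'" using a m(2) by (auto simp: O'_def p_def)
  ultimately show ?thesis by (intro exI[of _ O']) blast
qed

section \<open>Logarithmic derivatives and residues\<close>

definition dlog :: "complex fls \<Rightarrow> complex fls" where
  "dlog a = fls_deriv a / a"

lemma dlog_mult: "a \<noteq> 0 \<Longrightarrow> b \<noteq> 0 \<Longrightarrow> dlog (a * b) = dlog a + dlog b"
  by (simp add: dlog_def field_simps)

lemma dlog_1 [simp]: "dlog 1 = 0" and dlog_cst [simp]: "dlog (cst c) = 0"
  by (simp_all add: dlog_def)

lemma dlog_inverse: "a \<noteq> 0 \<Longrightarrow> dlog (inverse a) = - dlog a"
  using dlog_mult[of a "inverse a"] by (simp add: eq_neg_iff_add_eq_0 add.commute)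

lemma dlog_power: "a \<noteq> 0 \<Longrightarrow> dlog (a ^ n) = of_nat n * dlog a"
  by (induction n) (simp_all add: dlog_mult algebra_simps)

lemma dlog_power_int: "a \<noteq> 0 \<Longrightarrow> dlog (a powi n) = of_int n * dlog a"
  by (auto simp: power_int_def dlog_power dlog_inverse power_inverse)

lemma dlog_prod: "(\<And>i. i \<in> A \<Longrightarrow> f i \<noteq> 0) \<Longrightarrow> dlog (prod f A) = (\<Sum>i\<in>A. dlog (f i))"
  by (induction A rule: infinite_finite_induct) (auto simp: dlog_mult)

lemma dlog_eq_0_iff: "a \<noteq> 0 \<Longrightarrow> dlog a = 0 \<longleftrightarrow> a \<in> range cst"
  by (auto simp: dlog_def fls_deriv_eq_0_iff)

lemma dlog_eq_iff:
  assumes "a \<noteq> 0" "b \<noteq> 0"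
  shows "dlog a = dlog b \<longleftrightarrow> (\<exists>c. c \<noteq> 0 \<and> a = cst c * b)"
proof
  assume "dlog a = dlog b"
  then have "dlog (a * inverse b) = 0" using assms by (simp add: dlog_mult dlog_inverse)
  then obtain c where "a * inverse b = cst c" using assms by (auto simp: dlog_eq_0_iff)
  then have "a = cst c * b" using assms by (simp add: field_simps)
  then show "\<exists>c. c \<noteq> 0 \<and> a = cst c * b" using assms by (intro exI[of _ c]) auto
next
  assume "\<exists>c. c \<noteq> 0 \<and> a = cst c * b"
  then obtain c where "c \<noteq> 0" "a = cst c * b" by blast
  then show "dlog a = dlog b" using assms by (simp add: dlog_mult)
qed

lemma dlog_residue:
  assumes "a \<noteq> 0"
  shows "dlog a $$ (- 1) = of_int (fls_subdegree a)"
  using fls_residue_deriv_times_inverse_eq_subdegree[of a] by (simp add: dlog_def divide_inverse)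

lemma dlog_nth_eq_0:
  assumes "n < - 1"
  shows "dlog a $$ n = 0"
proof (cases "a = 0 \<or> fls_deriv a = 0")
  case False
  then have a: "a \<noteq> 0" "fls_deriv a \<noteq> 0" by auto
  have "fls_subdegree a - 1 \<le> fls_subdegree (fls_deriv a)"
    using a(2) by (intro fls_subdegree_geI) auto
  moreover have "fls_subdegree (dlog a) = fls_subdegree (fls_deriv a) - fls_subdegree a"
    using a by (simp add: dlog_def divide_inverse)
  ultimately show ?thesis using assms by (intro fls_eq0_below_subdegree) simp
qed (auto simp: dlog_def)

text \<open>For nonzero \<open>k\<close> the series is the derivative of a^k / k, and derivatives
  have no residue.\<close>

lemma residue_power_int_dlog:
  assumes "a \<noteq> 0"
  shows "(a powi k * dlog a) $$ (- 1) = (if k = 0 then of_int (fls_subdegree a) else 0)"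
proof (cases "k = 0")
  case False
  have "fls_deriv (a powi k) = of_int k * (a powi k * dlog a)"
    using dlog_power_int[OF assms, of k] assms by (simp add: dlog_def field_simps)
  then have "of_int k * (a powi k * dlog a) $$ (- 1) = 0"
    using fls_deriv_residue[of "a powi k"] by simp
  then show ?thesis using False by simp
qed (simp add: dlog_residue assms)

lemma residue_dlog_positive:
  assumes "a \<noteq> 0" "F \<noteq> 0 \<Longrightarrow> fls_subdegree F > 0"
  shows "(F * dlog a) $$ (- 1) = 0"
proof (cases "F = 0 \<or> dlog a = 0")
  case False
  then have "- 1 \<le> fls_subdegree (dlog a)" by (intro fls_subdegree_geI) (auto intro: dlog_nth_eq_0)
  then show ?thesis using assms False by (intro fls_times_nth_eq0) auto
qed auto

lemma X_intpow_mult_nth: "(fls_X_intpow k * F) $$ n = (F :: complex fls) $$ (n - k)"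
  by (simp add: fls_shifted_times_simps)

section \<open>Rotations of the variable\<close>

definition rot :: "complex \<Rightarrow> complex fls \<Rightarrow> complex fls" where
  "rot c F = fls_compose_fps F (fps_const c * fps_X)"

context
  fixes c :: complex
  assumes c: "c \<noteq> 0"
begin

lemma rot_nth: "rot c F $$ n = F $$ n * c powi n"
  unfolding rot_def by (rule fls_nth_fls_compose_fps_linear[OF c])

lemma rot_cst [simp]: "rot c (cst z) = cst z" and rot_0: "rot c 0 = 0" and rot_1: "rot c 1 = 1"
  by (simp_all add: rot_def)

lemma rot_add: "rot c (F + G) = rot c F + rot c G"
  by (rule fls_eqI) (simp add: rot_nth algebra_simps)

lemma rot_mult: "rot c (F * G) = rot c F * rot c G"
  unfolding rot_def using c by (intro fls_compose_fps_mult) auto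

lemma hom_on_rot: "hom_on UNIV (rot c)"
  by (simp add: hom_on_def rot_add rot_mult rot_1)

lemmas rot_inverse = hom_on_inverse[OF is_subfield_UNIV hom_on_rot UNIV_I]
lemmas rot_divide = hom_on_divide[OF is_subfield_UNIV hom_on_rot UNIV_I UNIV_I]
lemmas rot_power = hom_on_power[OF is_subfield_UNIV hom_on_rot UNIV_I]
lemmas rot_eq_0_iff = hom_on_eq_0_iff[OF is_subfield_UNIV hom_on_rot UNIV_I]

lemma rot_ev: "rot c (ev p x) = ev p (rot c x)"
  by (rule hom_ev[OF is_subfield_UNIV hom_on_rot]) auto

lemma rot_subdegree: "fls_subdegree (rot c F) = fls_subdegree F"
proof (cases "F = 0")
  case False
  then show ?thesis using c by (intro fls_subdegree_eqI) (auto simp: rot_nth)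
qed (simp add: rot_0)

lemma rot_X_intpow: "rot c (fls_X_intpow k) = cst (c powi k) * fls_X_intpow k"
  by (rule fls_eqI) (simp add: rot_nth)

text \<open>The factor \<open>c\<close> comes from the chain rule. It shifts the exponent by one,
  which is why later formulas address the coefficient at n - 1.\<close>

lemma rot_dlog: "dlog (rot c F) = cst c * rot c (dlog F)"
proof -
  have "fls_deriv (rot c F) = cst c * rot c (fls_deriv F)"
    by (rule fls_eqI) (simp add: rot_nth c power_int_add)
  then show ?thesis by (simp add: dlog_def rot_divide)
qed

lemma rot_dlog_nth: "dlog (rot c F) $$ (n - 1) = c powi n * dlog F $$ (n - 1)"
proof -
  have "c * c powi (n - 1) = c powi n" using c by (simp add: power_int_diff)
  then show ?thesis by (simp add: rot_dlog rot_nth)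
qed

end

lemma rot_rot: "c \<noteq> 0 \<Longrightarrow> d \<noteq> 0 \<Longrightarrow> rot c (rot d F) = rot (c * d) F"
  by (rule fls_eqI) (simp add: rot_nth power_int_mult_distrib)

lemma rot_one [simp]: "rot 1 F = F"
  by (rule fls_eqI) (simp add: rot_nth)

section \<open>Branches of algebraic functions as series\<close>

lemma fps_nth_root_exists:
  fixes P :: "complex fps"
  assumes "P $ 0 \<noteq> 0" "n > 0"
  shows "\<exists>g. g ^ n = P"
proof -
  obtain k where k: "n = Suc k" using assms(2) by (cases n) auto
  define r :: "nat \<Rightarrow> complex \<Rightarrow> complex" where "r m z = exp (Ln z / of_nat m)" for m z
  have "r (Suc k) (P $ 0) ^ Suc k = exp (of_nat (Suc k) * (Ln (P $ 0) / of_nat (Suc k)))"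
    unfolding r_def exp_of_nat_mult ..
  also have "\<dots> = P $ 0" using assms(1) by (simp del: of_nat_Suc)
  finally have "fps_radical r (Suc k) P ^ Suc k = P"
    using power_radical[OF assms(1)] by blast
  then show ?thesis using k by blast
qed

text \<open>\<open>G\<close> has an n-th root of order 1, and \<open>b\<close> is the compositional
  inverse of that root.\<close>

lemma fps_branch:
  fixes G :: "complex fps"
  assumes "G \<noteq> 0" "subdegree G = n" "n > 0"
  shows "\<exists>b. b $ 0 = 0 \<and> b $ 1 \<noteq> 0 \<and> G oo b = fps_X ^ n"
proof -
  define U where "U = fps_shift n G"
  have G: "G = U * fps_X ^ n" unfolding U_def using assms(2) subdegree_decompose[of G] by simp
  have "U $ 0 \<noteq> 0" using assms(1,2) by (auto simp: U_def)
  then obtain g where g: "g ^ n = U" using fps_nth_root_exists[OF _ \<open>n > 0\<close>] by blast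
  have g0: "g $ 0 \<noteq> 0"
  proof
    assume "g $ 0 = 0"
    then have "(g ^ n) $ 0 = 0" using \<open>n > 0\<close> by (simp add: fps_nth_power_0)
    then show False using g \<open>U $ 0 \<noteq> 0\<close> by simp
  qed
  define a where "a = g * fps_X"
  have a: "a $ 0 = 0" "a $ 1 \<noteq> 0" using g0 by (simp_all add: a_def)
  have an: "a ^ n = G" by (simp add: a_def power_mult_distrib g G)
  define b where "b = fps_inv a"
  have b0: "b $ 0 = 0" by (simp add: b_def fps_inv_def)
  have ab: "a oo b = fps_X" unfolding b_def by (rule fps_inv_right[OF a])
  have "fps_deriv (a oo b) $ 0 = a $ 1 * b $ 1"
    by (simp add: fps_compose_deriv[OF b0])
  then have "b $ 1 \<noteq> 0" unfolding ab by auto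
  moreover have "G oo b = fps_X ^ n"
    unfolding an[symmetric] using fps_compose_power[OF b0, of a n] ab by simp
  ultimately show ?thesis using b0 by blast
qed

lemma ev_fps:
  assumes "b $ 0 = 0"
  shows "ev P (fps_to_fls b) = fps_to_fls (fps_of_poly P oo b)"
proof (induction P)
  case (pCons c P)
  have "fps_of_poly (pCons c P) oo b = fps_const c + b * (fps_of_poly P oo b)"
    using assms by (simp add: fps_of_poly_pCons fps_compose_add_distrib fps_compose_mult_distrib mult.commute)
  then show ?case using pCons.IH by (simp add: ev_pCons fls_times_fps_to_fls fps_const_to_fls)
qed simp

text \<open>Written as t^e / P(t) = u^(e k), the equation has a left side of order \<open>e\<close>
  in t, which is inverted after extracting an e-th root. The solution is found in the variable u^k,
  whence only exponents divisible by \<open>k\<close> occur.\<close>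

lemma small_root_exists:
  assumes P0: "coeff P 0 \<noteq> 0" and e: "e > 0" and k: "k > 0"
  shows "\<exists>t. t \<noteq> 0 \<and> fls_subdegree t = int k \<and> ev P t = t ^ e * fls_X_intpow (- int (e * k)) \<and>
           (\<forall>n. t $$ n \<noteq> 0 \<longrightarrow> int k dvd n)"
proof -
  define Q where "Q = fps_of_poly P"
  have Q0: "Q $ 0 \<noteq> 0" using P0 by (simp add: Q_def)
  define G where "G = inverse Q * fps_X ^ e"
  have iQ: "inverse Q $ 0 \<noteq> 0" using Q0 by simp
  have "G \<noteq> 0" using Q0 by (simp add: G_def)
  moreover have "subdegree G = e" using iQ Q0 by (simp add: G_def)
  ultimately obtain b where b: "b $ 0 = 0" "b $ 1 \<noteq> 0" "G oo b = fps_X ^ e"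
    using fps_branch[of G e] e by blast
  have "(inverse Q oo b) * b ^ e = fps_X ^ e"
    using b(3) by (simp add: G_def fps_compose_mult_distrib[OF b(1)] fps_compose_power[OF b(1), symmetric] b(1))
  moreover have "(Q oo b) * (inverse Q oo b) = 1"
    using Q0 by (simp flip: fps_compose_mult_distrib[OF b(1)] add: inverse_mult_eq_1')
  ultimately have be: "b ^ e = fps_X ^ e * (Q oo b)"
    by (metis mult.commute mult.left_commute mult_1)
  define b' where "b' = b oo fps_X ^ k"
  have Xk: "(fps_X ^ k :: complex fps) $ 0 = 0" using k by (simp add: fps_nth_power_0)
  have b'0: "b' $ 0 = 0" by (simp add: b'_def b(1))
  have "b' ^ e = (b ^ e) oo fps_X ^ k" by (simp add: b'_def fps_compose_power[OF Xk])
  also have "\<dots> = (fps_X ^ e oo fps_X ^ k) * ((Q oo b) oo fps_X ^ k)"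
    unfolding be by (rule fps_compose_mult_distrib[OF Xk])
  also have "fps_X ^ e oo fps_X ^ k = (fps_X ^ (e * k) :: complex fps)"
    using Xk by (simp add: fps_compose_power[OF Xk, symmetric] power_mult[symmetric] mult.commute)
  also have "(Q oo b) oo fps_X ^ k = Q oo b'"
    unfolding b'_def by (rule fps_compose_assoc[OF Xk b(1), symmetric])
  finally have b'e: "b' ^ e = fps_X ^ (e * k) * (Q oo b')" .
  define t where "t = fps_to_fls b'"
  have nth: "b' $ n = (if k dvd n then b $ (n div k) else 0)" for n
    unfolding b'_def by (rule fps_nth_compose_X_power)
  have sub: "subdegree b' = k"
  proof (rule subdegreeI)
    show "b' $ k \<noteq> 0" using b(2) k by (simp add: nth)
    show "b' $ i = 0" if "i < k" for i
      using that b(1) by (cases "i = 0") (auto simp: nth dest: dvd_imp_le)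
  qed
  have t0: "t \<noteq> 0" using sub k by (auto simp: t_def)
  have "t ^ e = fls_X ^ (e * k) * ev P t"
    unfolding t_def ev_fps[OF b'0] Q_def[symmetric] fps_to_fls_power[symmetric] b'e
    by (simp add: fls_times_fps_to_fls fps_to_fls_power)
  then have "ev P t = t ^ e * fls_X_intpow (- int (e * k))"
    by (simp add: fls_X_power_conv_shift_1 fls_X_intpow_times_conv_shift mult.commute fls_shifted_times_simps)
  moreover have "int k dvd n" if "t $$ n \<noteq> 0" for n
    using that unfolding t_def by (cases "n < 0") (auto simp: nth split: if_splits simp flip: int_dvd_int_iff)
  moreover have "fls_subdegree t = int k" by (simp add: t_def fls_subdegree_fls_to_fps sub)
  ultimately show ?thesis using t0 by blast
qed

section \<open>Residues of powers of w against logarithmic derivatives of roots\<close>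

lemma fps_compose_shift:
  fixes b :: "complex fps"
  assumes "b $ 0 = 0"
  shows "g oo b = fps_const (g $ 0) + b * (fps_shift 1 g oo b)"
proof -
  have "g = fps_const (g $ 0) + fps_X * fps_shift 1 g"
    by (rule fps_ext) (auto simp: fps_X_mult_nth)
  then have "g oo b = (fps_const (g $ 0) + fps_X * fps_shift 1 g) oo b" by simp
  also have "\<dots> = fps_const (g $ 0) + b * (fps_shift 1 g oo b)"
    by (simp add: fps_compose_add_distrib fps_compose_mult_distrib[OF assms] assms)
  finally show ?thesis .
qed

lemma fps_compose_expand:
  fixes b :: "complex fps"
  assumes "b $ 0 = 0"
  shows "fps_to_fls (g oo b) = (\<Sum>k\<le>N. cst (g $ k) * fps_to_fls b ^ k) +
           fps_to_fls b ^ Suc N * fps_to_fls (fps_shift (Suc N) g oo b)"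
proof (induction N)
  case 0
  show ?case by (subst fps_compose_shift[OF assms]) (simp add: fls_times_fps_to_fls)
next
  case (Suc N)
  have "fps_to_fls (fps_shift (Suc N) g oo b) =
      cst (g $ Suc N) + fps_to_fls b * fps_to_fls (fps_shift (Suc (Suc N)) g oo b)"
  proof -
    have "fps_shift 1 (fps_shift (Suc N) g) = fps_shift (Suc (Suc N)) g" by (rule fps_ext) simp
    then show ?thesis by (subst fps_compose_shift[OF assms]) (simp add: fls_times_fps_to_fls)
  qed
  then show ?case unfolding Suc.IH by (simp add: algebra_simps)
qed

lemma root_of_unity_is_const:
  assumes "z ^ m = (1 :: complex fls)" "m > 0"
  shows "\<exists>\<zeta>. z = cst \<zeta> \<and> \<zeta> ^ m = 1"
proof -
  have "ev (monom 1 m - 1) z = 0" using assms by simp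
  moreover have "coeff (monom 1 m - 1 :: complex poly) m \<noteq> 0" using assms(2) by (simp add: coeff_1)
  then have "monom 1 m - 1 \<noteq> (0 :: complex poly)" by (metis coeff_0)
  ultimately have "z \<in> range cst" using ev_eq_0_iff by blast
  then obtain \<zeta> where \<zeta>: "z = cst \<zeta>" by blast
  then have "cst (\<zeta> ^ m) = 1" using assms(1) by (simp add: fls_const_power)
  then have "\<zeta> ^ m = 1" by (metis fls_const_1 fls_const_nth)
  then show ?thesis using \<zeta> by blast
qed

text \<open>With g = P^(1/m) the equation says that y a^N equals \<zeta> g(a) for some m-th root of
  unity \<zeta>. When y = \<zeta> g(a) / a^N is expanded in powers of \<open>a\<close>, only the
  exponent 0 has a residue against a'/a, and that exponent carries the coefficient \<open>N\<close>
  of \<open>g\<close>. The unknown \<zeta> disappears in the m-th power.\<close>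

lemma residue_small_root_fractional:
  assumes a: "a \<noteq> 0" "fls_subdegree a > 0" and root: "ev P a = a ^ (m * N) * y ^ m"
    and m: "m > 0" and g: "g ^ m = fps_of_poly P" "g \<noteq> 0"
  shows "((y * dlog a) $$ (- 1)) ^ m = (of_int (fls_subdegree a) * g $ N) ^ m"
proof -
  obtain b where b: "a = fps_to_fls b"
    using fls_as_fps'[of a 0] a(2) by auto
  have b0: "b $ 0 = 0" using a(2) unfolding b by (simp add: fls_subdegree_fls_to_fps subdegree_pos_iff)
  have bnz: "b \<noteq> 0" using a(1) b by auto
  define G where "G = fps_to_fls (g oo b)"
  have G0: "G \<noteq> 0" using g(2) b0 bnz by (simp add: G_def fps_compose_eq_0_iff)
  have "(y * a ^ N) ^ m = G ^ m"
  proof -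
    have "(y * a ^ N) ^ m = ev P a" by (simp add: root power_mult_distrib power_mult[symmetric] mult.commute)
    also have "\<dots> = fps_to_fls ((g ^ m) oo b)" unfolding b ev_fps[OF b0] g(1) ..
    also have "\<dots> = G ^ m" by (simp add: G_def fps_compose_power[OF b0, symmetric] fps_to_fls_power)
    finally show ?thesis .
  qed
  then have "(y * a ^ N / G) ^ m = 1" using G0 by (simp add: power_divide)
  then obtain \<zeta> where \<zeta>: "y * a ^ N / G = cst \<zeta>" "\<zeta> ^ m = 1"
    using root_of_unity_is_const[OF _ m] by blast
  define H where "H = fps_to_fls (fps_shift (Suc N) g oo b)"
  have Gexp: "G = (\<Sum>k\<le>N. cst (g $ k) * a ^ k) + a ^ Suc N * H"
    unfolding G_def H_def b by (rule fps_compose_expand[OF b0])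
  have "y = cst \<zeta> * G / a ^ N" using \<zeta>(1) G0 a(1) by (simp add: field_simps)
  also have "\<dots> = cst \<zeta> * (\<Sum>k\<le>N. cst (g $ k) * a ^ k) / a ^ N + cst \<zeta> * (a ^ Suc N * H) / a ^ N"
    unfolding Gexp by (simp only: distrib_left add_divide_distrib)
  also have "cst \<zeta> * (\<Sum>k\<le>N. cst (g $ k) * a ^ k) / a ^ N = (\<Sum>k\<le>N. cst (\<zeta> * g $ k) * a powi (int k - int N))"
    unfolding sum_distrib_left sum_divide_distrib
    using a(1) by (intro sum.cong refl) (simp add: power_int_diff flip: fls_const_mult_const)
  also have "cst \<zeta> * (a ^ Suc N * H) / a ^ N = cst \<zeta> * (a * H)"
    using a(1) by simp
  finally have y: "y = (\<Sum>k\<le>N. cst (\<zeta> * g $ k) * a powi (int k - int N)) + cst \<zeta> * (a * H)" .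
  have H: "(a * H * dlog a) $$ (- 1) = 0"
  proof (rule residue_dlog_positive[OF a(1)])
    assume "a * H \<noteq> 0"
    then show "fls_subdegree (a * H) > 0"
      using a(2) fls_subdegree_fls_to_fps_gt0[of "fps_shift (Suc N) g oo b"] by (simp add: H_def)
  qed
  have "(y * dlog a) $$ (- 1) = (\<Sum>k\<le>N. \<zeta> * g $ k * (a powi (int k - int N) * dlog a) $$ (- 1))"
    using H by (subst y) (simp add: distrib_right sum_distrib_right fls_nth_sum mult.assoc)
  also have "\<dots> = (\<Sum>k\<le>N. if k = N then \<zeta> * g $ k * of_int (fls_subdegree a) else 0)"
    by (rule sum.cong) (auto simp: residue_power_int_dlog[OF a(1)])
  also have "\<dots> = \<zeta> * (of_int (fls_subdegree a) * g $ N)" by (simp add: mult_ac)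
  finally show ?thesis using \<zeta>(2) by (simp add: power_mult_distrib)
qed

text \<open>w^n = P(a)^n / a^(e n) is a Laurent polynomial in \<open>a\<close>, of which only the
  constant term has a residue against a'/a. For the shape of a walk that constant term is the n-th
  return probability.\<close>

lemma residue_root_integral:
  assumes a: "a \<noteq> 0" and root: "ev P a = a ^ e * w"
  shows "(w ^ n * dlog a) $$ (- 1) = coeff (P ^ n) (e * n) * of_int (fls_subdegree a)"
proof -
  let ?Q = "P ^ n"
  have "w ^ n = ev ?Q a / a ^ (e * n)"
    using a root by (simp add: power_mult_distrib power_mult)
  also have "\<dots> = (\<Sum>i\<le>degree ?Q. cst (coeff ?Q i) * a powi (int i - int (e * n)))"
    using a unfolding ev_altdef
    by (simp add: sum_divide_distrib power_int_diff del: of_nat_mult)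
  finally have "(w ^ n * dlog a) $$ (- 1) =
      (\<Sum>i\<le>degree ?Q. coeff ?Q i * (a powi (int i - int (e * n)) * dlog a) $$ (- 1))"
    by (simp add: sum_distrib_right fls_nth_sum mult.assoc)
  also have "\<dots> = (\<Sum>i\<le>degree ?Q. if i = e * n then coeff ?Q i * of_int (fls_subdegree a) else 0)"
    by (rule sum.cong) (auto simp: residue_power_int_dlog[OF a] simp flip: of_nat_mult)
  also have "\<dots> = coeff ?Q (e * n) * of_int (fls_subdegree a)"
    by (simp add: coeff_eq_0)
  finally show ?thesis .
qed

section \<open>The roots of a Laurent polynomial at infinity\<close>

text \<open>A Laurent polynomial \<open>\<chi>(t) = t\<^sup>-\<^sup>e P(t)\<close> is represented by the pair of \<open>P\<close> and \<open>e\<close>. The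
  equation \<open>\<chi>(t) = w\<close> is solved in Laurent series in \<open>u\<close>, where \<open>w = u\<^sup>-\<^sup>M\<close>.\<close>

lemma ev_smult [simp]: "ev (Polynomial.smult c p) x = cst c * ev p x"
  using ev_mult[of "[:c:]" p x] by simp

lemma cst_minus_one_power: "cst ((- 1) ^ n) = (- 1) ^ n"
  by (induction n) (simp_all add: fls_const_uminus)

lemma poly_eq_prod_roots:
  fixes p :: "'a::field poly"
  assumes "finite T" "card T = degree p" "\<And>a. a \<in> T \<Longrightarrow> poly p a = 0"
  shows "p = Polynomial.smult (lead_coeff p) (\<Prod>a\<in>T. [:- a, 1:])"
proof (rule ccontr)
  assume ne: "p \<noteq> Polynomial.smult (lead_coeff p) (\<Prod>a\<in>T. [:- a, 1:])"
  let ?q = "\<Prod>a\<in>T. [:- a, 1:]"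
  define r where "r = p - Polynomial.smult (lead_coeff p) ?q"
  have r0: "r \<noteq> 0" using ne by (simp add: r_def)
  have dq: "degree ?q = card T" by (subst degree_prod_eq_sum_degree) auto
  have lq: "lead_coeff ?q = 1" by (simp add: lead_coeff_prod)
  have "degree r \<le> degree p"
    unfolding r_def using dq assms(2) by (intro degree_diff_le) (auto intro: order.trans[OF degree_smult_le])
  moreover have "coeff r (degree p) = 0"
    using lq dq assms(2) by (simp add: r_def)
  ultimately have "degree r < card T \<or> degree p = 0"
    using r0 assms(2) by (metis le_neq_implies_less leading_coeff_0_iff)
  moreover have "degree p \<noteq> 0"
  proof
    assume "degree p = 0"
    then have "T = {}" using assms by simp
    obtain c where "p = [:c:]" using \<open>degree p = 0\<close> by (rule degree_eq_zeroE)
    then show False using ne \<open>T = {}\<close> by simp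
  qed
  moreover have "T \<subseteq> {x. poly r x = 0}"
    using assms by (auto simp: r_def poly_prod)
  then have "card T \<le> degree r"
    using card_mono[OF poly_roots_finite[OF r0]] card_poly_roots_bound[OF r0] by (meson order.trans)
  ultimately show False by linarith
qed

text \<open>Eliminating \<open>w\<close> gives c^e P(a) = Q(c a), a polynomial relation for the
  transcendental \<open>a\<close>, hence an identity of polynomials.\<close>

lemma scaled_roots:
  assumes "a \<notin> range cst" "ev P a = a ^ e * w" "ev Q (cst c * a) = (cst c * a) ^ e * w"
  shows "coeff P i * c ^ e = coeff Q i * c ^ i"
proof -
  define Qc where "Qc = pcompose Q [:0, c:]"
  have evQ: "ev Qc a = ev Q (cst c * a)"
    unfolding Qc_def by (induction Q) (simp_all add: pcompose_pCons ev_pCons mult.assoc)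
  have "ev (Polynomial.smult (c ^ e) P - Qc) a = cst (c ^ e) * ev P a - ev Qc a"
    by simp
  also have "\<dots> = 0"
    using assms(2,3) by (simp add: evQ power_mult_distrib flip: fls_const_power)
  finally have "Polynomial.smult (c ^ e) P - Qc = 0" using ev_eq_0_iff[OF assms(1)] by blast
  then have "Polynomial.smult (c ^ e) P = Qc" by simp
  then have "coeff (Polynomial.smult (c ^ e) P) i = coeff Qc i" by simp
  moreover have "coeff Qc i = coeff Q i * c ^ i" by (simp add: Qc_def coeff_pcompose_linear)
  ultimately show ?thesis by (simp add: mult.commute)
qed

text \<open>Divisibility of \<open>M\<close> by both end degrees turns the fractional powers of 1/w
  in the expansions of the roots into integral powers of \<open>u\<close>. One root \<open>t\<close>
  vanishing at u = 0 and one root \<open>t'\<close> with a pole suffice, since the rotations by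
  powers of the primitive M-th root of unity \<open>\<eta>\<close> supply the others. That
  \<open>t\<close> is a series in u^(M/e) is recorded as invariance under the rotation by \<eta>^e,
  and likewise for \<open>t'\<close>.\<close>

locale branch_roots =
  fixes P :: "complex poly" and e M :: nat and \<eta> :: complex and t t' :: "complex fls"
  assumes e: "0 < e" "e < degree P" and P0: "coeff P 0 \<noteq> 0"
    and M: "0 < M" "e dvd M" "degree P - e dvd M"
    and \<eta>: "\<eta> \<noteq> 0" "\<And>n :: int. \<eta> powi n = 1 \<longleftrightarrow> int M dvd n"
    and t: "t \<noteq> 0" "fls_subdegree t = int (M div e)" "ev P t = t ^ e * fls_X_intpow (- int M)"
      "rot (\<eta> ^ e) t = t"
    and t': "t' \<noteq> 0" "fls_subdegree t' = - int (M div (degree P - e))"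
      "ev P t' = t' ^ e * fls_X_intpow (- int M)" "rot (\<eta> ^ (degree P - e)) t' = t'"
begin

definition f :: nat where "f = degree P - e"
definition w :: "complex fls" where "w = fls_X_intpow (- int M)"
text \<open>The \<open>e\<close> small roots, those vanishing at u = 0; \<open>B\<close> will
  collect the \<open>f\<close> large roots, those with a pole. Each of the two is a single rotation
  orbit.\<close>

definition A :: "complex fls set" where "A = (\<lambda>i. rot (\<eta> ^ i) t) ` {..<e}"
definition B :: "complex fls set" where "B = (\<lambda>i. rot (\<eta> ^ i) t') ` {..<f}"
definition T :: "complex fls set" where "T = A \<union> B"

lemma f: "0 < f" "degree P = e + f" "f dvd M"
  using e M by (auto simp: f_def)

lemma \<eta>_pow: "\<eta> ^ i \<noteq> 0" using \<eta> by simp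

lemma P_nz: "P \<noteq> 0" using P0 by auto

lemma \<eta>_pow_powi: "(\<eta> ^ i) powi n = \<eta> powi (int i * n)"
  by (simp add: power_int_mult)

lemma rot_w: "rot (\<eta> ^ i) w = w"
proof -
  have "(\<eta> ^ i) powi (- int M) = 1"
    unfolding \<eta>_pow_powi \<eta>(2) by simp
  then show ?thesis unfolding w_def rot_X_intpow[OF \<eta>_pow] by simp
qed

lemma subdegree_not_const: "fls_subdegree a \<noteq> 0 \<Longrightarrow> a \<notin> range cst"
  by auto

lemma w_not_const: "w \<notin> range cst"
  by (rule subdegree_not_const) (use M in \<open>simp add: w_def\<close>)

text \<open>The i-th rotation multiplies the leading coefficient by \<eta>^(i n) with n = M/k or n =
  - M/k, and these factors differ for i < k.\<close>

lemma orbit_inj: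
  assumes "s \<noteq> 0" "k dvd M" "0 < k" "\<bar>fls_subdegree s\<bar> = int (M div k)"
  shows "inj_on (\<lambda>i. rot (\<eta> ^ i) s) {..<k}"
proof -
  have lt: False if "i < k" "j < k" "i < j" "rot (\<eta> ^ i) s = rot (\<eta> ^ j) s" for i j
  proof -
    let ?n = "fls_subdegree s"
    have "s $$ ?n * (\<eta> ^ i) powi ?n = s $$ ?n * (\<eta> ^ j) powi ?n"
      using that(4) by (metis \<eta>_pow rot_nth)
    then have "(\<eta> ^ i) powi ?n = (\<eta> ^ j) powi ?n" using assms(1) by simp
    then have "\<eta> powi (int i * ?n) = \<eta> powi (int j * ?n)"
      by (simp only: \<eta>_pow_powi)
    then have "\<eta> powi (int j * ?n - int i * ?n) = 1" using \<eta>(1) by (simp add: power_int_diff)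
    then have "int M dvd (int j - int i) * ?n" using \<eta>(2) by (simp add: left_diff_distrib)
    moreover have "?n = int (M div k) \<or> ?n = - int (M div k)" using assms(4) by linarith
    ultimately have "int M dvd (int j - int i) * int (M div k)" by auto
    then have "int (k * (M div k)) dvd (int j - int i) * int (M div k)"
      using assms(2) by simp
    moreover have "M div k > 0" using assms(2,3) M(1) by (simp add: div_greater_zero_iff dvd_imp_le)
    ultimately have "int k dvd int j - int i" by (simp add: mult.commute)
    then have "int k \<le> int j - int i" using that(3) by (intro zdvd_imp_le) auto
    then show False using that by linarith
  qed
  show ?thesis by (rule inj_onI) (metis lt lessThan_iff linorder_neqE_nat)
qed

lemma A_props: "card A = e" "finite A" "a \<in> A \<Longrightarrow> a \<noteq> 0"
  "a \<in> A \<Longrightarrow> fls_subdegree a = int (M div e)" "a \<in> A \<Longrightarrow> ev P a = a ^ e * w"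
proof -
  show "card A = e" unfolding A_def using orbit_inj[OF t(1) M(2) e(1)] t(2) by (simp add: card_image)
  show "finite A" by (simp add: A_def)
  assume "a \<in> A"
  then obtain i where a: "a = rot (\<eta> ^ i) t" by (auto simp: A_def)
  show "a \<noteq> 0" using t(1) \<eta>_pow by (simp add: a rot_eq_0_iff)
  show "fls_subdegree a = int (M div e)" using t(2) \<eta>_pow by (simp add: a rot_subdegree)
  have "ev P a = rot (\<eta> ^ i) (t ^ e * w)"
    using t(3) \<eta>_pow unfolding a w_def by (metis rot_ev)
  then show "ev P a = a ^ e * w" using \<eta>_pow by (simp add: rot_mult rot_power rot_w a)
qed

lemma B_props: "card B = f" "finite B" "b \<in> B \<Longrightarrow> b \<noteq> 0"
  "b \<in> B \<Longrightarrow> fls_subdegree b = - int (M div f)" "b \<in> B \<Longrightarrow> ev P b = b ^ e * w"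
proof -
  show "card B = f" unfolding B_def using orbit_inj[OF t'(1) f(3) f(1)] t'(2) by (simp add: card_image f_def)
  show "finite B" by (simp add: B_def)
  assume "b \<in> B"
  then obtain i where b: "b = rot (\<eta> ^ i) t'" by (auto simp: B_def)
  show "b \<noteq> 0" using t'(1) \<eta>_pow by (simp add: b rot_eq_0_iff)
  show "fls_subdegree b = - int (M div f)" using t'(2) \<eta>_pow by (simp add: b rot_subdegree f_def)
  have "ev P b = rot (\<eta> ^ i) (t' ^ e * w)"
    using t'(3) \<eta>_pow unfolding b w_def by (metis rot_ev)
  then show "ev P b = b ^ e * w" using \<eta>_pow by (simp add: rot_mult rot_power rot_w b)
qed

lemma div_pos: "0 < M div e" "0 < M div f"
  using M e f by (simp_all add: div_greater_zero_iff dvd_imp_le)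

lemma AB_disjoint: "A \<inter> B = {}"
proof -
  have False if "a \<in> A" "a \<in> B" for a
    using A_props(4)[OF that(1)] B_props(4)[OF that(2)] div_pos by linarith
  then show ?thesis by blast
qed

lemma T_props: "finite T" "card T = degree P" "a \<in> T \<Longrightarrow> a \<noteq> 0" "a \<in> T \<Longrightarrow> ev P a = a ^ e * w"
  "a \<in> T \<Longrightarrow> a \<notin> range cst"
proof -
  show "finite T" using A_props B_props by (simp add: T_def)
  show "card T = degree P"
    unfolding T_def using A_props B_props AB_disjoint f by (simp add: card_Un_disjoint)
  assume a: "a \<in> T"
  then show "a \<noteq> 0" "ev P a = a ^ e * w" using A_props B_props by (auto simp: T_def)
  have "fls_subdegree a \<noteq> 0" using a A_props(4)[of a] B_props(4)[of a] div_pos by (auto simp: T_def)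
  then show "a \<notin> range cst" by (rule subdegree_not_const)
qed

lemma A_subset: "A \<subseteq> T" and B_eq: "B = T - A"
  using AB_disjoint by (auto simp: T_def)

text \<open>The value \<open>z\<close> of the Laurent polynomial stays a parameter because the same
  polynomial is also split at a finite place.\<close>

definition root_poly :: "complex fls \<Rightarrow> complex fls poly" where
  "root_poly z = map_poly cst P - monom z e"

lemma poly_root_poly: "poly (root_poly z) a = ev P a - a ^ e * z"
  by (simp add: root_poly_def ev_def poly_monom mult.commute)

lemma coeff_root_poly: "coeff (root_poly z) i = cst (coeff P i) - (if i = e then z else 0)"
  by (simp add: root_poly_def coeff_map_poly)

lemma degree_root_poly: "degree (root_poly z) = degree P"
proof (rule antisym)
  show "degree (root_poly z) \<le> degree P"
    by (rule degree_le) (use e in \<open>auto simp: coeff_root_poly coeff_eq_0\<close>)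
  have "coeff (root_poly z) (degree P) \<noteq> 0"
    using e P_nz by (simp add: coeff_root_poly)
  then show "degree P \<le> degree (root_poly z)" by (rule le_degree)
qed

lemma root_poly_nz: "root_poly z \<noteq> 0"
  using degree_root_poly[of z] e by (metis degree_0 not_less0)

lemma lead_coeff_root_poly: "lead_coeff (root_poly z) = cst (lead_coeff P)"
  unfolding degree_root_poly coeff_root_poly using e by simp

lemma root_poly_split:
  assumes "finite X" "card X = degree P" "\<And>a. a \<in> X \<Longrightarrow> ev P a = a ^ e * z"
  shows "root_poly z = Polynomial.smult (cst (lead_coeff P)) (\<Prod>a\<in>X. [:- a, 1:])"
  unfolding lead_coeff_root_poly[of z, symmetric]
  by (rule poly_eq_prod_roots) (use assms in \<open>simp_all add: degree_root_poly poly_root_poly\<close>)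

lemma root_poly_w: "root_poly w = Polynomial.smult (cst (lead_coeff P)) (\<Prod>a\<in>T. [:- a, 1:])"
  by (rule root_poly_split) (use T_props in auto)

lemma root_iff: "a \<in> T \<longleftrightarrow> ev P a = a ^ e * w"
proof
  assume "ev P a = a ^ e * w"
  then have "poly (root_poly w) a = 0" by (simp add: poly_root_poly)
  then have "cst (lead_coeff P) = 0 \<or> (\<exists>b\<in>T. a = b)"
    unfolding root_poly_w using T_props(1) by (simp add: poly_prod)
  then show "a \<in> T" using P_nz by auto
qed (rule T_props)

text \<open>\<open>w\<close> enters only the coefficient of Y^e, strictly between the constant and
  the leading one, and the product of the roots depends on the latter two alone.\<close>

lemma prod_T_const: "\<exists>c. c \<noteq> 0 \<and> \<Prod>T = cst c"
proof -
  have "poly (root_poly w) 0 = cst (coeff P 0)"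
    using e by (simp add: poly_0_coeff_0 coeff_root_poly)
  moreover have "poly (root_poly w) 0 = cst (lead_coeff P) * ((- 1) ^ card T * \<Prod>T)"
    unfolding root_poly_w by (simp add: poly_prod prod_uminus)
  ultimately have "cst (lead_coeff P) * ((- 1) ^ card T * \<Prod>T) = cst (coeff P 0)" by simp
  then have "\<Prod>T = cst (coeff P 0) / (cst (lead_coeff P) * (- 1) ^ card T)"
    using P_nz by (simp add: field_simps)
  also have "\<dots> = cst (coeff P 0 / (lead_coeff P * (- 1) ^ card T))"
    unfolding cst_minus_one_power[symmetric] by (simp add: fls_const_divide_const)
  finally show ?thesis using P0 P_nz by (intro exI conjI) auto
qed

lemma sum_dlog_T: "(\<Sum>a\<in>T. dlog a) = 0"
proof -
  obtain c where "\<Prod>T = cst c" using prod_T_const by blast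
  then have "dlog (\<Prod>T) = 0" by simp
  then show ?thesis using T_props(3) by (simp add: dlog_prod)
qed

section \<open>Rotations of the small and of the large roots\<close>

lemma orbit_closed:
  assumes "rot (\<eta> ^ k) s = s" "0 < k"
  shows "rot (\<eta> ^ j) s \<in> (\<lambda>i. rot (\<eta> ^ i) s) ` {..<k}"
proof -
  have *: "rot (\<eta> ^ (k * n)) s = s" for n
  proof (induction n)
    case (Suc n)
    have "rot (\<eta> ^ (k * Suc n)) s = rot (\<eta> ^ k) (rot (\<eta> ^ (k * n)) s)"
      using \<eta>(1) by (simp add: rot_rot power_add)
    then show ?case using Suc assms by simp
  qed simp
  have "rot (\<eta> ^ j) s = rot (\<eta> ^ (j mod k)) (rot (\<eta> ^ (k * (j div k))) s)"
    using \<eta>(1) by (simp add: rot_rot flip: power_add)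
  also have "\<dots> = rot (\<eta> ^ (j mod k)) s" using * by simp
  finally show ?thesis using assms(2) by auto
qed

lemma rot_A: "a \<in> A \<Longrightarrow> rot (\<eta> ^ j) a \<in> A"
proof -
  assume "a \<in> A"
  then obtain i where "a = rot (\<eta> ^ i) t" by (auto simp: A_def)
  then have "rot (\<eta> ^ j) a = rot (\<eta> ^ (j + i)) t" using \<eta>(1) by (simp add: rot_rot power_add)
  then show "rot (\<eta> ^ j) a \<in> A" unfolding A_def using orbit_closed[OF t(4) e(1)] by simp
qed

lemma rot_B: "b \<in> B \<Longrightarrow> rot (\<eta> ^ j) b \<in> B"
proof -
  assume "b \<in> B"
  then obtain i where "b = rot (\<eta> ^ i) t'" by (auto simp: B_def)
  then have "rot (\<eta> ^ j) b = rot (\<eta> ^ (j + i)) t'" using \<eta>(1) by (simp add: rot_rot power_add)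
  then show "rot (\<eta> ^ j) b \<in> B"
    unfolding B_def f_def using orbit_closed[OF t'(4)] f(1) by (simp add: f_def)
qed

lemma rot_e: "a \<in> A \<Longrightarrow> rot (\<eta> ^ e) a = a"
proof -
  assume "a \<in> A"
  then obtain i where "a = rot (\<eta> ^ i) t" by (auto simp: A_def)
  then have "rot (\<eta> ^ e) a = rot (\<eta> ^ i) (rot (\<eta> ^ e) t)" using \<eta>(1) by (simp add: rot_rot mult.commute)
  then show "rot (\<eta> ^ e) a = a" using t(4) \<open>a = _\<close> by simp
qed

lemma rot_f: "b \<in> B \<Longrightarrow> rot (\<eta> ^ f) b = b"
proof -
  assume "b \<in> B"
  then obtain i where "b = rot (\<eta> ^ i) t'" by (auto simp: B_def)
  then have "rot (\<eta> ^ f) b = rot (\<eta> ^ i) (rot (\<eta> ^ f) t')" using \<eta>(1) by (simp add: rot_rot mult.commute)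
  then show "rot (\<eta> ^ f) b = b" using t'(4) \<open>b = _\<close> by (simp add: f_def)
qed

lemma A_orbit:
  assumes "a \<in> A" "b \<in> A"
  shows "\<exists>i. rot (\<eta> ^ i) a = b"
proof -
  obtain i j where i: "a = rot (\<eta> ^ i) t" "i < e" and j: "b = rot (\<eta> ^ j) t"
    using assms by (auto simp: A_def)
  have "rot (\<eta> ^ (e - i + j)) a = rot (\<eta> ^ j) (rot (\<eta> ^ e) t)"
    using \<eta>(1) i by (simp add: rot_rot add.commute flip: power_add)
  then show ?thesis using t(4) j by auto
qed

lemma B_orbit:
  assumes "a \<in> B" "b \<in> B"
  shows "\<exists>i. rot (\<eta> ^ i) a = b"
proof -
  obtain i j where i: "a = rot (\<eta> ^ i) t'" "i < f" and j: "b = rot (\<eta> ^ j) t'"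
    using assms by (auto simp: B_def)
  have "rot (\<eta> ^ (f - i + j)) a = rot (\<eta> ^ j) (rot (\<eta> ^ f) t')"
    using \<eta>(1) i by (simp add: rot_rot add.commute flip: power_add)
  then show ?thesis using t'(4) j by (auto simp: f_def)
qed

lemma t_in_A: "t \<in> A" and t'_in_B: "t' \<in> B"
  using e f by (auto simp: A_def B_def intro!: image_eqI[of _ _ 0])

text \<open>The sum over the orbit is a geometric sum in \<eta>^n and keeps only the exponents n = M
  k. There the coefficient is the residue of w^k times the logarithmic derivative of
  \<open>t\<close>. The sum over the small roots thus carries the return probabilities and nothing
  else.\<close>

lemma sum_dlog_A_nth:
  "(\<Sum>a\<in>A. dlog a) $$ (n - 1) =
     (if int M dvd n \<and> 0 \<le> n then coeff (P ^ nat (n div int M)) (e * nat (n div int M)) * of_nat M else 0)"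
proof -
  define c where "c = dlog t $$ (n - 1)"
  have "(\<Sum>a\<in>A. dlog a) $$ (n - 1) = (\<Sum>i<e. dlog (rot (\<eta> ^ i) t) $$ (n - 1))"
    unfolding A_def using orbit_inj[OF t(1) M(2) e(1)] t(2)
    by (subst sum.reindex) (simp_all add: fls_nth_sum)
  also have "\<dots> = (\<Sum>i<e. (\<eta> powi n) ^ i) * c"
    unfolding sum_distrib_right
  proof (rule sum.cong)
    fix i
    have "dlog (rot (\<eta> ^ i) t) $$ (n - 1) = (\<eta> ^ i) powi n * c"
      unfolding c_def by (rule rot_dlog_nth[OF \<eta>_pow])
    also have "(\<eta> ^ i) powi n = (\<eta> powi n) ^ i"
      unfolding \<eta>_pow_powi by (simp add: power_int_mult[symmetric] mult.commute flip: power_int_of_nat)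
    finally show "dlog (rot (\<eta> ^ i) t) $$ (n - 1) = (\<eta> powi n) ^ i * c" .
  qed simp
  finally have sum: "(\<Sum>a\<in>A. dlog a) $$ (n - 1) = (\<Sum>i<e. (\<eta> powi n) ^ i) * c" .
  show ?thesis
  proof (cases "int M dvd n")
    case False
    then have ne: "\<eta> powi n \<noteq> 1" using \<eta>(2) by simp
    have "dlog (rot (\<eta> ^ e) t) $$ (n - 1) = (\<eta> ^ e) powi n * c"
      unfolding c_def by (rule rot_dlog_nth[OF \<eta>_pow])
    also have "(\<eta> ^ e) powi n = (\<eta> powi n) ^ e"
      unfolding \<eta>_pow_powi by (simp add: power_int_mult[symmetric] mult.commute flip: power_int_of_nat)
    \<comment> \<open>Invariance of \<open>t\<close> under \<eta>^e leaves two possibilities: either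
      \<open>c\<close> is 0, or the e-th power of \<eta>^n is 1 and the geometric sum
      vanishes.\<close>
    finally have "c = (\<eta> powi n) ^ e * c" using t(4) by (simp add: c_def)
    then have "(1 - (\<eta> powi n) ^ e) * c = 0" by (simp add: algebra_simps)
    moreover have "(\<Sum>i<e. (\<eta> powi n) ^ i) * (1 - \<eta> powi n) = 1 - (\<eta> powi n) ^ e"
      using ne by (simp add: sum_gp_strict)
    ultimately have "(1 - \<eta> powi n) * ((\<Sum>i<e. (\<eta> powi n) ^ i) * c) = 0"
      by (metis mult.commute mult.left_commute)
    then show ?thesis using sum ne False by simp
  next
    case True
    then obtain k where k: "n = int M * k" by (elim dvdE)
    have "\<eta> powi n = 1" using True \<eta>(2) by simp
    then have sum': "(\<Sum>a\<in>A. dlog a) $$ (n - 1) = of_nat e * c" using sum by simp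
    show ?thesis
    proof (cases "0 \<le> n")
      case False
      then have "c = 0" unfolding c_def by (intro dlog_nth_eq_0) simp
      then show ?thesis using sum' False by simp
    next
      case n: True
      then have k0: "0 \<le> k" using k M(1) by (simp add: zero_le_mult_iff)
      have "w ^ nat k = fls_X_intpow (- n)"
        unfolding w_def fls_X_intpow_power using k k0 by (simp add: mult.commute)
      then have "c = (w ^ nat k * dlog t) $$ (- 1)"
        unfolding c_def by (simp only: X_intpow_mult_nth) simp
      also have "\<dots> = coeff (P ^ nat k) (e * nat k) * of_int (int (M div e))"
        using residue_root_integral[OF t(1,3)] t(2) by (simp add: w_def)
      finally have "of_nat e * c = coeff (P ^ nat k) (e * nat k) * (of_nat e * of_nat (M div e))" by simp
      also have "(of_nat e * of_nat (M div e) :: complex) = of_nat M"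
        using M(2) by (metis dvd_mult_div_cancel of_nat_mult)
      finally show ?thesis using sum' True n k M(1) by simp
    qed
  qed
qed

end

text \<open>The large roots are the inverses of the small roots of the reflected polynomial, for
  which the two end degrees change places.\<close>

lemma branch_roots_exists:
  assumes e: "0 < e" "e < degree P" and P0: "coeff P 0 \<noteq> 0"
    and M: "0 < M" "e dvd M" "degree P - e dvd M"
    and \<eta>: "\<eta> \<noteq> 0" "\<And>n :: int. \<eta> powi n = 1 \<longleftrightarrow> int M dvd n"
  shows "\<exists>t t'. branch_roots P e M \<eta> t t'"
proof -
  let ?f = "degree P - e"
  have fix_rot: "rot (\<eta> ^ k) s = s" if kM: "k dvd M" and s: "\<And>n. s $$ n \<noteq> 0 \<Longrightarrow> int (M div k) dvd n" for k s
  proof (rule fls_eqI)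
    fix n
    have nz: "\<eta> ^ k \<noteq> 0" using \<eta> by simp
    show "rot (\<eta> ^ k) s $$ n = s $$ n"
    proof (cases "s $$ n = 0")
      case False
      then obtain j where "n = int (M div k) * j" using s by blast
      then have "int k * n = int (k * (M div k)) * j" by simp
      also have "k * (M div k) = M" using kM by simp
      finally have "int M dvd int k * n" by simp
      then have "(\<eta> ^ k) powi n = 1" using \<eta>(2)[of "int k * n"] by (simp add: power_int_mult)
      then show ?thesis by (simp add: rot_nth[OF nz])
    qed (simp add: rot_nth[OF nz])
  qed
  have pos: "0 < M div e" "0 < M div ?f" using M e by (simp_all add: div_greater_zero_iff dvd_imp_le)
  obtain t where t: "t \<noteq> 0" "fls_subdegree t = int (M div e)"
    "ev P t = t ^ e * fls_X_intpow (- int (e * (M div e)))" "\<And>n. t $$ n \<noteq> 0 \<Longrightarrow> int (M div e) dvd n"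
    using small_root_exists[OF P0 e(1) pos(1)] by blast
  have "coeff (reflect_poly P) 0 \<noteq> 0" using e by auto
  then obtain s where s: "s \<noteq> 0" "fls_subdegree s = int (M div ?f)"
    "ev (reflect_poly P) s = s ^ ?f * fls_X_intpow (- int (?f * (M div ?f)))"
    "\<And>n. s $$ n \<noteq> 0 \<Longrightarrow> int (M div ?f) dvd n"
    using small_root_exists[of "reflect_poly P" ?f "M div ?f"] e pos(2) by auto
  define t' where "t' = inverse s"
  have "map_poly cst (reflect_poly P) = reflect_poly (map_poly cst P)"
    by (rule poly_eqI) (simp add: coeff_map_poly coeff_reflect_poly degree_map_poly)
  then have "ev (reflect_poly P) s = s ^ degree P * ev P t'"
    using s(1) by (simp add: ev_def poly_reflect_poly_nz degree_map_poly t'_def)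
  moreover have "s ^ degree P = s ^ e * s ^ ?f" using e by (simp add: power_add[symmetric])
  ultimately have "s ^ e * ev P t' = fls_X_intpow (- int M)" using s(1,3) M(3) by simp
  then have "ev P t' = t' ^ e * fls_X_intpow (- int M)" using s(1) by (simp add: t'_def field_simps)
  moreover have "rot (\<eta> ^ ?f) t' = t'"
    using fix_rot[OF M(3) s(4)] \<eta>(1) by (simp add: t'_def rot_inverse)
  moreover have "t' \<noteq> 0" "fls_subdegree t' = - int (M div ?f)" using s(1,2) by (simp_all add: t'_def)
  ultimately have "branch_roots P e M \<eta> t t'"
    using assms t fix_rot[OF M(2) t(4)] by unfold_locales auto
  then show ?thesis by blast
qed

lemma primitive_root_exists:
  assumes "0 < M"
  shows "\<exists>\<eta> :: complex. \<eta> \<noteq> 0 \<and> (\<forall>n :: int. \<eta> powi n = 1 \<longleftrightarrow> int M dvd n)"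
proof -
  define \<eta> where "\<eta> = cis (2 * pi / M)"
  have "\<eta> powi n = 1 \<longleftrightarrow> int M dvd n" for n
  proof -
    have "\<eta> powi n = cis (of_int n * (2 * pi / M))" by (simp add: \<eta>_def cis_power_int)
    also have "\<dots> = 1 \<longleftrightarrow> (\<exists>k :: int. of_int n * (2 * pi / M) = of_int k * (2 * pi))"
    proof -
      have "cis x = 1 \<longleftrightarrow> cos x = 1" for x
        using cos_one_sin_zero[of x] by (auto simp: complex_eq_iff)
      then show ?thesis by (simp only: cos_one_2pi_int mult.assoc)
    qed
    also have "\<dots> \<longleftrightarrow> (\<exists>k :: int. n = k * int M)"
    proof -
      have "of_int n * (2 * pi / M) = of_int k * (2 * pi) \<longleftrightarrow> n = k * int M" for k
      proof -
        have "of_int n * (2 * pi / M) = of_int k * (2 * pi) \<longleftrightarrow> real_of_int n = of_int k * of_nat M"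
          using assms by (simp add: field_simps)
        also have "\<dots> \<longleftrightarrow> n = k * int M" by (metis of_int_eq_iff of_int_mult of_int_of_nat_eq)
        finally show ?thesis .
      qed
      then show ?thesis by simp
    qed
    also have "\<dots> \<longleftrightarrow> int M dvd n" by (auto simp: dvd_def mult.commute)
    finally show ?thesis .
  qed
  moreover have "\<eta> \<noteq> 0" by (simp add: \<eta>_def)
  ultimately show ?thesis by blast
qed

section \<open>The Galois group of a pair of Laurent polynomials\<close>

locale root_pair =
  p: branch_roots P e M \<eta> t t' + q: branch_roots Q e' M \<eta> s s'
  for P Q :: "complex poly" and e e' M :: nat and \<eta> :: complex and t t' s s' :: "complex fls"
begin

abbreviation "w \<equiv> p.w"
abbreviation "T \<equiv> p.T"
abbreviation "S \<equiv> q.T"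

definition L :: "complex fls set" where
  "L = gen_field (range cst \<union> {w} \<union> T \<union> S)"

definition HOM :: "(complex fls \<Rightarrow> complex fls) \<Rightarrow> bool" where
  "HOM g \<longleftrightarrow> hom_on L g \<and> (\<forall>c. g (cst c) = cst c) \<and> g w = w"

text \<open>A homomorphism is remembered only through its effect on the roots and completed by the
  identity elsewhere. This yields a finite set of honest permutations, over which sums can be
  taken.\<close>

definition \<Gamma> :: "(complex fls \<Rightarrow> complex fls) set" where
  "\<Gamma> = {\<pi>. (\<exists>g. HOM g \<and> (\<forall>a\<in>T \<union> S. \<pi> a = g a)) \<and> (\<forall>a. a \<notin> T \<union> S \<longrightarrow> \<pi> a = a)}"

lemma L: "is_subfield L" "range cst \<subseteq> L" "w \<in> L" "T \<subseteq> L" "S \<subseteq> L"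
proof -
  show "is_subfield L" unfolding L_def by (rule is_subfield_gen_field)
  have "range cst \<union> {w} \<union> T \<union> S \<subseteq> L" unfolding L_def by (rule gen_field_superset)
  then show "range cst \<subseteq> L" "w \<in> L" "T \<subseteq> L" "S \<subseteq> L" by simp_all
qed

lemma finite_TS: "finite (T \<union> S)"
  using p.T_props(1) q.T_props(1) by (rule finite_UnI)

lemma HOM_root:
  assumes "HOM g"
  shows "a \<in> T \<Longrightarrow> g a \<in> T" "a \<in> S \<Longrightarrow> g a \<in> S"
proof -
  have g: "hom_on L g" "\<And>c. g (cst c) = cst c" "g w = w" using assms by (auto simp: HOM_def)
  have ev: "g (ev R a) = ev R (g a)" if "a \<in> L" for R a
    by (rule hom_ev[OF L(1) g(1) L(2) that g(2)])
  have mult: "g (a ^ k * w) = g a ^ k * w" if "a \<in> L" for a k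
    using that by (simp add: hom_on_mult[OF L(1) g(1)] hom_on_power[OF L(1) g(1)] subfield_power[OF L(1)] L(3) g(3))
  show "g a \<in> T" if "a \<in> T"
  proof -
    have "ev P (g a) = g a ^ e * w"
      using that L(4) p.T_props(4)[OF that] ev[of a P] mult[of a e] by (metis subsetD)
    then show ?thesis by (simp only: p.root_iff)
  qed
  show "g a \<in> S" if "a \<in> S"
  proof -
    have "ev Q (g a) = g a ^ e' * w"
      using that L(5) q.T_props(4)[OF that] ev[of a Q] mult[of a e'] by (metis subsetD)
    then show ?thesis by (simp only: q.root_iff)
  qed
qed

text \<open>The elements of \<open>L\<close> with image in \<open>L\<close> form a subfield
  containing the generators.\<close>

lemma HOM_L: "HOM g \<Longrightarrow> x \<in> L \<Longrightarrow> g x \<in> L"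
proof -
  assume "HOM g" "x \<in> L"
  then have g: "hom_on L g" "\<And>c. g (cst c) = cst c" "g w = w" by (auto simp: HOM_def)
  define R where "R = {x \<in> L. g x \<in> L}"
  have "is_subfield R"
    by (rule is_subfieldI)
       (auto simp: R_def hom_on_0[OF L(1) g(1)] hom_on_1[OF L(1) g(1)] hom_on_add[OF L(1) g(1)]
         hom_on_mult[OF L(1) g(1)] hom_on_uminus[OF L(1) g(1)] hom_on_inverse[OF L(1) g(1)]
         subfield_0[OF L(1)] subfield_1[OF L(1)] subfield_add[OF L(1)] subfield_mult[OF L(1)]
         subfield_uminus[OF L(1)] subfield_inverse[OF L(1)])
  moreover have "range cst \<union> {w} \<union> T \<union> S \<subseteq> R"
    using L(2-5) g HOM_root[OF \<open>HOM g\<close>] by (auto simp: R_def)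
  ultimately have "L \<subseteq> R" unfolding L_def by (rule gen_field_least)
  then show ?thesis using \<open>x \<in> L\<close> by (auto simp: R_def)
qed

lemma HOM_comp: "HOM g \<Longrightarrow> HOM h \<Longrightarrow> HOM (\<lambda>x. g (h x))"
proof -
  assume g: "HOM g" and h: "HOM h"
  have "hom_on L (\<lambda>x. g (h x))"
    using g h HOM_L[OF h] unfolding HOM_def hom_on_def by simp
  then show ?thesis using g h by (simp add: HOM_def)
qed

lemma \<Gamma>_root:
  assumes "\<pi> \<in> \<Gamma>"
  shows "a \<in> T \<Longrightarrow> \<pi> a \<in> T" "a \<in> S \<Longrightarrow> \<pi> a \<in> S"
proof -
  obtain g where g: "HOM g" "\<And>a. a \<in> T \<union> S \<Longrightarrow> \<pi> a = g a" using assms unfolding \<Gamma>_def by blast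
  show "a \<in> T \<Longrightarrow> \<pi> a \<in> T" using g(2)[of a] HOM_root(1)[OF g(1)] by simp
  show "a \<in> S \<Longrightarrow> \<pi> a \<in> S" using g(2)[of a] HOM_root(2)[OF g(1)] by simp
qed

lemma \<Gamma>_inj: "\<pi> \<in> \<Gamma> \<Longrightarrow> inj_on \<pi> (T \<union> S)"
proof -
  assume "\<pi> \<in> \<Gamma>"
  then obtain g where g: "hom_on L g" "\<forall>a\<in>T \<union> S. \<pi> a = g a" unfolding \<Gamma>_def HOM_def by blast
  have "inj_on g (T \<union> S)" using hom_on_inj[OF L(1) g(1)] L(4,5) by (meson Un_least inj_on_subset)
  moreover have "inj_on \<pi> (T \<union> S) \<longleftrightarrow> inj_on g (T \<union> S)" by (rule inj_on_cong) (use g(2) in blast)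
  ultimately show "inj_on \<pi> (T \<union> S)" by blast
qed

lemma \<Gamma>_bij: "\<pi> \<in> \<Gamma> \<Longrightarrow> bij_betw \<pi> T T" "\<pi> \<in> \<Gamma> \<Longrightarrow> bij_betw \<pi> S S"
  and \<Gamma>_bij_TS: "\<pi> \<in> \<Gamma> \<Longrightarrow> bij_betw \<pi> (T \<union> S) (T \<union> S)"
proof -
  assume \<pi>: "\<pi> \<in> \<Gamma>"
  have *: "bij_betw \<pi> X X" if "finite X" "X \<subseteq> T \<union> S" "\<pi> ` X \<subseteq> X" for X
    unfolding bij_betw_def using that inj_on_subset[OF \<Gamma>_inj[OF \<pi>] that(2)] endo_inj_surj by blast
  show "bij_betw \<pi> T T" by (rule *) (use \<Gamma>_root[OF \<pi>] p.T_props(1) in auto)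
  show "bij_betw \<pi> S S" by (rule *) (use \<Gamma>_root[OF \<pi>] q.T_props(1) in auto)
  show "bij_betw \<pi> (T \<union> S) (T \<union> S)" by (rule *) (use \<Gamma>_root[OF \<pi>] finite_TS in auto)
qed

lemma \<Gamma>_permutes: "\<pi> \<in> \<Gamma> \<Longrightarrow> \<pi> permutes (T \<union> S)"
proof -
  assume \<pi>: "\<pi> \<in> \<Gamma>"
  have "\<pi> a = a" if "a \<notin> T \<union> S" for a using \<pi> that unfolding \<Gamma>_def by blast
  then show ?thesis by (rule bij_imp_permutes[OF \<Gamma>_bij_TS[OF \<pi>]])
qed

lemma finite_\<Gamma>: "finite \<Gamma>"
proof -
  have "\<Gamma> \<subseteq> {\<pi>. \<pi> permutes (T \<union> S)}" using \<Gamma>_permutes by blast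
  then show ?thesis using finite_permutations[OF finite_TS] by (rule finite_subset)
qed

lemma \<Gamma>_id: "id \<in> \<Gamma>"
proof -
  have "HOM (\<lambda>x. x)" by (simp add: HOM_def hom_on_id)
  moreover have "\<forall>a\<in>T \<union> S. id a = a" by simp
  ultimately have "\<exists>g. HOM g \<and> (\<forall>a\<in>T \<union> S. id a = g a)" by blast
  then show ?thesis unfolding \<Gamma>_def by (intro CollectI conjI) simp_all
qed

lemma \<Gamma>_comp: "\<pi> \<in> \<Gamma> \<Longrightarrow> \<rho> \<in> \<Gamma> \<Longrightarrow> \<pi> \<circ> \<rho> \<in> \<Gamma>"
proof -
  assume \<pi>: "\<pi> \<in> \<Gamma>" and \<rho>: "\<rho> \<in> \<Gamma>"
  obtain g h where gh: "HOM g" "\<forall>a\<in>T \<union> S. \<pi> a = g a" "HOM h" "\<forall>a\<in>T \<union> S. \<rho> a = h a"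
    using \<pi> \<rho> unfolding \<Gamma>_def by blast
  have "HOM (\<lambda>x. g (h x))" by (rule HOM_comp[OF gh(1,3)])
  moreover have "(\<pi> \<circ> \<rho>) a = g (h a)" if "a \<in> T \<union> S" for a
    using gh that \<Gamma>_root[OF \<rho>] by (metis Un_iff comp_apply)
  moreover have "(\<pi> \<circ> \<rho>) a = a" if "a \<notin> T \<union> S" for a
  proof -
    have "\<rho> a = a" "\<pi> a = a" using that \<pi> \<rho> unfolding \<Gamma>_def by blast+
    then show ?thesis by simp
  qed
  ultimately show ?thesis unfolding \<Gamma>_def by blast
qed

lemma \<Gamma>_right_mult:
  assumes "\<rho> \<in> \<Gamma>" "H \<subseteq> \<Gamma>" "\<And>\<pi>. \<pi> \<in> H \<Longrightarrow> \<pi> \<circ> \<rho> \<in> H"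
  shows "bij_betw (\<lambda>\<pi>. \<pi> \<circ> \<rho>) H H"
proof -
  have "inj_on (\<lambda>\<pi>. \<pi> \<circ> \<rho>) H"
  proof (rule inj_onI)
    fix \<pi> \<pi>' assume "\<pi> \<circ> \<rho> = \<pi>' \<circ> \<rho>"
    moreover have "surj \<rho>" using permutes_surj[OF \<Gamma>_permutes[OF assms(1)]] .
    ultimately show "\<pi> = \<pi>'" by (metis (no_types, lifting) comp_assoc comp_id surj_iff)
  qed
  moreover have "finite H" using assms(2) finite_\<Gamma> finite_subset by blast
  ultimately show ?thesis
    using assms(3) by (simp add: bij_betw_def endo_inj_surj image_subsetI)
qed

text \<open>No inverse homomorphism is constructed: right translation is injective on the finite set
  \<open>\<Gamma>\<close>, hence reaches the identity.\<close>

lemma \<Gamma>_inverse: "\<rho> \<in> \<Gamma> \<Longrightarrow> \<exists>\<pi>\<in>\<Gamma>. \<pi> \<circ> \<rho> = id"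
proof -
  assume \<rho>: "\<rho> \<in> \<Gamma>"
  have "bij_betw (\<lambda>\<pi>. \<pi> \<circ> \<rho>) \<Gamma> \<Gamma>"
    by (rule \<Gamma>_right_mult[OF \<rho> subset_refl]) (rule \<Gamma>_comp[OF _ \<rho>])
  then have "id \<in> (\<lambda>\<pi>. \<pi> \<circ> \<rho>) ` \<Gamma>" using \<Gamma>_id by (simp add: bij_betw_def)
  then obtain \<pi> where "\<pi> \<in> \<Gamma>" "id = \<pi> \<circ> \<rho>" by (rule imageE)
  then show ?thesis by (intro bexI[of _ \<pi>]) simp_all
qed

text \<open>Both root polynomials have coefficients in C(w), are fixed by \<open>\<phi>\<close> and
  split, so \<open>\<phi>\<close> prolongs to all roots. Every nontrivial Galois element below
  arises in this way or from such elements by composition and inversion.\<close>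

lemma extend_to_\<Gamma>:
  assumes R: "is_subfield R" "range cst \<subseteq> R" "w \<in> R"
    and \<phi>: "hom_on R \<phi>" "\<And>c. \<phi> (cst c) = cst c" "\<phi> w = w"
  shows "\<exists>\<pi>\<in>\<Gamma>. \<forall>a\<in>(T \<union> S) \<inter> R. \<pi> a = \<phi> a"
proof -
  have cR: "cst c \<in> R" for c using R(2) by auto
  have 1: "p.root_poly w \<in> polys R" "q.root_poly w \<in> polys R"
    using R(3) cR by (auto simp: polys_def p.coeff_root_poly q.coeff_root_poly intro!: subfield_diff[OF R(1)] subfield_0[OF R(1)])
  have 2: "map_poly \<phi> (p.root_poly w) = p.root_poly w" "map_poly \<phi> (q.root_poly w) = q.root_poly w"
    using R(3) cR \<phi>(2,3)
    by (auto intro!: poly_eqI simp: coeff_hom_poly[OF R(1) \<phi>(1)] p.coeff_root_poly q.coeff_root_poly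
        hom_on_diff[OF R(1) \<phi>(1)])
  have "\<exists>R' \<psi>. is_subfield R' \<and> R \<subseteq> R' \<and> T \<union> S \<subseteq> R' \<and> hom_on R' \<psi> \<and> (\<forall>x\<in>R. \<psi> x = \<phi> x)"
  proof (rule hom_on_extend_finite[OF finite_TS R(1) \<phi>(1)])
    fix a assume "a \<in> T \<union> S"
    then show "\<exists>f c B. f \<in> polys R \<and> f \<noteq> 0 \<and> poly f a = 0 \<and> finite B \<and>
            map_poly \<phi> f = Polynomial.smult c (\<Prod>b\<in>B. [:- b, 1:])"
    proof
      assume "a \<in> T"
      then have "poly (p.root_poly w) a = 0" by (simp add: p.poly_root_poly p.T_props)
      then show ?thesis
        using 1(1) 2(1) p.root_poly_nz p.root_poly_w p.T_props(1) by metis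
    next
      assume "a \<in> S"
      then have "poly (q.root_poly w) a = 0" using q.T_props(4)[of a] by (simp add: q.poly_root_poly)
      then show ?thesis
        using 1(2) 2(2) q.root_poly_nz q.root_poly_w q.T_props(1) by metis
    qed
  qed
  then obtain R' \<psi> where R': "is_subfield R'" "R \<subseteq> R'" "T \<union> S \<subseteq> R'" "hom_on R' \<psi>" "\<And>x. x \<in> R \<Longrightarrow> \<psi> x = \<phi> x"
    by blast
  have "L \<subseteq> R'" unfolding L_def by (rule gen_field_least) (use R R' in auto)
  then have "HOM \<psi>" unfolding HOM_def using R'(4,5) hom_on_subset \<phi> R(3) cR by metis
  define \<pi> where "\<pi> a = (if a \<in> T \<union> S then \<psi> a else a)" for a
  have "\<pi> \<in> \<Gamma>" unfolding \<Gamma>_def using \<open>HOM \<psi>\<close> by (auto simp: \<pi>_def)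
  moreover have "\<forall>a\<in>(T \<union> S) \<inter> R. \<pi> a = \<phi> a" using R'(5) by (auto simp: \<pi>_def)
  ultimately show ?thesis by blast
qed

lemma rot_in_\<Gamma>: "\<exists>\<pi>\<in>\<Gamma>. \<forall>a\<in>T \<union> S. \<pi> a = rot (\<eta> ^ j) a"
proof -
  have nz: "\<eta> ^ j \<noteq> 0" by (rule p.\<eta>_pow)
  obtain \<pi> where "\<pi> \<in> \<Gamma>" "\<forall>a\<in>(T \<union> S) \<inter> UNIV. \<pi> a = rot (\<eta> ^ j) a"
    using extend_to_\<Gamma>[OF is_subfield_UNIV subset_UNIV UNIV_I hom_on_rot[OF nz] rot_cst[OF nz] p.rot_w] by blast
  then show ?thesis by blast
qed

text \<open>\<open>w\<close> is a rational function of any single root, and the same one for all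
  roots of one equation. The isomorphism from C(a) to C(b) that sends a to b therefore fixes
  \<open>w\<close>.\<close>

lemma \<Gamma>_transitive_S: "a' \<in> S \<Longrightarrow> b' \<in> S \<Longrightarrow> \<exists>\<pi>\<in>\<Gamma>. \<pi> a' = b'"
proof -
  have *: "\<exists>\<pi>\<in>\<Gamma>. \<pi> a = b"
    if ab: "a \<in> T \<union> S" "a \<notin> range cst" "b \<notin> range cst" "ev R a = a ^ k * w" "ev R b = b ^ k * w" for a b R k
  proof -
    obtain \<phi> where \<phi>: "hom_on (ratf a) \<phi>" "\<And>c. \<phi> (cst c) = cst c" "\<phi> a = b"
      using hom_on_ratf[OF ab(2,3)] by blast
    have nz: "a \<noteq> 0" "b \<noteq> 0" using ab(2,3) by (metis fls_const_0 rangeI)+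
    have w: "w = ev R a / a ^ k" "w = ev R b / b ^ k" using ab(4,5) nz by simp_all
    have sub: "is_subfield (ratf a)" "range cst \<subseteq> ratf a" "a \<in> ratf a" "ev R a \<in> ratf a" "a ^ k \<in> ratf a"
      using is_subfield_ratf cst_in_ratf X_in_ratf ev_in_ratf subfield_power[OF is_subfield_ratf] by blast+
    have "\<phi> (ev R a / a ^ k) = ev R b / b ^ k"
      unfolding hom_on_divide[OF sub(1) \<phi>(1) sub(4,5)] hom_ev[OF sub(1) \<phi>(1) sub(2,3) \<phi>(2)]
        hom_on_power[OF sub(1) \<phi>(1) sub(3)] \<phi>(3) ..
    then have "\<phi> w = w" using w by simp
    moreover have "w \<in> ratf a" using w(1) subfield_divide[OF sub(1,4,5)] by simp
    ultimately obtain \<pi> where "\<pi> \<in> \<Gamma>" "\<forall>c\<in>(T \<union> S) \<inter> ratf a. \<pi> c = \<phi> c"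
      using extend_to_\<Gamma>[OF sub(1,2) _ \<phi>(1,2)] by blast
    then show ?thesis using ab(1) sub(3) \<phi>(3) by blast
  qed
  show "a' \<in> S \<Longrightarrow> b' \<in> S \<Longrightarrow> \<exists>\<pi>\<in>\<Gamma>. \<pi> a' = b'"
    using q.T_props *[of a' b' Q e'] by simp
qed

text \<open>A vanishing integral combination says that a monomial in the roots is constant, and
  homomorphisms fixing the constants preserve this. Compatibility with the derivation is thereby
  never an issue.\<close>

lemma \<Gamma>_relation:
  assumes \<pi>: "\<pi> \<in> \<Gamma>" and X: "X \<subseteq> T \<union> S" and rel: "(\<Sum>a\<in>X. of_int (n a) * dlog a) = 0"
  shows "(\<Sum>a\<in>X. of_int (n a) * dlog (\<pi> a)) = 0"
proof -
  have nz: "a \<noteq> 0" if "a \<in> T \<union> S" for a using that p.T_props(3) q.T_props(3) by blast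
  obtain g where g: "HOM g" "\<forall>a\<in>T \<union> S. \<pi> a = g a" using \<pi> unfolding \<Gamma>_def by blast
  have hom: "hom_on L g" "\<And>c. g (cst c) = cst c" using g by (auto simp: HOM_def)
  have XL: "a \<in> L" if "a \<in> X" for a using that X L(4,5) by blast
  have dlog_prod': "dlog (\<Prod>a\<in>X. h a powi n a) = (\<Sum>a\<in>X. of_int (n a) * dlog (h a))"
    if "\<And>a. a \<in> X \<Longrightarrow> h a \<noteq> 0" for h
    using that by (subst dlog_prod) (simp_all add: dlog_power_int power_int_eq_0_iff)
  have "dlog (\<Prod>a\<in>X. a powi n a) = (\<Sum>a\<in>X. of_int (n a) * dlog a)"
    using X nz by (intro dlog_prod'[of "\<lambda>a. a"]) blast
  then have "dlog (\<Prod>a\<in>X. a powi n a) = 0" using rel by simp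
  moreover have "(\<Prod>a\<in>X. a powi n a) \<noteq> 0"
    using X nz finite_subset[OF X finite_TS] by (auto simp: prod_zero_iff)
  ultimately obtain c where "(\<Prod>a\<in>X. a powi n a) = cst c" using dlog_eq_0_iff by blast
  then have "g (\<Prod>a\<in>X. a powi n a) = cst c" using hom by simp
  moreover have "g (\<Prod>a\<in>X. a powi n a) = (\<Prod>a\<in>X. g a powi n a)"
    using XL by (simp add: hom_on_prod[OF L(1) hom(1)] hom_on_power_int[OF L(1) hom(1)] subfield_power_int[OF L(1)])
  moreover have "(\<Prod>a\<in>X. g a powi n a) = (\<Prod>a\<in>X. \<pi> a powi n a)"
    using g(2) X by (intro prod.cong) auto
  ultimately have "dlog (\<Prod>a\<in>X. \<pi> a powi n a) = 0" by simp
  moreover have "dlog (\<Prod>a\<in>X. \<pi> a powi n a) = (\<Sum>a\<in>X. of_int (n a) * dlog (\<pi> a))"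
  proof -
    have "\<pi> a \<noteq> 0" if "a \<in> X" for a using that X nz \<Gamma>_root[OF \<pi>] by blast
    then show ?thesis by (rule dlog_prod')
  qed
  ultimately show ?thesis by simp
qed

text \<open>The product of the conjugates of a root over the field of rational functions in another root
  \<open>x\<close> is a rational function of \<open>x\<close> without zeros and poles outside \<open>0\<close> and \<open>\<infinity>\<close>, hence a monomial.\<close>

lemma orbit_dlog:
  assumes x: "x \<in> T \<union> S" and a: "a \<in> T"
  shows "\<exists>k :: int. (\<Sum>b\<in>{\<pi> a | \<pi>. \<pi> \<in> \<Gamma> \<and> \<pi> x = x}. dlog b) = of_int k * dlog x"
proof -
  obtain R k where R: "ev R x = x ^ k * w"
    using x p.T_props(4) q.T_props(4) by blast
  have xc: "x \<notin> range cst" using x p.T_props(5) q.T_props(5) by blast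
  have x0: "x \<noteq> 0" using xc by (metis fls_const_0 rangeI)
  \<comment> \<open>From R(x) = x^k w: the polynomial X^k P(Y) - R(X) Y^e clears the denominator of
    \<open>w\<close>. At X = x it is x^k times the root polynomial, and its constant and leading
    coefficients in Y are monomials in X.\<close>
  define F where "F = Polynomial.smult (monom 1 k) (map_poly (\<lambda>c. [:c:]) P) - monom R e"
  have coeffF: "coeff F i = monom (coeff P i) k - (if i = e then R else 0)" for i
  proof -
    have "monom 1 k * [:coeff P i:] = monom (coeff P i) k" by (simp add: mult.commute smult_monom)
    then show ?thesis by (simp add: F_def coeff_map_poly)
  qed
  have evF: "ev2 F x = Polynomial.smult (x ^ k) (p.root_poly w)"
    by (rule poly_eqI) (auto simp: coeff_ev2 coeffF p.coeff_root_poly R algebra_simps)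
  have degF: "degree F = degree P"
    using degree_ev2[OF xc, of F] evF x0 by (simp add: p.degree_root_poly)
  have lcF: "lead_coeff F = monom (lead_coeff P) k" "coeff F 0 = monom (coeff P 0) k"
    unfolding degF coeffF using p.e by simp_all
  have split: "ev2 F x = Polynomial.smult (x ^ k * cst (lead_coeff P)) (\<Prod>b\<in>T. [:- b, 1:])"
    unfolding evF p.root_poly_w by simp
  obtain C \<gamma> m where C: "C \<subseteq> T" "a \<in> C" "\<gamma> \<noteq> 0" "\<Prod>C = cst \<gamma> * x powi m"
    and Ciff: "\<And>b. b \<in> T \<Longrightarrow> b \<in> C \<longleftrightarrow> (\<forall>G. poly (ev2 G x) a = 0 \<longrightarrow> poly (ev2 G x) b = 0)"
    using conjugates_prod[OF xc split _ p.T_props(1) lcF(1) _ lcF(2) p.P0 a] x0 p.P_nz by auto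
  have orbit: "C = {\<pi> a | \<pi>. \<pi> \<in> \<Gamma> \<and> \<pi> x = x}"
  proof (intro equalityI subsetI)
    fix b assume "b \<in> {\<pi> a | \<pi>. \<pi> \<in> \<Gamma> \<and> \<pi> x = x}"
    then obtain \<pi> where \<pi>: "\<pi> \<in> \<Gamma>" "\<pi> x = x" "b = \<pi> a" by blast
    obtain g where g: "HOM g" "\<forall>a\<in>T \<union> S. \<pi> a = g a" using \<pi> unfolding \<Gamma>_def by blast
    have hom: "hom_on L g" "\<And>c. g (cst c) = cst c" using g by (auto simp: HOM_def)
    have gx: "g x = x" "g a = b" "x \<in> L" "a \<in> L" using g \<pi> x a L by auto
    have "poly (ev2 G x) b = 0" if "poly (ev2 G x) a = 0" for G
    proof -
      have evL: "ev c x \<in> L" for c by (rule ev_in_subfield[OF L(1,2) gx(3)])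
      then have "ev2 G x \<in> polys L" by (simp add: polys_def coeff_ev2)
      then have "g (poly (ev2 G x) a) = poly (map_poly g (ev2 G x)) b"
        using hom_poly_eval[OF L(1) hom(1), of "ev2 G x" a] gx by simp
      also have "map_poly g (ev2 G x) = ev2 G x"
        by (rule poly_eqI) (simp add: coeff_hom_poly[OF L(1) hom(1)] coeff_ev2
            hom_ev[OF L(1) hom(1) L(2) gx(3) hom(2)] gx(1))
      finally show ?thesis using that hom_on_0[OF L(1) hom(1)] by simp
    qed
    then show "b \<in> C" using Ciff[of b] \<Gamma>_root[OF \<pi>(1)] a \<pi>(3) by blast
  next
    \<comment> \<open>Conversely, a conjugate \<open>b\<close> of \<open>a\<close> over C(x) is
      reached by sending \<open>a\<close> to \<open>b\<close> over C(x) and prolonging to all roots;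
      \<open>x\<close> itself stays fixed.\<close>
    fix b assume b: "b \<in> C"
    have rx: "is_subfield (ratf x)" "range cst \<subseteq> ratf x" "w \<in> ratf x" "x \<in> ratf x"
    proof -
      show "is_subfield (ratf x)" "range cst \<subseteq> ratf x" "x \<in> ratf x"
        using is_subfield_ratf cst_in_ratf X_in_ratf by blast+
      have "w = ev R x / ev (monom 1 k) x" using R x0 by simp
      moreover have "ev (monom 1 k) x \<noteq> 0" using x0 by simp
      ultimately show "w \<in> ratf x" using ratfI by metis
    qed
    have pr: "p.root_poly w \<in> polys (ratf x)"
      using rx cst_in_ratf[of _ x]
      by (auto simp: polys_def p.coeff_root_poly intro!: subfield_diff[OF rx(1)] subfield_0[OF rx(1)])
    have "poly (p.root_poly w) a = 0" using a by (simp add: p.poly_root_poly p.T_props)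
    moreover have "poly (map_poly (\<lambda>x. x) g) b = 0" if g: "g \<in> polys (ratf x)" "poly g a = 0" for g
    proof -
      obtain c G where G: "ev c x \<noteq> 0" "Polynomial.smult (ev c x) g = ev2 G x"
        using polys_ratf_clear_denominators[OF g(1)] by blast
      have "poly (ev2 G x) a = 0" unfolding G(2)[symmetric] using g(2) by simp
      then have "poly (ev2 G x) b = 0" using b C(1) Ciff[of b] by blast
      then have "poly g b = 0" unfolding G(2)[symmetric] using G(1) by simp
      then show ?thesis by (simp add: map_poly_id[unfolded id_def])
    qed
    ultimately obtain R' \<psi> where R': "is_subfield R'" "ratf x \<subseteq> R'" "a \<in> R'" "hom_on R' \<psi>"
      "\<And>y. y \<in> ratf x \<Longrightarrow> \<psi> y = y" "\<psi> a = b"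
      using hom_on_adjoin[OF rx(1) hom_on_id pr p.root_poly_nz, of a b] by blast
    then obtain \<pi> where \<pi>: "\<pi> \<in> \<Gamma>" "\<And>c. c \<in> T \<union> S \<Longrightarrow> c \<in> R' \<Longrightarrow> \<pi> c = \<psi> c"
      using extend_to_\<Gamma>[OF R'(1) _ _ R'(4)] rx cst_in_ratf[of _ x] by blast
    have "\<pi> x = x" using \<pi>(2)[OF x] R'(2,5) rx(4) by auto
    moreover have "\<pi> a = b" using \<pi>(2)[of a] R'(3,6) a by simp
    ultimately show "b \<in> {\<pi> a | \<pi>. \<pi> \<in> \<Gamma> \<and> \<pi> x = x}" using \<pi>(1) by blast
  qed
  have "dlog (\<Prod>C) = (\<Sum>b\<in>C. dlog b)" using C(1) p.T_props(3) by (intro dlog_prod) auto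
  moreover have "dlog (\<Prod>C) = of_int m * dlog x"
    unfolding C(4) using x0 C(3) by (simp add: dlog_mult dlog_power_int)
  ultimately show ?thesis using orbit by auto
qed

text \<open>The field \<open>K\<close> generated by \<open>w\<close> and \<open>T\<close> is
  embedded by \<open>\<psi>\<close> at another place, w -> z, where the rotation exchanges two image
  roots and fixes the others. The image of \<open>\<psi>\<close> is stable under the rotation, so
  transporting it back gives an automorphism of \<open>K\<close> with the same action on
  \<open>T\<close>. The roots \<open>S\<close> are left out of \<open>K\<close>, since they need not
  be Laurent series at that place.\<close>

lemma transposition_from_place:
  fixes z :: "complex fls" and X :: "complex fls set"
  assumes z: "z \<notin> range cst" and X: "finite X" "card X = degree P" "\<And>b. b \<in> X \<Longrightarrow> ev P b = b ^ e * z"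
    and c: "c \<noteq> 0" "rot c z = z"
    and b: "b1 \<in> X" "b2 \<in> X" "b1 \<noteq> b2" "rot c b1 = b2" "rot c b2 = b1"
      "\<And>b. b \<in> X \<Longrightarrow> b \<noteq> b1 \<Longrightarrow> b \<noteq> b2 \<Longrightarrow> rot c b = b"
  shows "\<exists>\<pi>\<in>\<Gamma>. \<exists>a1\<in>T. \<exists>a2\<in>T. a1 \<noteq> a2 \<and> \<pi> a1 = a2 \<and> \<pi> a2 = a1 \<and> (\<forall>a\<in>T. a \<noteq> a1 \<longrightarrow> a \<noteq> a2 \<longrightarrow> \<pi> a = a)"
proof -
  obtain \<phi> where \<phi>: "hom_on (ratf w) \<phi>" "\<And>c. \<phi> (cst c) = cst c" "\<phi> w = z"
    using hom_on_ratf[OF p.w_not_const z] by blast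
  have rw: "is_subfield (ratf w)" "range cst \<subseteq> ratf w" "w \<in> ratf w"
    using is_subfield_ratf cst_in_ratf X_in_ratf by blast+
  have pr: "p.root_poly w \<in> polys (ratf w)"
    using rw cst_in_ratf[of _ w]
    by (auto simp: polys_def p.coeff_root_poly intro!: subfield_diff[OF rw(1)] subfield_0[OF rw(1)])
  have splitz: "p.root_poly z = Polynomial.smult (cst (lead_coeff P)) (\<Prod>a\<in>X. [:- a, 1:])"
    by (rule p.root_poly_split) (use X in auto)
  have mpr: "map_poly \<phi> (p.root_poly w) = p.root_poly z"
    using rw(3) cst_in_ratf[of _ w] \<phi>(2,3)
    by (auto intro!: poly_eqI simp: coeff_hom_poly[OF rw(1) \<phi>(1)] p.coeff_root_poly hom_on_diff[OF rw(1) \<phi>(1)])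
  have "\<exists>R' \<psi>. is_subfield R' \<and> ratf w \<subseteq> R' \<and> T \<subseteq> R' \<and> hom_on R' \<psi> \<and> (\<forall>x\<in>ratf w. \<psi> x = \<phi> x)"
  proof (rule hom_on_extend_finite[OF p.T_props(1) rw(1) \<phi>(1)])
    fix a assume "a \<in> T"
    then have "poly (p.root_poly w) a = 0" by (simp add: p.poly_root_poly p.T_props)
    then show "\<exists>f c B. f \<in> polys (ratf w) \<and> f \<noteq> 0 \<and> poly f a = 0 \<and> finite B \<and>
            map_poly \<phi> f = Polynomial.smult c (\<Prod>b\<in>B. [:- b, 1:])"
      using pr mpr p.root_poly_nz splitz X(1) by metis
  qed
  then obtain R' \<psi> where R': "is_subfield R'" "ratf w \<subseteq> R'" "T \<subseteq> R'" "hom_on R' \<psi>" "\<And>x. x \<in> ratf w \<Longrightarrow> \<psi> x = \<phi> x"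
    by blast
  define K where "K = gen_field (range cst \<union> {w} \<union> T)"
  have K: "is_subfield K" "range cst \<subseteq> K" "w \<in> K" "T \<subseteq> K"
  proof -
    show "is_subfield K" unfolding K_def by (rule is_subfield_gen_field)
    have "range cst \<union> {w} \<union> T \<subseteq> K" unfolding K_def by (rule gen_field_superset)
    then show "range cst \<subseteq> K" "w \<in> K" "T \<subseteq> K" by simp_all
  qed
  have "K \<subseteq> R'" unfolding K_def by (rule gen_field_least) (use R' rw in auto)
  then have \<psi>: "hom_on K \<psi>" by (rule hom_on_subset[OF R'(4)])
  have \<psi>c: "\<psi> (cst c) = cst c" for c using R'(5)[OF cst_in_ratf] \<phi>(2) by simp
  have \<psi>w: "\<psi> w = z" using R'(5)[OF rw(3)] \<phi>(3) by simp
  note \<psi> = \<psi> \<psi>c \<psi>w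
  have \<psi>T: "\<psi> a \<in> X" if "a \<in> T" for a
  proof -
    have "\<psi> (ev P a) = ev P (\<psi> a)" using hom_ev[OF K(1) \<psi>(1) K(2) _ \<psi>(2)] that K(4) by blast
    moreover have "\<psi> (a ^ e * w) = \<psi> a ^ e * z"
      using that K by (simp add: hom_on_mult[OF K(1) \<psi>(1)] hom_on_power[OF K(1) \<psi>(1)] subfield_power[OF K(1)] subset_eq \<psi>(3))
    ultimately have "poly (p.root_poly z) (\<psi> a) = 0"
      using p.T_props(4)[OF that] by (simp add: p.poly_root_poly)
    then have "poly (Polynomial.smult (cst (lead_coeff P)) (\<Prod>a\<in>X. [:- a, 1:])) (\<psi> a) = 0"
      unfolding splitz .
    then show ?thesis using X(1) p.P_nz by (auto simp: poly_prod)
  qed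
  have inj: "inj_on \<psi> K" by (rule hom_on_inj[OF K(1) \<psi>(1)])
  have "card (\<psi> ` T) = card X"
    using inj_on_subset[OF inj K(4)] X(2) p.T_props(2) by (simp add: card_image)
  then have \<psi>TX: "\<psi> ` T = X" using \<psi>T X(1) by (intro card_subset_eq) auto
  define I where "I = \<psi> ` K"
  have I: "is_subfield I" unfolding I_def by (rule is_subfield_hom_image[OF K(1) \<psi>(1)])
  have rotX: "rot c b \<in> X" if "b \<in> X" for b using b that by (cases "b = b1 \<or> b = b2") auto
  have stab: "rot c (\<psi> x) \<in> I" if "x \<in> K" for x
  proof -
    define R where "R = {x \<in> K. rot c (\<psi> x) \<in> I}"
    have "is_subfield R"
      by (rule is_subfieldI)
         (auto simp: R_def hom_on_0[OF K(1) \<psi>(1)] hom_on_1[OF K(1) \<psi>(1)] hom_on_add[OF K(1) \<psi>(1)]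
           hom_on_mult[OF K(1) \<psi>(1)] hom_on_uminus[OF K(1) \<psi>(1)] hom_on_inverse[OF K(1) \<psi>(1)]
           subfield_0[OF K(1)] subfield_1[OF K(1)] subfield_add[OF K(1)] subfield_mult[OF K(1)]
           subfield_uminus[OF K(1)] subfield_inverse[OF K(1)]
           rot_0[OF c(1)] rot_1[OF c(1)] rot_add[OF c(1)] rot_mult[OF c(1)] rot_inverse[OF c(1)]
           hom_on_uminus[OF is_subfield_UNIV hom_on_rot[OF c(1)]]
           subfield_0[OF I] subfield_1[OF I] subfield_add[OF I] subfield_mult[OF I]
           subfield_uminus[OF I] subfield_inverse[OF I])
    moreover have "range cst \<union> {w} \<union> T \<subseteq> R"
    proof -
      have "cst k \<in> R" for k using K(2) \<psi>(2)[of k] c(1) by (auto simp: R_def I_def intro!: image_eqI[of _ _ "cst k"])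
      moreover have "w \<in> R" using K(3) \<psi>(3) c(2) by (auto simp: R_def I_def intro!: image_eqI[of _ _ w])
      moreover have "a \<in> R" if "a \<in> T" for a
      proof -
        have "rot c (\<psi> a) \<in> \<psi> ` T" using rotX \<psi>T[OF that] \<psi>TX by blast
        then show ?thesis using that K(4) by (auto simp: R_def I_def)
      qed
      ultimately show ?thesis by blast
    qed
    ultimately have "K \<subseteq> R" unfolding K_def by (rule gen_field_least)
    then show ?thesis using that by (auto simp: R_def)
  qed
  \<comment> \<open>The rotation conjugated by \<open>\<psi>\<close>: injectivity of
    \<open>\<psi>\<close> on \<open>K\<close> and stability of its image make this a homomorphism of
    \<open>K\<close> into itself.\<close>
  define g where "g x = inv_into K \<psi> (rot c (\<psi> x))" for x
  have gK: "g x \<in> K" "\<psi> (g x) = rot c (\<psi> x)" if "x \<in> K" for x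
    using stab[OF that] unfolding g_def I_def by (auto intro: inv_into_into f_inv_into_f)
  have eqI: "y = y'" if "y \<in> K" "y' \<in> K" "\<psi> y = \<psi> y'" for y y' using inj that by (auto dest: inj_onD)
  have hom: "hom_on K g"
    unfolding hom_on_def
  proof (intro conjI ballI)
    have 1: "1 \<in> K" by (rule subfield_1[OF K(1)])
    show "g 1 = 1"
      by (rule eqI[OF gK(1)[OF 1] 1]) (simp only: gK(2)[OF 1] hom_on_1[OF K(1) \<psi>(1)] rot_1[OF c(1)])
  next
    fix x y assume xy: "x \<in> K" "y \<in> K"
    note gxy = gK(1)[OF xy(1)] gK(1)[OF xy(2)]
    note add = subfield_add[OF K(1) xy] and mult = subfield_mult[OF K(1) xy]
    show "g (x + y) = g x + g y"
      by (rule eqI[OF gK(1)[OF add] subfield_add[OF K(1) gxy]])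
         (simp only: gK(2)[OF add] gK(2)[OF xy(1)] gK(2)[OF xy(2)] hom_on_add[OF K(1) \<psi>(1) gxy]
           hom_on_add[OF K(1) \<psi>(1) xy] rot_add[OF c(1)])
    show "g (x * y) = g x * g y"
      by (rule eqI[OF gK(1)[OF mult] subfield_mult[OF K(1) gxy]])
         (simp only: gK(2)[OF mult] gK(2)[OF xy(1)] gK(2)[OF xy(2)] hom_on_mult[OF K(1) \<psi>(1) gxy]
           hom_on_mult[OF K(1) \<psi>(1) xy] rot_mult[OF c(1)])
  qed
  have gc: "g (cst k) = cst k" for k
  proof -
    have k: "cst k \<in> K" using K(2) by auto
    show ?thesis by (rule eqI[OF gK(1)[OF k] k]) (simp only: gK(2)[OF k] \<psi>(2) rot_cst[OF c(1)])
  qed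
  have gw: "g w = w" by (rule eqI[OF gK(1)[OF K(3)] K(3)]) (simp only: gK(2)[OF K(3)] \<psi>(3) c(2))
  obtain \<pi> where \<pi>: "\<pi> \<in> \<Gamma>" "\<And>a. a \<in> T \<Longrightarrow> \<pi> a = g a"
    using extend_to_\<Gamma>[OF K(1-3) hom gc gw] K(4) by blast
  obtain a1 a2 where a: "a1 \<in> T" "a2 \<in> T" "\<psi> a1 = b1" "\<psi> a2 = b2" using b(1,2) \<psi>TX by blast
  have \<pi>I: "\<pi> x = y" if "x \<in> T" "y \<in> T" "rot c (\<psi> x) = \<psi> y" for x y
  proof -
    have xy: "x \<in> K" "y \<in> K" using that K(4) by auto
    have "g x = y" by (rule eqI[OF gK(1)[OF xy(1)] xy(2)]) (simp only: gK(2)[OF xy(1)] that(3))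
    then show ?thesis using \<pi>(2)[OF that(1)] by simp
  qed
  have "\<pi> a1 = a2" "\<pi> a2 = a1" using a b(4,5) by (simp_all add: \<pi>I)
  moreover have "a1 \<noteq> a2" using a b(3) by auto
  moreover have "\<pi> x = x" if x: "x \<in> T" "x \<noteq> a1" "x \<noteq> a2" for x
  proof -
    have "\<psi> x \<noteq> \<psi> a1" "\<psi> x \<noteq> \<psi> a2"
      using x a(1,2) inj_onD[OF inj_on_subset[OF inj K(4)]] by blast+
    then show ?thesis using b(6)[OF \<psi>T[OF x(1)]] a(3,4) by (intro \<pi>I x(1)) simp
  qed
  ultimately show ?thesis using \<pi>(1) a(1,2) by blast
qed

end

text \<open>Makes the residue formula for small roots available for large ones, through the
  reflected polynomial.\<close>

lemma (in branch_roots) inverse_root: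
  assumes "a \<noteq> 0" "ev P a = a ^ e * w"
  shows "ev (reflect_poly P) (inverse a) = inverse a ^ f * w"
proof -
  have "map_poly cst (reflect_poly P) = reflect_poly (map_poly cst P)"
    by (rule poly_eqI) (simp add: coeff_map_poly coeff_reflect_poly degree_map_poly)
  then have "ev (reflect_poly P) (inverse a) = inverse a ^ degree P * ev P a"
    using assms(1) by (simp add: ev_def poly_reflect_poly_nz degree_map_poly)
  also have "\<dots> = inverse a ^ f * w"
    using assms f by (simp add: power_add field_simps)
  finally show ?thesis .
qed

text \<open>Equal logarithmic derivatives mean a constant ratio \<open>c\<close>, and comparing the
  equations of the two roots gives P(c t) = c^e P(t).\<close>

lemma (in branch_roots) dlog_inj:
  assumes "\<And>c. c \<noteq> 0 \<Longrightarrow> (\<And>i. coeff P i * c ^ e = coeff P i * c ^ i) \<Longrightarrow> c = 1"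
    and "a \<in> T" "b \<in> T" "dlog a = dlog b"
  shows "a = b"
proof -
  obtain c where c: "c \<noteq> 0" "a = cst c * b" using assms(2-4) T_props(3) dlog_eq_iff by blast
  have "ev P (cst c * b) = (cst c * b) ^ e * w" using T_props(4)[OF assms(2)] c(2) by simp
  then have "coeff P i * c ^ e = coeff P i * c ^ i" for i
    using scaled_roots[OF T_props(5,4)] assms(3) by blast
  then have "c = 1" using assms(1) c(1) by blast
  then show ?thesis using c(2) by simp
qed

text \<open>Being joined by a Galois transposition is an equivalence relation on \<open>T\<close>. A class of more than
  one root meets the small roots in an orbit of some power \<open>u \<mapsto> \<eta>\<^sup>m u\<close> and the sum of its logarithmic
  derivatives vanishes; comparing the residues of its product with \<open>w\<^sup>1\<^sup>/\<^sup>m\<close> on the small and on the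
  large roots gives an equality that \<open>indecomposable\<close> forbids unless \<open>m = 1\<close>.\<close>

locale walk_pair = root_pair +
  assumes unscaled_P: "\<And>c. c \<noteq> 0 \<Longrightarrow> (\<And>i. coeff P i * c ^ e = coeff P i * c ^ i) \<Longrightarrow> c = 1"
    and unscaled_Q: "\<And>c. c \<noteq> 0 \<Longrightarrow> (\<And>i. coeff Q i * c ^ e' = coeff Q i * c ^ i) \<Longrightarrow> c = 1"
    and transposition: "\<exists>\<pi>\<in>\<Gamma>. \<exists>a1\<in>T. \<exists>a2\<in>T. a1 \<noteq> a2 \<and> \<pi> a1 = a2 \<and> \<pi> a2 = a1 \<and>
      (\<forall>a\<in>T. a \<noteq> a1 \<longrightarrow> a \<noteq> a2 \<longrightarrow> \<pi> a = a)"
    and indecomposable: "\<And>m g g'. 2 \<le> m \<Longrightarrow> m dvd e \<Longrightarrow> m dvd p.f \<Longrightarrow> g ^ m = fps_of_poly P \<Longrightarrow>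
      g' ^ m = fps_of_poly (reflect_poly P) \<Longrightarrow> (g $ (e div m)) ^ m \<noteq> (g' $ (p.f div m)) ^ m"
    and same_spectrum: "\<And>n. coeff (P ^ n) (e * n) = coeff (Q ^ n) (e' * n)"
begin

lemmas dlog_inj_T = p.dlog_inj[OF unscaled_P]
lemmas dlog_inj_S = q.dlog_inj[OF unscaled_Q]

text \<open>The form in which equality of the spectra enters the Galois argument: both sums have
  coefficients read off from the return probabilities.\<close>

lemma sum_dlog_small: "(\<Sum>a\<in>p.A. dlog a) = (\<Sum>a\<in>q.A. dlog a)"
proof (rule fls_eqI)
  fix n
  show "(\<Sum>a\<in>p.A. dlog a) $$ n = (\<Sum>a\<in>q.A. dlog a) $$ n"
    using p.sum_dlog_A_nth[of "n + 1"] q.sum_dlog_A_nth[of "n + 1"] same_spectrum by simp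
qed

subsection \<open>All transpositions of the roots are Galois\<close>

text \<open>A transposition as seen on \<open>T\<close>; what \<open>\<pi>\<close> does on
  \<open>S\<close> is left open.\<close>

definition swap :: "complex fls \<Rightarrow> complex fls \<Rightarrow> (complex fls \<Rightarrow> complex fls) \<Rightarrow> bool" where
  "swap a b \<pi> \<longleftrightarrow> \<pi> \<in> \<Gamma> \<and> \<pi> a = b \<and> \<pi> b = a \<and> (\<forall>c\<in>T. c \<noteq> a \<longrightarrow> c \<noteq> b \<longrightarrow> \<pi> c = c)"

lemma swapD:
  assumes "swap a b \<pi>"
  shows "\<pi> \<in> \<Gamma>" "\<pi> a = b" "\<pi> b = a"
    and "\<And>c. c \<in> T \<Longrightarrow> c \<noteq> a \<Longrightarrow> c \<noteq> b \<Longrightarrow> \<pi> c = c"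
  using assms unfolding swap_def by blast+

lemma swapI:
  assumes "\<pi> \<in> \<Gamma>" "\<pi> a = b" "\<pi> b = a" "\<And>c. c \<in> T \<Longrightarrow> c \<noteq> a \<Longrightarrow> c \<noteq> b \<Longrightarrow> \<pi> c = c"
  shows "swap a b \<pi>"
  using assms unfolding swap_def by blast

definition tr :: "complex fls \<Rightarrow> complex fls \<Rightarrow> bool" where
  "tr a b \<longleftrightarrow> a = b \<or> (\<exists>\<pi>. swap a b \<pi>)"

lemma tr_refl: "tr a a"
  by (simp add: tr_def)

lemma trE:
  assumes "tr a b" "a \<noteq> b"
  obtains \<pi> where "swap a b \<pi>"
  using assms unfolding tr_def by blast

lemma trI: "swap a b \<pi> \<Longrightarrow> tr a b"
  unfolding tr_def by blast

lemma tr_sym: "tr a b \<Longrightarrow> tr b a"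
proof -
  assume ab: "tr a b"
  show "tr b a"
  proof (cases "a = b")
    case False
    with ab obtain \<pi> where \<pi>: "swap a b \<pi>" by (rule trE)
    have "swap b a \<pi>" by (rule swapI) (use swapD[OF \<pi>] in blast)+
    then show ?thesis by (rule trI)
  qed (simp add: tr_refl)
qed

text \<open>The transposition of \<open>b\<close> and \<open>c\<close> conjugated by that of
  \<open>a\<close> and \<open>b\<close> is the transposition of \<open>a\<close> and
  \<open>c\<close>.\<close>

lemma tr_trans:
  assumes T: "a \<in> T" "b \<in> T" "c \<in> T" and ab: "tr a b" and bc: "tr b c"
  shows "tr a c"
proof (cases "a = b \<or> b = c \<or> a = c")
  case False
  then have ne: "a \<noteq> b" "b \<noteq> c" "a \<noteq> c" by auto
  obtain \<pi> where \<pi>: "swap a b \<pi>" using ab ne(1) by (rule trE)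
  obtain \<rho> where \<rho>: "swap b c \<rho>" using bc ne(2) by (rule trE)
  have \<pi>c: "\<pi> c = c" using swapD(4)[OF \<pi> T(3)] ne by blast
  have \<rho>a: "\<rho> a = a" using swapD(4)[OF \<rho> T(1)] ne by blast
  have "swap a c (\<pi> \<circ> (\<rho> \<circ> \<pi>))"
  proof (rule swapI)
    show "\<pi> \<circ> (\<rho> \<circ> \<pi>) \<in> \<Gamma>" using swapD(1)[OF \<pi>] swapD(1)[OF \<rho>] \<Gamma>_comp by blast
    show "(\<pi> \<circ> (\<rho> \<circ> \<pi>)) a = c" by (simp only: comp_apply swapD(2)[OF \<pi>] swapD(2)[OF \<rho>] \<pi>c)
    show "(\<pi> \<circ> (\<rho> \<circ> \<pi>)) c = a" by (simp only: comp_apply swapD(3)[OF \<pi>] swapD(3)[OF \<rho>] \<pi>c)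
    fix d assume d: "d \<in> T" "d \<noteq> a" "d \<noteq> c"
    show "(\<pi> \<circ> (\<rho> \<circ> \<pi>)) d = d"
    proof (cases "d = b")
      case True
      then show ?thesis by (simp only: comp_apply swapD(3)[OF \<pi>] swapD(2)[OF \<pi>] \<rho>a)
    next
      case False
      then show ?thesis
        by (simp only: comp_apply swapD(4)[OF \<pi> d(1,2) False] swapD(4)[OF \<rho> d(1) False d(3)])
    qed
  qed
  then show ?thesis by (rule trI)
qed (use ab bc tr_refl in metis)

text \<open>Conjugating by \<open>\<rho>\<close> transports the transposition, so
  \<open>\<Gamma>\<close> permutes the classes of \<open>tr\<close>.\<close>

lemma tr_image:
  assumes T: "a \<in> T" "b \<in> T" and ab: "tr a b" and \<rho>: "\<rho> \<in> \<Gamma>"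
  shows "tr (\<rho> a) (\<rho> b)"
proof (cases "a = b")
  case False
  with ab obtain \<pi> where \<pi>: "swap a b \<pi>" by (rule trE)
  obtain \<sigma> where \<sigma>: "\<sigma> \<in> \<Gamma>" "\<sigma> \<circ> \<rho> = id" using \<Gamma>_inverse[OF \<rho>] by blast
  have img: "\<rho> ` T = T" using \<Gamma>_bij(1)[OF \<rho>] by (rule bij_betw_imp_surj_on)
  have \<sigma>\<rho>: "\<sigma> (\<rho> x) = x" for x using fun_cong[OF \<sigma>(2), of x] by simp
  have "swap (\<rho> a) (\<rho> b) (\<rho> \<circ> (\<pi> \<circ> \<sigma>))"
  proof (rule swapI)
    show "\<rho> \<circ> (\<pi> \<circ> \<sigma>) \<in> \<Gamma>" using swapD(1)[OF \<pi>] \<rho> \<sigma>(1) \<Gamma>_comp by blast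
    show "(\<rho> \<circ> (\<pi> \<circ> \<sigma>)) (\<rho> a) = \<rho> b" by (simp only: comp_apply \<sigma>\<rho> swapD(2)[OF \<pi>])
    show "(\<rho> \<circ> (\<pi> \<circ> \<sigma>)) (\<rho> b) = \<rho> a" by (simp only: comp_apply \<sigma>\<rho> swapD(3)[OF \<pi>])
    fix c assume c: "c \<in> T" "c \<noteq> \<rho> a" "c \<noteq> \<rho> b"
    then obtain d where d: "d \<in> T" "c = \<rho> d" using img by blast
    then have "\<pi> d = d" using c swapD(4)[OF \<pi> d(1)] by blast
    then show "(\<rho> \<circ> (\<pi> \<circ> \<sigma>)) c = c" by (simp only: comp_apply d(2) \<sigma>\<rho>)
  qed
  then show ?thesis by (rule trI)
qed (simp add: tr_refl)

lemma tr_rot: "a \<in> T \<Longrightarrow> b \<in> T \<Longrightarrow> tr a b \<Longrightarrow> tr (rot (\<eta> ^ j) a) (rot (\<eta> ^ j) b)"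
proof -
  assume ab: "a \<in> T" "b \<in> T" "tr a b"
  obtain \<pi> where \<pi>: "\<pi> \<in> \<Gamma>" "\<forall>a\<in>T \<union> S. \<pi> a = rot (\<eta> ^ j) a" using rot_in_\<Gamma> by blast
  have "\<pi> a = rot (\<eta> ^ j) a" "\<pi> b = rot (\<eta> ^ j) b" using \<pi>(2) ab(1,2) by blast+
  then show ?thesis using tr_image[OF ab \<pi>(1)] by simp
qed

lemma rot_T: "a \<in> T \<Longrightarrow> rot (\<eta> ^ j) a \<in> T"
  using p.rot_A[of a j] p.rot_B[of a j] unfolding p.T_def by blast

lemma rot_compose: "rot (\<eta> ^ i) (rot (\<eta> ^ j) a) = rot (\<eta> ^ (i + j)) a"
  unfolding rot_rot[OF p.\<eta>_pow p.\<eta>_pow] power_add ..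

text \<open>The factor u^(-M/m), an m-th root of \<open>w\<close>, is itself fixed by the rotation
  by \<eta>^(m i), because that multiplies it by a power of \<eta>^M = 1.\<close>

lemma residue_shift_rot:
  assumes "m dvd M"
  shows "(fls_X_intpow (- int (M div m)) * dlog (rot (\<eta> ^ (m * i)) a)) $$ (- 1) =
    (fls_X_intpow (- int (M div m)) * dlog a) $$ (- 1)"
proof -
  let ?n = "int (M div m)"
  have "(\<eta> ^ (m * i)) powi ?n = \<eta> powi (int (m * i) * ?n)" by (rule p.\<eta>_pow_powi)
  also have "int (m * i) * ?n = int M * int i" using assms by (metis dvd_mult_div_cancel mult.assoc mult.commute of_nat_mult)
  finally have "(\<eta> ^ (m * i)) powi ?n = 1" using p.\<eta>(2) by simp
  moreover have "(fls_X_intpow (- ?n) * dlog b) $$ (- 1) = dlog b $$ (?n - 1)" for b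
    unfolding X_intpow_mult_nth by simp
  ultimately show ?thesis using rot_dlog_nth[OF p.\<eta>_pow, of "m * i" a ?n] by simp
qed

lemma swap_permutes:
  assumes "swap a b \<pi>" "X \<subseteq> T" "a \<in> X" "b \<in> X"
  shows "bij_betw \<pi> X X"
proof -
  have "\<pi> c \<in> X" if "c \<in> X" for c
  proof (cases "c = a \<or> c = b")
    case True
    then show ?thesis using swapD(2,3)[OF assms(1)] assms(3,4) by auto
  next
    case False
    then have "\<pi> c = c" using swapD(4)[OF assms(1), of c] that assms(2) by blast
    then show ?thesis using that by simp
  qed
  then have "\<pi> ` X \<subseteq> X" by blast
  moreover have "inj_on \<pi> X"
    using inj_on_subset[OF bij_betw_imp_inj_on[OF \<Gamma>_bij(1)[OF swapD(1)[OF assms(1)]]] assms(2)] .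
  moreover have "finite X" using assms(2) p.T_props(1) by (rule finite_subset)
  ultimately show ?thesis by (simp add: bij_betw_def endo_inj_surj)
qed

text \<open>The stabiliser of \<open>a1\<close> is transitive on the rest of its class, so the
  product of the rest is a constant times a power of \<open>a1\<close>, and the sum over the class
  is (k + 1) dlog a1. The transposition preserves this sum but moves \<open>a1\<close> to
  \<open>a2\<close>, which forces k + 1 = 0.\<close>

lemma block_sum:
  obtains a1 where "a1 \<in> T" "(\<Sum>b\<in>{b\<in>T. tr a1 b}. dlog b) = 0"
proof -
  obtain \<pi> a1 a2 where \<pi>: "swap a1 a2 \<pi>" "a1 \<in> T" "a2 \<in> T" "a1 \<noteq> a2"
    using transposition unfolding swap_def by blast
  define B0 where "B0 = {b\<in>T. tr a1 b}"
  have B0: "finite B0" "B0 \<subseteq> T" "a1 \<in> B0" "a2 \<in> B0"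
    using p.T_props(1) \<pi>(2,3) tr_refl trI[OF \<pi>(1)] unfolding B0_def by simp_all
  have orbit: "{\<rho> a2 | \<rho>. \<rho> \<in> \<Gamma> \<and> \<rho> a1 = a1} = B0 - {a1}"
  proof (intro equalityI subsetI)
    fix b assume "b \<in> {\<rho> a2 | \<rho>. \<rho> \<in> \<Gamma> \<and> \<rho> a1 = a1}"
    then obtain \<rho> where \<rho>: "\<rho> \<in> \<Gamma>" "\<rho> a1 = a1" "b = \<rho> a2" by blast
    have "tr a1 (\<rho> a2)" using tr_image[OF \<pi>(2,3) trI[OF \<pi>(1)] \<rho>(1)] \<rho>(2) by simp
    moreover have "\<rho> a2 \<noteq> a1"
      using inj_onD[OF bij_betw_imp_inj_on[OF \<Gamma>_bij(1)[OF \<rho>(1)]], of a2 a1] \<pi>(2-4) \<rho>(2) by auto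
    ultimately show "b \<in> B0 - {a1}" using \<Gamma>_root(1)[OF \<rho>(1) \<pi>(3)] \<rho>(3) by (simp add: B0_def)
  next
    fix b assume b: "b \<in> B0 - {a1}"
    show "b \<in> {\<rho> a2 | \<rho>. \<rho> \<in> \<Gamma> \<and> \<rho> a1 = a1}"
    proof (cases "b = a2")
      case True
      have "b = id a2 \<and> id \<in> \<Gamma> \<and> id a1 = a1" using True \<Gamma>_id by simp
      then show ?thesis by blast
    next
      case False
      have "tr a2 b" using b \<pi>(2,3) tr_trans[OF \<pi>(3,2) _ tr_sym[OF trI[OF \<pi>(1)]]] by (simp add: B0_def)
      then obtain \<rho> where \<rho>: "swap a2 b \<rho>" using False by (metis trE)
      have "\<rho> a1 = a1" using swapD(4)[OF \<rho> \<pi>(2)] b \<pi>(4) by blast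
      then show ?thesis using swapD(1,2)[OF \<rho>] by blast
    qed
  qed
  obtain k where "(\<Sum>b\<in>B0 - {a1}. dlog b) = of_int k * dlog a1"
    using orbit_dlog[of a1 a2] \<pi>(2,3) unfolding orbit by blast
  then have sum: "(\<Sum>b\<in>B0. dlog b) = of_int (k + 1) * dlog a1"
    using sum.remove[OF B0(1,3), of dlog] by (simp add: algebra_simps)
  \<comment> \<open>Weights that put the sum over the class minus (k + 1) dlog a1 into the form of
    one integral combination.\<close>
  define n where "n b = (if b = a1 then - k else 1 :: int)" for b
  have nsum: "(\<Sum>b\<in>B0. of_int (n b) * h b) = (\<Sum>b\<in>B0. h b) - of_int (k + 1) * h a1" for h :: "complex fls \<Rightarrow> complex fls"
  proof -
    have "(\<Sum>b\<in>B0 - {a1}. of_int (n b) * h b) = (\<Sum>b\<in>B0 - {a1}. h b)" by (rule sum.cong) (auto simp: n_def)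
    then show ?thesis
      using sum.remove[OF B0(1,3), of h] sum.remove[OF B0(1,3), of "\<lambda>b. of_int (n b) * h b"]
      by (simp add: n_def algebra_simps)
  qed
  have "(\<Sum>b\<in>B0. of_int (n b) * dlog b) = 0" using nsum[of dlog] sum by simp
  moreover have "B0 \<subseteq> T \<union> S" using B0(2) by blast
  ultimately have "(\<Sum>b\<in>B0. of_int (n b) * dlog (\<pi> b)) = 0"
    by (intro \<Gamma>_relation[OF swapD(1)[OF \<pi>(1)]])
  moreover have "(\<Sum>b\<in>B0. dlog (\<pi> b)) = (\<Sum>b\<in>B0. dlog b)"
    by (rule sum.reindex_bij_betw[OF swap_permutes[OF \<pi>(1) B0(2-4)]])
  ultimately have "(\<Sum>b\<in>B0. dlog b) = of_int (k + 1) * dlog a2"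
    using nsum[of "\<lambda>b. dlog (\<pi> b)"] swapD(2)[OF \<pi>(1)] by simp
  then have "of_int (k + 1) * (dlog a1 - dlog a2) = 0" using sum by (simp add: algebra_simps)
  moreover have "dlog a1 - dlog a2 \<noteq> 0" using dlog_inj_T[OF _ _ \<pi>(2,3)] \<pi>(4) by auto
  ultimately have "(of_int (k + 1) :: complex fls) = 0" by (metis mult_eq_0_iff)
  then have "(\<Sum>b\<in>B0. dlog b) = 0" using sum by simp
  then show thesis using that \<pi>(2) by (simp add: B0_def)
qed

lemma sum_residues:
  assumes "X \<subseteq> T"
  shows "(\<Sum>a\<in>X. dlog a) $$ (- 1) = of_int (int (card (X \<inter> p.A)) * int (M div e) - int (card (X \<inter> p.B)) * int (M div p.f))"
proof -
  have fin: "finite X" using assms p.T_props(1) finite_subset by blast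
  have "(\<Sum>a\<in>X. dlog a) $$ (- 1) = (\<Sum>a\<in>X. of_int (fls_subdegree a))"
    using assms p.T_props(3) by (simp add: fls_nth_sum dlog_residue subset_eq)
  also have "\<dots> = (\<Sum>a\<in>X \<inter> p.A. of_int (fls_subdegree a)) + (\<Sum>a\<in>X \<inter> p.B. of_int (fls_subdegree a))"
  proof -
    have "X = (X \<inter> p.A) \<union> (X \<inter> p.B)" using assms by (auto simp: p.T_def)
    then show ?thesis using fin p.AB_disjoint by (metis (no_types, lifting) finite_Un sum.union_disjoint Int_assoc Int_commute Int_empty_right Int_left_commute)
  qed
  also have "(\<Sum>a\<in>X \<inter> p.A. complex_of_int (fls_subdegree a)) = of_nat (card (X \<inter> p.A)) * of_nat (M div e)"
    by (simp add: p.A_props)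
  also have "(\<Sum>a\<in>X \<inter> p.B. complex_of_int (fls_subdegree a)) = - of_nat (card (X \<inter> p.B)) * of_nat (M div p.f)"
    by (simp add: p.B_props)
  finally show ?thesis by simp
qed

lemma all_tr:
  assumes "a \<in> T" "b \<in> T"
  shows "tr a b"
proof -
  obtain a1 where a1: "a1 \<in> T" "(\<Sum>b\<in>{b\<in>T. tr a1 b}. dlog b) = 0" using block_sum by blast
  define B0 where "B0 = {b\<in>T. tr a1 b}"
  have B0: "finite B0" "B0 \<subseteq> T" "a1 \<in> B0" "(\<Sum>b\<in>B0. dlog b) = 0"
    using p.T_props(1) a1 by (auto simp: B0_def tr_refl)
  have B0_tr: "tr b c" if "b \<in> B0" "c \<in> B0" for b c
    using that tr_trans[of b a1 c] tr_sym a1(1) by (auto simp: B0_def)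
  have B0_I: "c \<in> B0" if "b \<in> B0" "c \<in> T" "tr b c" for b c
    using that tr_trans[of a1 b c] a1(1) by (auto simp: B0_def)
  have "int (card (B0 \<inter> p.A)) * int (M div e) = int (card (B0 \<inter> p.B)) * int (M div p.f)"
    using sum_residues[OF B0(2)] B0(4) by simp (metis diff_eq_eq add_0 of_int_0_eq_iff of_int_diff of_int_mult of_int_of_nat_eq of_nat_eq_iff of_nat_mult)
  then have bal: "card (B0 \<inter> p.A) * (M div e) = card (B0 \<inter> p.B) * (M div p.f)"
    by (metis of_nat_eq_iff of_nat_mult)
  have "card (B0 \<inter> p.A) + card (B0 \<inter> p.B) > 0"
    using B0 by (auto simp: p.T_def card_gt_0_iff)
  \<comment> \<open>The vanishing residue balances small against large roots of the class, so
    neither kind can be absent.\<close>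
  then have "card (B0 \<inter> p.A) > 0" "card (B0 \<inter> p.B) > 0" using bal p.div_pos by (metis add_is_0 mult_eq_0_iff neq0_conv)+
  then obtain \<alpha> \<beta> where \<alpha>: "\<alpha> \<in> B0" "\<alpha> \<in> p.A" and \<beta>: "\<beta> \<in> B0" "\<beta> \<in> p.B"
    by (metis Int_iff card_gt_0_iff ex_in_conv)
  \<comment> \<open>\<open>J\<close> holds for the exponents whose rotation preserves the class. It
    holds for \<open>e\<close> and \<open>f\<close>, since these rotations fix the small root
    \<alpha> and the large root \<beta> of the class respectively.\<close>
  define J where "J j \<longleftrightarrow> rot (\<eta> ^ j) \<alpha> \<in> B0" for j
  have inT: "rot (\<eta> ^ j) b \<in> T" if "b \<in> B0" for j b using rot_T that B0(2) by blast
  have J: "rot (\<eta> ^ j) b \<in> B0" if J: "J j" and b: "b \<in> B0" for j b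
  proof -
    have "tr (rot (\<eta> ^ j) \<alpha>) (rot (\<eta> ^ j) b)"
      by (rule tr_rot[OF subsetD[OF B0(2) \<alpha>(1)] subsetD[OF B0(2) b] B0_tr[OF \<alpha>(1) b]])
    then show ?thesis by (rule B0_I[OF J[unfolded J_def] inT[OF b]])
  qed
  have J': "J j" if b: "b \<in> B0" and jb: "rot (\<eta> ^ j) b \<in> B0" for j b
  proof -
    have "tr (rot (\<eta> ^ j) b) (rot (\<eta> ^ j) \<alpha>)"
      by (rule tr_rot[OF subsetD[OF B0(2) b] subsetD[OF B0(2) \<alpha>(1)] B0_tr[OF b \<alpha>(1)]])
    then show ?thesis unfolding J_def by (rule B0_I[OF jb inT[OF \<alpha>(1)]])
  qed
  have Je: "J e" unfolding J_def p.rot_e[OF \<alpha>(2)] by (rule \<alpha>(1))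
  have Jf: "J p.f" by (rule J'[OF \<beta>(1)]) (unfold p.rot_f[OF \<beta>(2)], rule \<beta>(1))
  \<comment> \<open>The exponents in \<open>J\<close> turn out to be exactly the multiples of this
    least one, which therefore divides both \<open>e\<close> and \<open>f\<close>.\<close>
  define m where "m = (LEAST j. 0 < j \<and> J j)"
  have m: "0 < m" "J m" using LeastI[of "\<lambda>j. 0 < j \<and> J j" e] Je p.e(1) by (auto simp: m_def)
  have m_le: "m \<le> j" if "0 < j" "J j" for j using that unfolding m_def by (intro Least_le) simp
  have Jmult: "J (m * k)" for k
  proof (induction k)
    case 0
    then show ?case using \<alpha>(1) by (simp add: J_def)
  next
    case (Suc k)
    then have "rot (\<eta> ^ m) (rot (\<eta> ^ (m * k)) \<alpha>) \<in> B0" using J[OF m(2)] by (simp add: J_def)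
    then show ?case by (simp add: J_def rot_compose)
  qed
  have m_dvd: "m dvd j" if "J j" for j
  proof -
    have "rot (\<eta> ^ (j mod m)) (rot (\<eta> ^ (m * (j div m))) \<alpha>) \<in> B0"
      using that by (simp add: J_def rot_compose)
    then have "J (j mod m)" using J'[of "rot (\<eta> ^ (m * (j div m))) \<alpha>"] Jmult by (simp add: J_def)
    then have "j mod m = 0" using m_le[of "j mod m"] m(1) by (metis mod_less_divisor not_le neq0_conv)
    then show ?thesis by auto
  qed
  have md: "m dvd e" "m dvd p.f" using m_dvd Je Jf by auto
  then have mM: "m dvd M" using p.M(2) dvd_trans by blast
  have shape: "\<exists>i. b = rot (\<eta> ^ (m * i)) \<gamma>"
    if \<gamma>: "\<gamma> \<in> B0" and b: "b \<in> B0" and ex: "\<exists>j. rot (\<eta> ^ j) \<gamma> = b" for b \<gamma>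
  proof -
    obtain j where j: "rot (\<eta> ^ j) \<gamma> = b" using ex by blast
    have "J j" by (rule J'[OF \<gamma>]) (unfold j, rule b)
    then obtain i where "j = m * i" using m_dvd by (meson dvdE)
    then show ?thesis using j by blast
  qed
  have "m = 1"
  proof (rule ccontr)
    assume "m \<noteq> 1"
    then have m2: "2 \<le> m" using m(1) by simp
    \<comment> \<open>An m-th root of \<open>w\<close>. The rotations preserving the class fix it,
      so its residue against the logarithmic derivative is the same for all small roots of the
      class, and the same for all large ones.\<close>
    define y :: "complex fls" where "y = fls_X_intpow (- int (M div m))"
    have ym: "y ^ m = p.w" unfolding y_def p.w_def fls_X_intpow_power using mM by (simp flip: of_nat_mult)
    define h where "h a = (y * dlog a) $$ (- 1)" for a
    have hA: "h b = h \<alpha>" if b: "b \<in> B0 \<inter> p.A" for b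
    proof -
      obtain i where "b = rot (\<eta> ^ (m * i)) \<alpha>"
        using shape[OF \<alpha>(1) _ p.A_orbit[OF \<alpha>(2)], of b] b by blast
      then show ?thesis unfolding h_def y_def using residue_shift_rot[OF mM] by simp
    qed
    have hB: "h b = h \<beta>" if b: "b \<in> B0 \<inter> p.B" for b
    proof -
      obtain i where "b = rot (\<eta> ^ (m * i)) \<beta>"
        using shape[OF \<beta>(1) _ p.B_orbit[OF \<beta>(2)], of b] b by blast
      then show ?thesis unfolding h_def y_def using residue_shift_rot[OF mM] by simp
    qed
    have "0 = (y * (\<Sum>b\<in>B0. dlog b)) $$ (- 1)" using B0(4) by simp
    also have "\<dots> = (\<Sum>b\<in>B0. h b)" by (simp add: sum_distrib_left fls_nth_sum h_def)
    also have "\<dots> = (\<Sum>b\<in>B0 \<inter> p.A. h b) + (\<Sum>b\<in>B0 \<inter> p.B. h b)"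
    proof -
      have "B0 = (B0 \<inter> p.A) \<union> (B0 \<inter> p.B)" using B0(2) by (auto simp: p.T_def)
      moreover have "(B0 \<inter> p.A) \<inter> (B0 \<inter> p.B) = {}" using p.AB_disjoint by auto
      ultimately show ?thesis using B0(1) sum.union_disjoint[of "B0 \<inter> p.A" "B0 \<inter> p.B" h] by (metis finite_Int)
    qed
    also have "\<dots> = of_nat (card (B0 \<inter> p.A)) * h \<alpha> + of_nat (card (B0 \<inter> p.B)) * h \<beta>"
      using hA hB by simp
    finally have sum0: "of_nat (card (B0 \<inter> p.A)) * h \<alpha> = - (of_nat (card (B0 \<inter> p.B)) * h \<beta>)"
      by (simp add: eq_neg_iff_add_eq_0)
    obtain g where g: "g ^ m = fps_of_poly P" using fps_nth_root_exists[of "fps_of_poly P" m] p.P0 m(1) by auto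
    obtain g' where g': "g' ^ m = fps_of_poly (reflect_poly P)"
      using fps_nth_root_exists[of "fps_of_poly (reflect_poly P)" m] p.P_nz m(1) by auto
    have gnz: "g \<noteq> 0" "g' \<noteq> 0" using g g' m(1) p.P_nz by (auto simp: power_0_left)
    have "(h \<alpha>) ^ m = (of_int (fls_subdegree \<alpha>) * g $ (e div m)) ^ m"
      unfolding h_def
    proof (rule residue_small_root_fractional[where P = P])
      show "ev P \<alpha> = \<alpha> ^ (m * (e div m)) * y ^ m"
        using p.A_props(5)[OF \<alpha>(2)] ym md(1) by simp
      show "\<alpha> \<noteq> 0" "0 < fls_subdegree \<alpha>" using p.A_props(3,4)[OF \<alpha>(2)] p.div_pos(1) by simp_all
      show "0 < m" "g ^ m = fps_of_poly P" "g \<noteq> 0" by (fact m(1) g gnz(1))+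
    qed
    then have h\<alpha>: "(h \<alpha>) ^ m = (of_nat (M div e) * g $ (e div m)) ^ m" using p.A_props(4)[OF \<alpha>(2)] by simp
    have \<beta>0: "\<beta> \<noteq> 0" by (rule p.B_props(3)[OF \<beta>(2)])
    have "(h (inverse \<beta>)) ^ m = (of_int (fls_subdegree (inverse \<beta>)) * g' $ (p.f div m)) ^ m"
      unfolding h_def
    proof (rule residue_small_root_fractional[where P = "reflect_poly P"])
      show "ev (reflect_poly P) (inverse \<beta>) = inverse \<beta> ^ (m * (p.f div m)) * y ^ m"
        using p.inverse_root[OF \<beta>0 p.B_props(5)[OF \<beta>(2)]] ym md(2) by simp
      show "inverse \<beta> \<noteq> 0" "0 < fls_subdegree (inverse \<beta>)"
        using p.B_props(4)[OF \<beta>(2)] \<beta>0 p.div_pos(2) by simp_all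
      show "0 < m" "g' ^ m = fps_of_poly (reflect_poly P)" "g' \<noteq> 0" by (fact m(1) g' gnz(2))+
    qed
    then have h\<beta>: "(- h \<beta>) ^ m = (of_nat (M div p.f) * g' $ (p.f div m)) ^ m"
      using p.B_props(4)[OF \<beta>(2)] \<beta>0 by (simp add: h_def dlog_inverse)
    \<comment> \<open>By the balance of residues the number of small roots times M/e equals the
      number of large roots times M/f. This common factor appears on both sides and cancels.\<close>
    define c where "c = complex_of_nat (card (B0 \<inter> p.A) * (M div e))"
    have c': "c = of_nat (card (B0 \<inter> p.B) * (M div p.f))" unfolding c_def bal ..
    have c0: "c \<noteq> 0" unfolding c_def using \<open>card (B0 \<inter> p.A) > 0\<close> p.div_pos by simp
    have "(c * g $ (e div m)) ^ m = (of_nat (card (B0 \<inter> p.A)) * h \<alpha>) ^ m"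
      unfolding c_def by (simp add: power_mult_distrib h\<alpha>)
    also have "\<dots> = (of_nat (card (B0 \<inter> p.B)) * (- h \<beta>)) ^ m" using sum0 by simp
    also have "\<dots> = (c * g' $ (p.f div m)) ^ m"
      unfolding c' using h\<beta> by (simp only: power_mult_distrib of_nat_mult) (simp add: power_mult_distrib)
    finally have "(g $ (e div m)) ^ m = (g' $ (p.f div m)) ^ m" using c0 by (simp add: power_mult_distrib)
    then show False using indecomposable[OF m2 md g g'] by blast
  qed
  \<comment> \<open>With m = 1 every rotation preserves the class, and rotations are transitive on
    the small and on the large roots.\<close>
  have inB0: "c \<in> B0" if c: "c \<in> T" for c
  proof -
    have rB0: "rot (\<eta> ^ j) \<gamma> \<in> B0" if "\<gamma> \<in> B0" for j \<gamma> using J[OF _ that, of j] Jmult[of j] \<open>m = 1\<close> by simp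
    consider "c \<in> p.A" | "c \<in> p.B" using c unfolding p.T_def by blast
    then show ?thesis
    proof cases
      case 1
      then obtain i where "rot (\<eta> ^ i) \<alpha> = c" using p.A_orbit[OF \<alpha>(2)] by blast
      then show ?thesis using rB0[OF \<alpha>(1), of i] by simp
    next
      case 2
      then obtain i where "rot (\<eta> ^ i) \<beta> = c" using p.B_orbit[OF \<beta>(2)] by blast
      then show ?thesis using rB0[OF \<beta>(1), of i] by simp
    qed
  qed
  show ?thesis by (rule B0_tr[OF inB0[OF assms(1)] inB0[OF assms(2)]])
qed

lemma swap_exists: "a \<in> T \<Longrightarrow> b \<in> T \<Longrightarrow> a \<noteq> b \<Longrightarrow> \<exists>\<pi>. swap a b \<pi>"
  using all_tr unfolding tr_def by blast

text \<open>Subtracting from the relation its image under the transposition of \<open>a\<close> and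
  \<open>b\<close> leaves (n a - n b) (dlog a - dlog b) = 0.\<close>

lemma independent:
  assumes rel: "(\<Sum>c\<in>T. of_int (n c) * dlog c) = 0" and ab: "a \<in> T" "b \<in> T"
  shows "n a = n b"
proof (rule ccontr)
  assume ne: "n a \<noteq> n b"
  then have nab: "a \<noteq> b" by auto
  then obtain \<pi> where \<pi>: "swap a b \<pi>" using swap_exists ab by blast
  have "(\<Sum>c\<in>T. of_int (n c) * dlog (\<pi> c)) = 0"
    by (rule \<Gamma>_relation[OF swapD(1)[OF \<pi>] Un_upper1 rel])
  then have "(\<Sum>c\<in>T. of_int (n c) * (dlog c - dlog (\<pi> c))) = 0"
    using rel by (simp add: right_diff_distrib sum_subtractf)
  also have "(\<Sum>c\<in>T. of_int (n c) * (dlog c - dlog (\<pi> c))) = (\<Sum>c\<in>{a, b}. of_int (n c) * (dlog c - dlog (\<pi> c)))"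
  proof (rule sum.mono_neutral_right[OF p.T_props(1)])
    show "{a, b} \<subseteq> T" using ab by simp
    show "\<forall>c\<in>T - {a, b}. of_int (n c) * (dlog c - dlog (\<pi> c)) = 0"
    proof
      fix c assume "c \<in> T - {a, b}"
      then have "\<pi> c = c" using swapD(4)[OF \<pi>] by blast
      then show "of_int (n c) * (dlog c - dlog (\<pi> c)) = 0" by simp
    qed
  qed
  also have "\<dots> = of_int (n a - n b) * (dlog a - dlog b)"
    using nab swapD(2,3)[OF \<pi>] by (simp add: algebra_simps)
  finally have "of_int (n a - n b) * (dlog a - dlog b) = 0" .
  moreover have "dlog a - dlog b \<noteq> 0" using dlog_inj_T[OF _ _ ab] nab by auto
  ultimately have "(of_int (n a - n b) :: complex fls) = 0" by (metis mult_eq_0_iff)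
  then show False using ne by simp
qed

lemma independent_set:
  assumes "C \<subseteq> T" "(\<Sum>c\<in>C. dlog c) = 0"
  shows "C = {} \<or> C = T"
proof (rule ccontr)
  assume "\<not> ?thesis"
  then obtain a b where ab: "a \<in> C" "b \<in> T" "b \<notin> C" using assms(1) by blast
  define n where "n c = (if c \<in> C then 1 else 0 :: int)" for c
  have "(\<Sum>c\<in>T. of_int (n c) * dlog c) = (\<Sum>c\<in>C. dlog c)"
    using assms(1) p.T_props(1) by (intro sum.mono_neutral_cong_right) (auto simp: n_def)
  then have "n a = n b" using independent[of n a b] assms ab by auto
  then show False using ab by (simp add: n_def)
qed

end

subsection \<open>Roots of the second polynomial as products of roots of the first\<close>

context walk_pair
begin

lemma
  fixes h :: "complex fls \<Rightarrow> complex fls"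
  assumes "\<pi> \<in> \<Gamma>"
  shows \<Gamma>_sum_T: "(\<Sum>a\<in>T. h (\<pi> a)) = (\<Sum>a\<in>T. h a)"
    and \<Gamma>_sum_S: "(\<Sum>a\<in>S. h (\<pi> a)) = (\<Sum>a\<in>S. h a)"
  by (rule sum.reindex_bij_betw[OF \<Gamma>_bij(1)[OF assms]], rule sum.reindex_bij_betw[OF \<Gamma>_bij(2)[OF assms]])

lemma \<Gamma>_sum_small:
  assumes "\<pi> \<in> \<Gamma>"
  shows "(\<Sum>a\<in>p.A. dlog (\<pi> a)) = (\<Sum>a\<in>q.A. dlog (\<pi> a))"
proof -
  \<comment> \<open>The small roots of the two equations may overlap, hence a difference of
    indicator functions on the union.\<close>
  define n where "n a = (if a \<in> p.A then 1 else 0) - (if a \<in> q.A then 1 else 0 :: int)" for a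
  have sum: "(\<Sum>a\<in>p.A \<union> q.A. of_int (n a) * h a) = (\<Sum>a\<in>p.A. h a) - (\<Sum>a\<in>q.A. h a)"
    for h :: "complex fls \<Rightarrow> complex fls"
  proof -
    have fin: "finite (p.A \<union> q.A)" using p.A_props(2) q.A_props(2) by (rule finite_UnI)
    have "(\<Sum>a\<in>p.A \<union> q.A. of_int (n a) * h a) =
        (\<Sum>a\<in>p.A \<union> q.A. (if a \<in> p.A then h a else 0) - (if a \<in> q.A then h a else 0))"
      by (intro sum.cong) (auto simp: n_def)
    also have "\<dots> = (\<Sum>a\<in>p.A \<union> q.A. if a \<in> p.A then h a else 0) - (\<Sum>a\<in>p.A \<union> q.A. if a \<in> q.A then h a else 0)"
      by (rule sum_subtractf)
    also have "(\<Sum>a\<in>p.A \<union> q.A. if a \<in> p.A then h a else 0) = (\<Sum>a\<in>p.A. h a)"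
      using fin by (simp add: sum.If_cases Int_absorb1)
    also have "(\<Sum>a\<in>p.A \<union> q.A. if a \<in> q.A then h a else 0) = (\<Sum>a\<in>q.A. h a)"
      using fin by (simp add: sum.If_cases Int_absorb1)
    finally show ?thesis .
  qed
  have "(\<Sum>a\<in>p.A \<union> q.A. of_int (n a) * dlog a) = 0" unfolding sum using sum_dlog_small by simp
  moreover have "p.A \<union> q.A \<subseteq> T \<union> S" using p.A_subset q.A_subset by blast
  ultimately have "(\<Sum>a\<in>p.A \<union> q.A. of_int (n a) * dlog (\<pi> a)) = 0" by (intro \<Gamma>_relation[OF assms])
  then show ?thesis unfolding sum by simp
qed

text \<open>Otherwise the stabiliser \<open>H\<close> of a root \<open>a1\<close> would be
  transitive on \<open>S\<close>. The sums \<open>Z\<close> over \<open>H\<close> would then be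
  constant on \<open>S\<close>, hence 0 there, and constant on \<open>T\<close> apart from
  \<open>a1\<close>. Their sums over \<open>T\<close> and over the small roots vanish, which makes Z
  a1 = 0, although it is card H times dlog a1.\<close>

lemma orbit_proper: "\<exists>\<sigma>\<in>S. \<exists>a\<in>T. {\<pi> a | \<pi>. \<pi> \<in> \<Gamma> \<and> \<pi> \<sigma> = \<sigma>} \<noteq> T"
proof (rule ccontr)
  assume "\<not> ?thesis"
  then have all: "{\<pi> a | \<pi>. \<pi> \<in> \<Gamma> \<and> \<pi> \<sigma> = \<sigma>} = T" if "\<sigma> \<in> S" "a \<in> T" for \<sigma> a using that by blast
  define a1 where "a1 = t"
  have a1: "a1 \<in> p.A" "a1 \<in> T" using p.t_in_A p.A_subset by (auto simp: a1_def)
  define H where "H = {\<pi> \<in> \<Gamma>. \<pi> a1 = a1}"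
  have H: "finite H" "id \<in> H" "H \<subseteq> \<Gamma>" using finite_\<Gamma> \<Gamma>_id by (auto simp: H_def)
  have Hcomp: "\<pi> \<circ> \<rho> \<in> H" if "\<pi> \<in> H" "\<rho> \<in> H" for \<pi> \<rho>
    using that \<Gamma>_comp by (auto simp: H_def)
  define Z where "Z a = (\<Sum>\<pi>\<in>H. dlog (\<pi> a))" for a
  have Z_inv: "Z (\<rho> a) = Z a" if "\<rho> \<in> H" for \<rho> a
  proof -
    have "bij_betw (\<lambda>\<pi>. \<pi> \<circ> \<rho>) H H"
      using that H(3) Hcomp by (intro \<Gamma>_right_mult) auto
    from sum.reindex_bij_betw[OF this, of "\<lambda>\<pi>. dlog (\<pi> a)"] show ?thesis by (simp add: Z_def)
  qed
  \<comment> \<open>Transitivity passes from one stabiliser to the other: an element taking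
    \<open>s1\<close> to \<open>s2\<close> is corrected by one that fixes \<open>s2\<close> and
    brings the image of \<open>a1\<close> back to \<open>a1\<close>.\<close>
  have S_trans: "\<exists>\<pi>\<in>H. \<pi> s1 = s2" if st: "s1 \<in> S" "s2 \<in> S" for s1 s2
  proof -
    obtain h where h: "h \<in> \<Gamma>" "h s1 = s2" using \<Gamma>_transitive_S[OF st] by blast
    have "h a1 \<in> T" using \<Gamma>_root(1)[OF h(1) a1(2)] .
    then have "a1 \<in> {\<pi> (h a1) | \<pi>. \<pi> \<in> \<Gamma> \<and> \<pi> s2 = s2}" using all[OF st(2)] a1(2) by blast
    then obtain g where g: "g \<in> \<Gamma>" "g s2 = s2" "g (h a1) = a1" by auto
    then have "g \<circ> h \<in> H" "(g \<circ> h) s1 = s2" using h \<Gamma>_comp by (auto simp: H_def)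
    then show ?thesis by blast
  qed
  have ZS: "Z s1 = 0" if "s1 \<in> S" for s1
  proof -
    have "Z s2 = Z s1" if "s2 \<in> S" for s2 using S_trans[OF \<open>s1 \<in> S\<close> that] Z_inv by auto
    then have "of_nat (card S) * Z s1 = (\<Sum>s2\<in>S. Z s2)" by simp
    also have "\<dots> = (\<Sum>\<pi>\<in>H. \<Sum>s2\<in>S. dlog (\<pi> s2))" unfolding Z_def by (rule sum.swap)
    also have "\<dots> = 0" using H(3) \<Gamma>_sum_S[of _ dlog] q.sum_dlog_T by (intro sum.neutral) auto
    finally show ?thesis using q.T_props(2) q.e by simp
  qed
  have ZT: "Z a = Z b" if ab: "a \<in> T - {a1}" "b \<in> T - {a1}" for a b
  proof (cases "a = b")
    case False
    then obtain \<pi> where \<pi>: "swap a b \<pi>" using swap_exists ab by blast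
    have "\<pi> a1 = a1" using swapD(4)[OF \<pi> a1(2)] that by blast
    then have "\<pi> \<in> H" using swapD(1)[OF \<pi>] by (simp add: H_def)
    then show ?thesis using Z_inv[of \<pi> a] swapD(2)[OF \<pi>] by simp
  qed simp
  have Z1: "Z a1 = of_nat (card H) * dlog a1"
  proof -
    have "Z a1 = (\<Sum>\<pi>\<in>H. dlog a1)" unfolding Z_def by (rule sum.cong) (auto simp: H_def)
    then show ?thesis by simp
  qed
  have "(\<Sum>a\<in>T. Z a) = (\<Sum>\<pi>\<in>H. \<Sum>a\<in>T. dlog (\<pi> a))" unfolding Z_def by (rule sum.swap)
  also have "\<dots> = 0" using H(3) \<Gamma>_sum_T[of _ dlog] p.sum_dlog_T by (intro sum.neutral) auto
  finally have sumT: "(\<Sum>a\<in>T. Z a) = 0" .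
  have "(\<Sum>a\<in>p.A. Z a) = (\<Sum>\<pi>\<in>H. \<Sum>a\<in>p.A. dlog (\<pi> a))" unfolding Z_def by (rule sum.swap)
  also have "\<dots> = (\<Sum>\<pi>\<in>H. \<Sum>a\<in>q.A. dlog (\<pi> a))" by (rule sum.cong[OF refl], rule \<Gamma>_sum_small) (use H(3) in auto)
  also have "\<dots> = (\<Sum>a\<in>q.A. Z a)" unfolding Z_def by (rule sum.swap)
  also have "\<dots> = 0" using ZS q.A_subset by (intro sum.neutral) auto
  finally have sumA: "(\<Sum>a\<in>p.A. Z a) = 0" .
  obtain b where b: "b \<in> T - {a1}" using p.t'_in_B a1(1) p.AB_disjoint p.B_eq by blast
  have "(\<Sum>a\<in>T. Z a) = Z a1 + (\<Sum>a\<in>T - {a1}. Z a)" using a1(2) p.T_props(1) by (simp add: sum.remove)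
  also have "(\<Sum>a\<in>T - {a1}. Z a) = (\<Sum>a\<in>T - {a1}. Z b)" using ZT b by (intro sum.cong) blast+
  also have "\<dots> = of_nat (e + p.f - 1) * Z b"
    using a1(2) p.T_props(1,2) p.f(2) by (simp add: card_Diff_singleton)
  finally have 1: "Z a1 + of_nat (e + p.f - 1) * Z b = 0" using sumT by simp
  have "(\<Sum>a\<in>p.A. Z a) = Z a1 + (\<Sum>a\<in>p.A - {a1}. Z a)" using a1(1) p.A_props(2) by (simp add: sum.remove)
  also have "(\<Sum>a\<in>p.A - {a1}. Z a) = (\<Sum>a\<in>p.A - {a1}. Z b)"
    using ZT b p.A_subset by (intro sum.cong) blast+
  also have "\<dots> = of_nat (e - 1) * Z b"
    using a1(1) p.A_props(1,2) by (simp add: card_Diff_singleton)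
  finally have 2: "Z a1 + of_nat (e - 1) * Z b = 0" using sumA by simp
  \<comment> \<open>The sum over \<open>T\<close> and the sum over the small roots differ by
    \<open>f\<close> copies of \<open>Z b\<close>, and \<open>f\<close> is positive.\<close>
  have "of_nat (e + p.f - 1) * Z b = of_nat (e - 1) * Z b" using 1 2 by (metis add_left_imp_eq)
  moreover have "(of_nat (e + p.f - 1) :: complex fls) = of_nat (e - 1) + of_nat p.f"
    using p.e(1) by (simp flip: of_nat_add)
  ultimately have "of_nat p.f * Z b = 0" by (metis add_cancel_left_right distrib_right)
  then have "Z b = 0" using p.f(1) by simp
  then have "of_nat (card H) * dlog a1 = 0" using 2 Z1 by simp
  moreover have "card H \<noteq> 0" using H(1,2) by auto
  ultimately have "dlog a1 = 0" by simp
  then show False using p.T_props(3,5)[OF a1(2)] dlog_eq_0_iff by blast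
qed

text \<open>Multiplicatively: \<sigma>^k is a constant times the product of
  \<open>C\<close>.\<close>

definition rel :: "int \<Rightarrow> complex fls set \<Rightarrow> complex fls \<Rightarrow> bool" where
  "rel k C \<sigma> \<longleftrightarrow> C \<subseteq> T \<and> \<sigma> \<in> S \<and> (\<Sum>c\<in>C. dlog c) = of_int k * dlog \<sigma>"

text \<open>\<open>k\<close> is nonzero because a proper nonempty set of roots has nonvanishing sum,
  and passing to the complement changes its sign.\<close>

lemma rel_exists: "\<exists>k C \<sigma>. 0 < k \<and> rel k C \<sigma> \<and> C \<noteq> {} \<and> C \<noteq> T"
proof -
  obtain \<sigma> a where sa: "\<sigma> \<in> S" "a \<in> T" "{\<pi> a | \<pi>. \<pi> \<in> \<Gamma> \<and> \<pi> \<sigma> = \<sigma>} \<noteq> T" using orbit_proper by blast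
  define C where "C = {\<pi> a | \<pi>. \<pi> \<in> \<Gamma> \<and> \<pi> \<sigma> = \<sigma>}"
  have C: "C \<subseteq> T" "a \<in> C" "C \<noteq> T"
  proof -
    show "C \<subseteq> T" using \<Gamma>_root(1)[OF _ sa(2)] unfolding C_def by blast
    have "a = id a \<and> id \<in> \<Gamma> \<and> id \<sigma> = \<sigma>" using \<Gamma>_id by simp
    then show "a \<in> C" unfolding C_def by blast
    show "C \<noteq> T" using sa(3) unfolding C_def .
  qed
  obtain k where k: "(\<Sum>c\<in>C. dlog c) = of_int k * dlog \<sigma>"
    using orbit_dlog[of \<sigma> a] sa(1,2) unfolding C_def by blast
  have "k \<noteq> 0" using independent_set[OF C(1)] k C(2,3) by auto
  show ?thesis
  proof (cases "0 < k")
    case True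
    then show ?thesis using k C sa(1) by (intro exI[of _ k] exI[of _ C] exI[of _ \<sigma>]) (auto simp: rel_def)
  next
    case False
    have "(\<Sum>c\<in>T - C. dlog c) = (\<Sum>c\<in>T. dlog c) - (\<Sum>c\<in>C. dlog c)"
      using p.T_props(1) C(1) by (rule sum_diff)
    then have "(\<Sum>c\<in>T - C. dlog c) = of_int (- k) * dlog \<sigma>" using k p.sum_dlog_T by simp
    then show ?thesis using False \<open>k \<noteq> 0\<close> C sa
      by (intro exI[of _ "- k"] exI[of _ "T - C"] exI[of _ \<sigma>]) (auto simp: rel_def)
  qed
qed

lemma rel_image:
  assumes "rel k C \<sigma>" "\<pi> \<in> \<Gamma>"
  shows "rel k (\<pi> ` C) (\<pi> \<sigma>)"
proof -
  have C: "C \<subseteq> T" "\<sigma> \<in> S" "finite C" using assms(1) p.T_props(1) finite_subset by (auto simp: rel_def)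
  define n where "n a = (if a \<in> C then 1 else 0) - (if a = \<sigma> then k else 0 :: int)" for a
  have sum: "(\<Sum>a\<in>insert \<sigma> C. of_int (n a) * h a) = (\<Sum>a\<in>C. h a) - of_int k * h \<sigma>"
    for h :: "complex fls \<Rightarrow> complex fls"
  proof -
    have "(\<Sum>a\<in>insert \<sigma> C. of_int (n a) * h a) =
        (\<Sum>a\<in>insert \<sigma> C. (if a \<in> C then h a else 0) - (if a = \<sigma> then of_int k * h a else 0))"
      by (intro sum.cong) (auto simp: n_def algebra_simps)
    also have "\<dots> = (\<Sum>a\<in>insert \<sigma> C. if a \<in> C then h a else 0) - (\<Sum>a\<in>insert \<sigma> C. if a = \<sigma> then of_int k * h a else 0)"
      by (rule sum_subtractf)
    also have "(\<Sum>a\<in>insert \<sigma> C. if a \<in> C then h a else 0) = (\<Sum>a\<in>C. h a)"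
      using C(3) by (intro sum.mono_neutral_cong_right) auto
    also have "(\<Sum>a\<in>insert \<sigma> C. if a = \<sigma> then of_int k * h a else 0) = of_int k * h \<sigma>"
      using C(3) by (subst sum.delta) auto
    finally show ?thesis .
  qed
  have "(\<Sum>a\<in>insert \<sigma> C. of_int (n a) * dlog a) = 0" unfolding sum using assms(1) by (simp add: rel_def)
  moreover have "insert \<sigma> C \<subseteq> T \<union> S" using C by blast
  ultimately have "(\<Sum>a\<in>insert \<sigma> C. of_int (n a) * dlog (\<pi> a)) = 0" by (intro \<Gamma>_relation[OF assms(2)])
  then have "(\<Sum>a\<in>C. dlog (\<pi> a)) = of_int k * dlog (\<pi> \<sigma>)" unfolding sum by simp
  moreover have "(\<Sum>a\<in>\<pi> ` C. dlog a) = (\<Sum>a\<in>C. dlog (\<pi> a))"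
    using inj_on_subset[OF bij_betw_imp_inj_on[OF \<Gamma>_bij(1)[OF assms(2)]] C(1)] by (simp add: sum.reindex)
  ultimately show ?thesis using C \<Gamma>_root[OF assms(2)] by (auto simp: rel_def)
qed

lemma card_image_\<Gamma>: "\<pi> \<in> \<Gamma> \<Longrightarrow> C \<subseteq> T \<Longrightarrow> card (\<pi> ` C) = card C"
  by (rule card_image, rule inj_on_subset[OF bij_betw_imp_inj_on[OF \<Gamma>_bij(1)]])

text \<open>Independence makes the difference of the two indicator functions constant on
  \<open>T\<close>; equality of the cardinalities makes this constant 0.\<close>

lemma rel_unique_set:
  assumes "rel k C \<sigma>" "rel k C' \<sigma>" "card C = card C'"
  shows "C = C'"
proof (rule ccontr)
  assume ne: "C \<noteq> C'"
  have C: "C \<subseteq> T" "C' \<subseteq> T" "finite C" "finite C'" using assms p.T_props(1) finite_subset by (auto simp: rel_def)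
  define n where "n a = (if a \<in> C then 1 else 0) - (if a \<in> C' then 1 else 0 :: int)" for a
  have "(\<Sum>a\<in>T. of_int (n a) * dlog a) = (\<Sum>a\<in>T. (if a \<in> C then dlog a else 0) - (if a \<in> C' then dlog a else 0))"
    by (intro sum.cong) (auto simp: n_def)
  also have "\<dots> = (\<Sum>a\<in>C. dlog a) - (\<Sum>a\<in>C'. dlog a)"
    unfolding sum_subtractf using C p.T_props(1) by (simp add: sum.If_cases Int_absorb1)
  also have "\<dots> = 0" using assms by (simp add: rel_def)
  finally have const: "n a = n b" if "a \<in> T" "b \<in> T" for a b using independent[of n] that by blast
  obtain a where a: "a \<in> C" "a \<notin> C'"
    using ne assms(3) C by (metis card_subset_eq subsetI)
  obtain b where b: "b \<in> C'" "b \<notin> C"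
    using ne assms(3) C by (metis card_subset_eq subsetI)
  show False using const[of a b] a b C by (auto simp: n_def)
qed

lemma rel_unique_root:
  assumes "rel k C \<sigma>" "rel k C \<sigma>'" "k \<noteq> 0"
  shows "\<sigma> = \<sigma>'"
proof -
  have "of_int k * (dlog \<sigma> - dlog \<sigma>') = 0" using assms(1,2) by (simp add: rel_def algebra_simps)
  then have "dlog \<sigma> = dlog \<sigma>'" using assms(3) by simp
  then show ?thesis using dlog_inj_S assms by (simp add: rel_def)
qed

lemma rel_subdegree:
  assumes "rel k C \<sigma>"
  shows "k * fls_subdegree \<sigma> = int (card (C \<inter> p.A)) * int (M div e) - int (card (C \<inter> p.B)) * int (M div p.f)"
proof -
  have C: "C \<subseteq> T" "\<sigma> \<in> S" using assms by (auto simp: rel_def)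
  have "(\<Sum>c\<in>C. dlog c) $$ (- 1) = of_int (k * fls_subdegree \<sigma>)"
    using assms q.T_props(3)[OF C(2)] by (simp add: rel_def dlog_residue)
  then show ?thesis using sum_residues[OF C(1)] by (metis of_int_eq_iff)
qed

lemma rel_all_roots:
  assumes "rel k C \<sigma>" "\<sigma>' \<in> S"
  shows "\<exists>C'. rel k C' \<sigma>' \<and> card C' = card C"
proof -
  obtain \<pi> where \<pi>: "\<pi> \<in> \<Gamma>" "\<pi> \<sigma> = \<sigma>'" using \<Gamma>_transitive_S[of \<sigma> \<sigma>'] assms by (auto simp: rel_def)
  then have "rel k (\<pi> ` C) \<sigma>'" using rel_image[OF assms(1)] by blast
  moreover have "card (\<pi> ` C) = card C" using card_image_\<Gamma>[OF \<pi>(1)] assms(1) by (simp add: rel_def)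
  ultimately show ?thesis by blast
qed

text \<open>The elements of \<open>C\<close> are exchanged one at a time by transpositions;
  \<open>\<sigma>\<close> moves along in an uncontrolled way but stays in \<open>S\<close>.\<close>

lemma rel_all_sets:
  assumes "rel k C \<sigma>" "C' \<subseteq> T" "card C' = card C"
  shows "\<exists>\<sigma>'. rel k C' \<sigma>'"
  using assms
proof (induction "card (C' - C)" arbitrary: C \<sigma>)
  case 0
  have fin: "finite C" "finite C'" using 0 p.T_props(1) finite_subset by (auto simp: rel_def)
  then have "C' \<subseteq> C" using 0 by (simp add: fin)
  then have "C' = C" using fin 0 by (simp add: card_subset_eq)
  then show ?case using 0 by blast
next
  case (Suc n)
  have fin: "finite C" "finite C'" and C: "C \<subseteq> T" using Suc.prems p.T_props(1) finite_subset by (auto simp: rel_def)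
  obtain b where b: "b \<in> C'" "b \<notin> C" using Suc.hyps(2) by (metis Diff_iff all_not_in_conv card.empty nat.distinct(1))
  have "\<not> C \<subseteq> C'" using b fin Suc.prems(3) by (metis card_subset_eq)
  then obtain a where a: "a \<in> C" "a \<notin> C'" by blast
  obtain \<pi> where \<pi>: "swap a b \<pi>" using swap_exists[of a b] a b C Suc.prems(2) by blast
  have \<pi>C: "\<pi> ` C = insert b (C - {a})"
  proof -
    have "\<pi> c = (if c = a then b else c)" if "c \<in> C" for c
    proof (cases "c = a")
      case False
      then show ?thesis using swapD(4)[OF \<pi>, of c] that b(2) C by (metis subsetD)
    qed (simp add: swapD(2)[OF \<pi>])
    then have "\<pi> ` C = (\<lambda>c. if c = a then b else c) ` C" by (intro image_cong) auto
    then show ?thesis using a by auto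
  qed
  have r: "rel k (insert b (C - {a})) (\<pi> \<sigma>)"
    using rel_image[OF Suc.prems(1) swapD(1)[OF \<pi>]] unfolding \<pi>C .
  have "C' - insert b (C - {a}) = (C' - C) - {b}" using a by auto
  then have "n = card (C' - insert b (C - {a}))" using b Suc.hyps(2) fin by simp
  moreover have "card C' = card (insert b (C - {a}))" using a b fin Suc.prems(3)
    by (simp add: card_Diff_singleton card_gt_0_iff)
       (metis Suc_pred card_gt_0_iff empty_iff)
  ultimately show ?case using Suc.hyps(1)[OF _ r Suc.prems(2)] by blast
qed

lemma rel_rot: "rel k C \<sigma> \<Longrightarrow> rel k (rot (\<eta> ^ j) ` C) (rot (\<eta> ^ j) \<sigma>)"
proof -
  assume r: "rel k C \<sigma>"
  obtain \<pi> where \<pi>: "\<pi> \<in> \<Gamma>" "\<forall>a\<in>T \<union> S. \<pi> a = rot (\<eta> ^ j) a" using rot_in_\<Gamma> by blast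
  have "\<pi> ` C = rot (\<eta> ^ j) ` C" using \<pi>(2) r by (intro image_cong) (auto simp: rel_def)
  then show ?thesis using rel_image[OF r \<pi>(1)] \<pi>(2) r by (auto simp: rel_def)
qed

text \<open>The order of the product of a set of given size increases strictly with the number of
  small roots in it. Within these bounds that number takes three consecutive values, whereas k times
  the order of a root in \<open>S\<close> takes only two.\<close>

lemma card_range:
  assumes r: "rel k C \<sigma>" and k: "0 < k" and c: "2 \<le> card C" "card C + 2 \<le> e + p.f" and ef: "2 \<le> e" "2 \<le> p.f"
  shows False
proof -
  \<comment> \<open>The least possible number of small roots in a set of this size; truncated
    subtraction gives 0 when the large roots suffice.\<close>
  define x where "x = card C - p.f"
  have x: "x + 2 \<le> e" "x + 2 \<le> card C" "card C - x \<le> p.f" using c ef by (auto simp: x_def)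
  have ex: "\<exists>C' \<sigma>. rel k C' \<sigma> \<and> card (C' \<inter> p.A) = y \<and> card (C' \<inter> p.B) = card C - y"
    if y: "x \<le> y" "y \<le> x + 2" for y
  proof -
    obtain X where X: "X \<subseteq> p.A" "card X = y" using obtain_subset_with_card_n[of y p.A] x y p.A_props(1) by auto
    have "card C - y \<le> p.f" using x y by linarith
    then obtain Y where Y: "Y \<subseteq> p.B" "card Y = card C - y"
      using obtain_subset_with_card_n[of "card C - y" p.B] p.B_props(1) by auto
    have disj: "X \<inter> Y = {}" using X Y p.AB_disjoint by auto
    have fin: "finite X" "finite Y" using X Y p.A_props(2) p.B_props(2) finite_subset by blast+
    have "card (X \<union> Y) = card C" using X Y disj fin x y by (simp add: card_Un_disjoint)
    moreover have "X \<union> Y \<subseteq> T" using X Y by (auto simp: p.T_def)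
    ultimately obtain \<sigma>' where "rel k (X \<union> Y) \<sigma>'" using rel_all_sets[OF r] by metis
    moreover have "(X \<union> Y) \<inter> p.A = X" "(X \<union> Y) \<inter> p.B = Y" using X Y p.AB_disjoint by auto
    ultimately show ?thesis using X(2) Y(2) by metis
  qed
  define v where "v y = int y * int (M div e) - int (card C - y) * int (M div p.f)" for y
  have val: "v y \<in> {k * int (M div e'), - k * int (M div q.f)}" if y: "x \<le> y" "y \<le> x + 2" for y
  proof -
    obtain C1 s1 where 1: "rel k C1 s1" "card (C1 \<inter> p.A) = y" "card (C1 \<inter> p.B) = card C - y"
      using ex[OF y] by blast
    have "v y = k * fls_subdegree s1" using rel_subdegree[OF 1(1)] 1 by (simp add: v_def)
    moreover have "s1 \<in> q.A \<or> s1 \<in> q.B" using 1(1) by (auto simp: rel_def q.T_def)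
    ultimately show ?thesis using q.A_props(4)[of s1] q.B_props(4)[of s1] by auto
  qed
  have step: "v y < v (Suc y)" if "Suc y \<le> card C" for y
  proof -
    have "int (card C - y) = int (card C - Suc y) + 1" using that by simp
    then show ?thesis using p.div_pos by (simp add: v_def algebra_simps)
  qed
  have "v x < v (Suc x)" "v (Suc x) < v (Suc (Suc x))" using step x by auto
  moreover have "v x \<in> {k * int (M div e'), - k * int (M div q.f)}"
    "v (Suc x) \<in> {k * int (M div e'), - k * int (M div q.f)}"
    "v (Suc (Suc x)) \<in> {k * int (M div e'), - k * int (M div q.f)}" using val by auto
  ultimately show False by auto
qed

lemma binomial_two_le:
  assumes "2 \<le> k" "k + 2 \<le> n"
  shows "n choose 2 \<le> n choose k"
proof (cases "2 * k \<le> n")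
  case True
  then show ?thesis using assms by (intro binomial_mono) auto
next
  case False
  then have "n choose 2 \<le> n choose (n - k)" using assms by (intro binomial_mono) auto
  then show ?thesis using assms by (simp add: binomial_symmetric[symmetric])
qed

text \<open>The single small root is fixed by all rotations, so \<eta>^f fixes \<open>T\<close>,
  hence also \<open>S\<close>, and the rotation orbits there give e' <= f and f' <= f for the end
  degrees of \<open>Q\<close>. On the other hand distinct sets belong to distinct roots in
  \<open>S\<close>, so the binomial coefficient of 1 + f over 2 is at most 2 f and f <= 3. What
  survives are the six products of pairs among four roots.\<close>

lemma one_small_root:
  assumes r: "rel k C \<sigma>" and k: "0 < k" and c: "2 \<le> card C" "card C + 2 \<le> e + p.f" and e: "e = 1"
  shows "p.f = 3 \<and> e' = 3 \<and> q.f = 3 \<and> k = 2 \<and> card C = 2"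
proof -
  have fixT: "rot (\<eta> ^ p.f) a = a" if "a \<in> T" for a
  proof -
    have "rot (\<eta> ^ (1 * p.f)) a = a" if "a \<in> p.A" for a
    proof -
      have *: "rot (\<eta> ^ n) a = a" for n
      proof (induction n)
        case (Suc n)
        have "rot (\<eta> ^ Suc n) a = rot (\<eta> ^ 1) (rot (\<eta> ^ n) a)" unfolding rot_compose by simp
        then show ?case unfolding Suc using p.rot_e[OF that] unfolding e by simp
      qed simp
      show ?thesis using * .
    qed
    then show ?thesis using that p.rot_f[of a] unfolding p.T_def by (metis UnE mult_1)
  qed
  have fixS: "rot (\<eta> ^ p.f) s1 = s1" if "s1 \<in> S" for s1
  proof -
    obtain C1 where C1: "rel k C1 s1" using rel_all_roots[OF r \<open>s1 \<in> S\<close>] by blast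
    have "rot (\<eta> ^ p.f) ` C1 = (\<lambda>a. a) ` C1" using C1 fixT by (intro image_cong refl) (unfold rel_def, blast)
    then have "rel k C1 (rot (\<eta> ^ p.f) s1)" using rel_rot[OF C1, of p.f] by simp
    then show ?thesis by (rule rel_unique_root[OF _ C1]) (use k in simp)
  qed
  have bound: "card X \<le> p.f" if X: "finite X" "s1 \<in> X" "X \<subseteq> S" "\<And>b. b \<in> X \<Longrightarrow> \<exists>i. rot (\<eta> ^ i) s1 = b" for X s1
  proof -
    have fix1: "rot (\<eta> ^ p.f) s1 = s1" using fixS[OF subsetD[OF X(3,2)]] .
    have "X \<subseteq> (\<lambda>i. rot (\<eta> ^ i) s1) ` {..<p.f}"
    proof
      fix b assume "b \<in> X"
      then obtain i where "rot (\<eta> ^ i) s1 = b" using X(4) by blast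
      then show "b \<in> (\<lambda>i. rot (\<eta> ^ i) s1) ` {..<p.f}"
        using p.orbit_closed[OF fix1 p.f(1), of i] by simp
    qed
    then have "card X \<le> card ((\<lambda>i. rot (\<eta> ^ i) s1) ` {..<p.f})" by (intro card_mono) auto
    also have "\<dots> \<le> p.f" using card_image_le[of "{..<p.f}"] by simp
    finally show ?thesis .
  qed
  have e'f: "e' \<le> p.f" using bound[OF q.A_props(2) q.t_in_A q.A_subset] q.A_orbit[OF q.t_in_A] q.A_props(1) by simp
  have f'f: "q.f \<le> p.f" using bound[OF q.B_props(2) q.t'_in_B] q.B_orbit[OF q.t'_in_B] q.B_props(1) q.B_eq by auto
  have "card {X. X \<subseteq> T \<and> card X = card C} \<le> card S"
  proof -
    define g where "g X = (SOME \<sigma>'. rel k X \<sigma>')" for X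
    have g: "rel k X (g X)" if "X \<subseteq> T" "card X = card C" for X
      unfolding g_def using rel_all_sets[OF r that] by (rule someI_ex)
    have "inj_on g {X. X \<subseteq> T \<and> card X = card C}"
    proof (rule inj_onI)
      fix X Y assume XY: "X \<in> {X. X \<subseteq> T \<and> card X = card C}" "Y \<in> {X. X \<subseteq> T \<and> card X = card C}" "g X = g Y"
      have 1: "rel k X (g X)" by (rule g) (use XY(1) in simp_all)
      have 2: "rel k Y (g X)" unfolding XY(3) by (rule g) (use XY(2) in simp_all)
      show "X = Y" by (rule rel_unique_set[OF 1 2]) (use XY(1,2) in simp)
    qed
    moreover have "g ` {X. X \<subseteq> T \<and> card X = card C} \<subseteq> S" using g by (auto simp: rel_def)
    ultimately show ?thesis using q.T_props(1) by (rule card_inj_on_le)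
  qed
  also have "card {X. X \<subseteq> T \<and> card X = card C} = (e + p.f) choose card C"
    using n_subsets[OF p.T_props(1)] p.T_props(2) p.f(2) by simp
  finally have le: "(e + p.f) choose card C \<le> e' + q.f" using q.T_props(2) q.f(2) by simp
  have "(e + p.f) choose 2 \<le> (e + p.f) choose card C" using c by (intro binomial_two_le) auto
  then have "(e + p.f) choose 2 \<le> e' + q.f" using le by simp
  then have "(1 + p.f) * p.f div 2 \<le> e' + q.f" unfolding e by (simp add: choose_two)
  moreover have "2 * ((1 + p.f) * p.f div 2) = (1 + p.f) * p.f"
    by (rule dvd_mult_div_cancel) simp
  ultimately have N0: "(1 + p.f) * p.f \<le> 2 * (e' + q.f)" by (metis mult_le_mono2)
  define N where "N = (1 + p.f) * p.f"
  have *: "N \<le> 2 * (e' + q.f)" using N0 by (simp only: N_def)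
  have "p.f \<le> 3"
  proof (rule ccontr)
    assume "\<not> p.f \<le> 3"
    then have "4 * p.f < N" unfolding N_def by (intro mult_strict_right_mono) auto
    then show False using * e'f f'f by presburger
  qed
  moreover have "3 \<le> p.f" using c e by simp
  ultimately have f3: "p.f = 3" by simp
  then have card2: "card C = 2" using c e by simp
  have "N = 12" using f3 by (simp add: N_def)
  \<comment> \<open>For f = 3 the estimate reads 12 <= 2 (e' + f'), with both degrees at most 3, so
    both bounds are attained.\<close>
  then have e'3: "e' = 3" "q.f = 3" using * e'f f'f f3 by presburger+
  obtain \<alpha> \<beta> where ab: "\<alpha> \<in> p.A" "\<beta> \<in> p.B" using p.t_in_A p.t'_in_B by blast
  have ne: "\<alpha> \<noteq> \<beta>" using ab p.AB_disjoint by auto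
  then obtain s1 where s1: "rel k {\<alpha>, \<beta>} s1" using rel_all_sets[OF r, of "{\<alpha>, \<beta>}"] ab card2 by (auto simp: p.T_def)
  have "{\<alpha>, \<beta>} \<inter> p.A = {\<alpha>}" "{\<alpha>, \<beta>} \<inter> p.B = {\<beta>}" using ab p.AB_disjoint by auto
  \<comment> \<open>A pair of one small and one large root has order M - M/3, twice the absolute
    order M/3 of every root in \<open>S\<close>; this determines \<open>k\<close>.\<close>
  then have "k * fls_subdegree s1 = int M - int (M div 3)"
    using rel_subdegree[OF s1] e f3 by simp
  moreover have "fls_subdegree s1 = int (M div 3) \<or> fls_subdegree s1 = - int (M div 3)"
  proof -
    have "fls_subdegree s1 = int (M div e') \<or> fls_subdegree s1 = - int (M div q.f)"
      using s1 q.A_props(4)[of s1] q.B_props(4)[of s1] unfolding rel_def q.T_def by blast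
    moreover have "M div e' = M div 3" by (simp only: e'3(1))
    moreover have "M div q.f = M div 3" by (simp only: e'3(2))
    ultimately show ?thesis by metis
  qed
  moreover have M3: "int M = 3 * int (M div 3)" "M div 3 > 0" using p.f(3) p.div_pos(2) f3 by auto
  ultimately have "k * int (M div 3) = 2 * int (M div 3) \<or> k * int (M div 3) = - 2 * int (M div 3)" by auto
  moreover have "0 < k * int (M div 3)" using M3(2) k by simp
  ultimately have "k = 2" using M3(2) by auto
  then show ?thesis using f3 e'3 card2 by simp
qed

end

text \<open>F_0 = g_0^3 and F_1 = 3 g_0^2 g_1, so the cube of g_1 is free of the choice of the cube
  root.\<close>

lemma fps_cube_nth:
  fixes g :: "complex fps"
  assumes "g ^ 3 = F"
  shows "27 * (g $ 1) ^ 3 * (F $ 0) ^ 2 = (F $ 1) ^ 3"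
proof -
  have "g ^ 3 = g * (g * g)" by (simp add: power3_eq_cube mult.assoc)
  then have "F $ 0 = (g $ 0) ^ 3" "F $ 1 = 3 * (g $ 0) ^ 2 * g $ 1"
    using assms by (auto simp: fps_mult_nth_1 power3_eq_cube power2_eq_square algebra_simps)
  then show ?thesis by (simp add: power_mult_distrib power2_eq_square power3_eq_cube algebra_simps)
qed

section \<open>Identification of the second polynomial\<close>

context walk_pair
begin

lemma degrees_from_subdegrees:
  assumes "int k * int (M div a) = int (M div b)" "a dvd M" "b dvd M"
  shows "a = k * b"
proof -
  obtain c d where cd: "M = a * c" "M = b * d" using assms(2,3) by (elim dvdE)
  have pos: "0 < a" "0 < b" "0 < c" "0 < d" using p.M(1) cd by (auto intro: Nat.gr0I)
  have "k * c = d" using assms(1) cd pos by (metis nonzero_mult_div_cancel_left of_nat_eq_iff of_nat_mult neq0_conv)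
  then have "a * c = (k * b) * c" using cd by (simp add: ac_simps)
  then show ?thesis using pos(3) by simp
qed

text \<open>\<open>X\<close> lists all sets of the relevant size by the roots in \<open>T\<close>,
  as singletons or as their complements; each such set belongs to exactly one root in
  \<open>S\<close>.\<close>

lemma singletons_case:
  assumes r: "rel k C \<sigma>" and k: "0 < k"
    and X: "\<And>a. a \<in> T \<Longrightarrow> X a \<subseteq> T \<and> card (X a) = card C" "inj_on X T"
    and surj: "\<And>C'. C' \<subseteq> T \<Longrightarrow> card C' = card C \<Longrightarrow> C' \<in> X ` T"
  shows "card S = card T"
proof -
  define g where "g a = (SOME \<sigma>'. rel k (X a) \<sigma>')" for a
  have g: "rel k (X a) (g a)" if "a \<in> T" for a
    unfolding g_def by (rule someI_ex[OF rel_all_sets[OF r]]) (use X(1)[OF that] in blast)+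
  have "inj_on g T"
  proof (rule inj_onI)
    fix a b assume ab: "a \<in> T" "b \<in> T" "g a = g b"
    have "rel k (X b) (g a)" using g[OF ab(2)] ab(3) by simp
    then have "X a = X b" using rel_unique_set[OF g[OF ab(1)]] X(1)[OF ab(1)] X(1)[OF ab(2)] by simp
    then show "a = b" using X(2) ab by (simp add: inj_on_eq_iff)
  qed
  moreover have "g ` T = S"
  proof (intro equalityI subsetI)
    fix \<sigma>' assume "\<sigma>' \<in> g ` T"
    then show "\<sigma>' \<in> S" using g unfolding rel_def by blast
  next
    fix \<sigma>' assume "\<sigma>' \<in> S"
    then obtain C' where C': "rel k C' \<sigma>'" "card C' = card C" using rel_all_roots[OF r] by blast
    then obtain a where a: "a \<in> T" "C' = X a" using surj[of C'] unfolding rel_def by blast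
    then have "g a = \<sigma>'" using rel_unique_root[OF g[OF a(1)]] C'(1) k by simp
    then show "\<sigma>' \<in> g ` T" using a(1) by blast
  qed
  ultimately show ?thesis using card_image by metis
qed

lemma root_side:
  assumes "\<sigma> \<in> S"
  shows "0 < fls_subdegree \<sigma> \<Longrightarrow> fls_subdegree \<sigma> = int (M div e')"
    and "fls_subdegree \<sigma> < 0 \<Longrightarrow> fls_subdegree \<sigma> = - int (M div q.f)"
proof -
  have "fls_subdegree \<sigma> = int (M div e') \<or> fls_subdegree \<sigma> = - int (M div q.f)"
    using assms q.A_props(4)[of \<sigma>] q.B_props(4)[of \<sigma>] unfolding q.T_def by blast
  then show "0 < fls_subdegree \<sigma> \<Longrightarrow> fls_subdegree \<sigma> = int (M div e')"
    and "fls_subdegree \<sigma> < 0 \<Longrightarrow> fls_subdegree \<sigma> = - int (M div q.f)" by auto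
qed

text \<open>Each root t is a constant times the k-th power of some s. Comparing orders of small and
  of large roots multiplies both end degrees by \<open>k\<close>, while \<open>S\<close> and
  \<open>T\<close> are equally large; so k = 1 and s = c t.\<close>

lemma rel_singleton:
  assumes r: "rel k C \<sigma>" and k: "0 < k" and c: "card C = 1"
  shows "e' = e \<and> (\<exists>c. c \<noteq> 0 \<and> (\<forall>i. coeff P i * c ^ e = coeff Q i * c ^ i))"
proof -
  have card: "card S = card T"
  proof (rule singletons_case[OF r k, of "\<lambda>a. {a}"])
    fix C' assume "C' \<subseteq> T" "card C' = card C"
    then show "C' \<in> (\<lambda>a. {a}) ` T" using c by (auto simp: card_1_singleton_iff)
  qed (use c in auto)
  have ex: "\<exists>\<sigma>. rel k {a} \<sigma> \<and> k * fls_subdegree \<sigma> = fls_subdegree a" if aT: "a \<in> T" for a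
  proof -
    obtain \<sigma> where \<sigma>: "rel k {a} \<sigma>" using rel_all_sets[OF r, of "{a}"] aT c by auto
    have "dlog a = of_int k * dlog \<sigma>" using \<sigma> by (simp add: rel_def)
    then have "dlog a $$ (- 1) = of_int k * dlog \<sigma> $$ (- 1)" by simp
    then have "(of_int (fls_subdegree a) :: complex) = of_int (k * fls_subdegree \<sigma>)"
      using p.T_props(3)[OF that] q.T_props(3)[of \<sigma>] \<sigma> by (simp add: dlog_residue rel_def)
    then have "k * fls_subdegree \<sigma> = fls_subdegree a" by (metis of_int_eq_iff)
    then show ?thesis using \<sigma> by blast
  qed
  obtain s1 where s1: "rel k {t} s1" "k * fls_subdegree s1 = fls_subdegree t"
    using ex[OF subsetD[OF p.A_subset p.t_in_A]] by blast
  have t'T: "t' \<in> T" using p.t'_in_B by (simp add: p.B_eq)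
  obtain s2 where s2: "rel k {t'} s2" "k * fls_subdegree s2 = fls_subdegree t'"
    using ex[OF t'T] by blast
  have sub: "fls_subdegree t = int (M div e)" "fls_subdegree t' = - int (M div p.f)"
    using p.A_props(4)[OF p.t_in_A] p.B_props(4)[OF p.t'_in_B] .
  have "0 < k * fls_subdegree s1" "k * fls_subdegree s2 < 0" using s1(2) s2(2) sub p.div_pos by simp_all
  then have "0 < fls_subdegree s1" "fls_subdegree s2 < 0" using k by (simp_all add: zero_less_mult_iff mult_less_0_iff)
  then have "fls_subdegree s1 = int (M div e')" "fls_subdegree s2 = - int (M div q.f)"
    using root_side s1(1) s2(1) by (simp_all add: rel_def)
  then have "int (nat k) * int (M div e') = int (M div e)" "int (nat k) * int (M div q.f) = int (M div p.f)"
    using s1(2) s2(2) sub k by simp_all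
  then have ke: "e' = nat k * e" "q.f = nat k * p.f"
    using degrees_from_subdegrees q.M(2) p.M(2) q.f(3) p.f(3) by blast+
  have "e' + q.f = e + p.f" using card p.T_props(2) q.T_props(2) p.f(2) q.f(2) by presburger
  moreover have "e' + q.f = nat k * (e + p.f)" unfolding distrib_left using ke by presburger
  ultimately have "nat k * (e + p.f) = e + p.f" by presburger
  then have "nat k = 1" using p.e(1) by simp
  then have k1: "k = 1" and ee: "e' = e" using ke k by auto
  have s1S: "s1 \<in> S" using s1(1) by (simp add: rel_def)
  have "dlog s1 = dlog t" using s1(1) k1 by (simp add: rel_def)
  then obtain c where c: "c \<noteq> 0" "s1 = cst c * t"
    using dlog_eq_iff[OF q.T_props(3)[OF s1S] p.t(1)] by blast
  have tT: "t \<in> T" using p.t_in_A p.A_subset by blast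
  have "ev Q (cst c * t) = (cst c * t) ^ e * w" using q.T_props(4)[OF s1S] unfolding c(2) ee .
  then have "coeff P i * c ^ e = coeff Q i * c ^ i" for i
    by (rule scaled_roots[OF p.T_props(5)[OF tT] p.T_props(4)[OF tT]])
  then show ?thesis using ee c(1) by blast
qed

text \<open>As the product of all roots is constant, omitting one of them leaves a constant multiple
  of its inverse. The argument for singletons then applies to 1/t and exchanges the end
  degrees.\<close>

lemma rel_cosingleton:
  assumes r: "rel k C \<sigma>" and k: "0 < k" and c: "card C + 1 = e + p.f"
  shows "e' = p.f \<and> (\<exists>c. c \<noteq> 0 \<and> (\<forall>i. coeff (reflect_poly P) i * c ^ p.f = coeff Q i * c ^ i))"
proof -
  have cT: "card T = e + p.f" using p.T_props(2) p.f(2) by simp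
  have cX: "card (T - {a}) = card C" if "a \<in> T" for a using that c cT p.T_props(1) by simp
  have card: "card S = card T"
  proof (rule singletons_case[OF r k, of "\<lambda>a. T - {a}"])
    show "inj_on (\<lambda>a. T - {a}) T" by (rule inj_onI) blast
    fix C' assume C': "C' \<subseteq> T" "card C' = card C"
    have "card (T - C') = 1" using C' c cT p.T_props(1) by (simp add: card_Diff_subset finite_subset)
    then obtain a where "T - C' = {a}" by (auto simp: card_1_singleton_iff)
    then have "C' = T - {a}" "a \<in> T" using C'(1) by auto
    then show "C' \<in> (\<lambda>a. T - {a}) ` T" by blast
  qed (use cX in auto)
  have ex: "\<exists>\<sigma>. \<sigma> \<in> S \<and> of_int k * dlog \<sigma> = - dlog a \<and> k * fls_subdegree \<sigma> = - fls_subdegree a" if aT: "a \<in> T" for a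
  proof -
    obtain \<sigma> where \<sigma>: "rel k (T - {a}) \<sigma>" using rel_all_sets[OF r, of "T - {a}"] cX[OF aT] by auto
    have "(\<Sum>c\<in>T - {a}. dlog c) = - dlog a"
      using p.sum_dlog_T sum.remove[OF p.T_props(1) that, of dlog] by (simp add: eq_neg_iff_add_eq_0 add.commute)
    then have rl: "of_int k * dlog \<sigma> = - dlog a" using \<sigma> by (simp add: rel_def)
    then have "(of_int k * dlog \<sigma>) $$ (- 1) = - (dlog a $$ (- 1))" by simp
    then have "(of_int (k * fls_subdegree \<sigma>) :: complex) = of_int (- fls_subdegree a)"
      using p.T_props(3)[OF that] q.T_props(3)[of \<sigma>] \<sigma> by (simp add: dlog_residue rel_def)
    then have "k * fls_subdegree \<sigma> = - fls_subdegree a" by (metis of_int_eq_iff)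
    then show ?thesis using \<sigma> rl by (auto simp: rel_def)
  qed
  have tT: "t \<in> T" using p.t_in_A p.A_subset by blast
  have t'T: "t' \<in> T" using p.t'_in_B by (simp add: p.B_eq)
  obtain s1 where s1: "s1 \<in> S" "of_int k * dlog s1 = - dlog t" "k * fls_subdegree s1 = - fls_subdegree t"
    using ex[OF tT] by blast
  obtain s2 where s2: "s2 \<in> S" "k * fls_subdegree s2 = - fls_subdegree t'"
    using ex[OF t'T] by blast
  have sub: "fls_subdegree t = int (M div e)" "fls_subdegree t' = - int (M div p.f)"
    using p.A_props(4)[OF p.t_in_A] p.B_props(4)[OF p.t'_in_B] .
  have "k * fls_subdegree s1 < 0" "0 < k * fls_subdegree s2" using s1(3) s2(2) sub p.div_pos by simp_all
  then have "fls_subdegree s1 < 0" "0 < fls_subdegree s2" using k by (simp_all add: zero_less_mult_iff mult_less_0_iff)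
  then have "fls_subdegree s1 = - int (M div q.f)" "fls_subdegree s2 = int (M div e')"
    using root_side s1(1) s2(1) by simp_all
  then have "int (nat k) * int (M div q.f) = int (M div e)" "int (nat k) * int (M div e') = int (M div p.f)"
    using s1(3) s2(2) sub k by simp_all
  then have ke: "q.f = nat k * e" "e' = nat k * p.f"
    using degrees_from_subdegrees q.M(2) p.M(2) q.f(3) p.f(3) by blast+
  have "e' + q.f = e + p.f" using card p.T_props(2) q.T_props(2) p.f(2) q.f(2) by presburger
  moreover have "e' + q.f = nat k * (e + p.f)" unfolding distrib_left using ke by (metis add.commute)
  ultimately have "nat k * (e + p.f) = e + p.f" by presburger
  then have "nat k = 1" using p.e(1) by simp
  then have k1: "k = 1" and ee: "e' = p.f" using ke k by auto
  have "dlog s1 = dlog (inverse t)" using s1(2) k1 p.t(1) by (simp add: dlog_inverse)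
  then obtain c where c: "c \<noteq> 0" "s1 = cst c * inverse t"
    using dlog_eq_iff[of s1 "inverse t"] q.T_props(3)[OF s1(1)] p.t(1) by auto
  have "fls_subdegree (inverse t) \<noteq> 0" using sub(1) p.div_pos(1) p.t(1) by simp
  then have nc: "inverse t \<notin> range cst" by (rule p.subdegree_not_const)
  have "ev Q (cst c * inverse t) = (cst c * inverse t) ^ p.f * w"
    using q.T_props(4)[OF s1(1)] unfolding c(2) ee .
  then have "coeff (reflect_poly P) i * c ^ p.f = coeff Q i * c ^ i" for i
    by (rule scaled_roots[OF nc p.inverse_root[OF p.t(1) p.T_props(4)[OF tT]]])
  then show ?thesis using ee c(1) by blast
qed

text \<open>Here s^2 is a constant times \<alpha> \<beta> with \<alpha> small and \<beta> large.
  Taking residues against w^(1/3), the root \<alpha> contributes nothing, so the residue for \<beta>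
  is twice the residue for s. Passing to 1/\<beta> brings in a minus sign, and the cubes equate a
  positive product of coefficients with a nonpositive one.\<close>

lemma no_exceptional_pair:
  assumes r: "rel 2 C \<sigma>" and c: "card C = 2" and deg: "e = 1" "p.f = 3" "e' = 3"
    and posP: "\<And>i. i \<le> degree P \<Longrightarrow> \<exists>x>0. coeff P i = complex_of_real x"
    and posQ: "\<And>i. \<exists>x\<ge>0. coeff Q i = complex_of_real x"
  shows False
proof -
  define \<beta> where "\<beta> = t'"
  define \<alpha> where "\<alpha> = t"
  have ab: "\<alpha> \<in> p.A" "\<beta> \<in> p.B" using p.t_in_A p.t'_in_B by (simp_all add: \<alpha>_def \<beta>_def)
  have ne: "\<alpha> \<noteq> \<beta>" using ab p.AB_disjoint by auto
  have "{\<alpha>, \<beta>} \<subseteq> T" "card {\<alpha>, \<beta>} = card C" using ab ne c by (auto simp: p.T_def)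
  then obtain s1 where s1: "rel 2 {\<alpha>, \<beta>} s1" using rel_all_sets[OF r] by blast
  have s1S: "s1 \<in> S" and dl: "dlog \<alpha> + dlog \<beta> = 2 * dlog s1" using s1 ne by (simp_all add: rel_def)
  have M3: "M = 3 * (M div 3)" "0 < M div 3" using p.f(3) p.div_pos(2) deg(2) by simp_all
  have "{\<alpha>, \<beta>} \<inter> p.A = {\<alpha>}" "{\<alpha>, \<beta>} \<inter> p.B = {\<beta>}" using ab p.AB_disjoint by auto
  then have "2 * fls_subdegree s1 = int M - int (M div 3)" using rel_subdegree[OF s1] deg by simp
  then have "0 < fls_subdegree s1" using M3 by linarith
  then have sub1: "fls_subdegree s1 = int (M div 3)" using root_side(1)[OF s1S] deg(3) by simp
  define y :: "complex fls" where "y = fls_X_intpow (- int (M div 3))"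
  have M3int: "int M = 3 * int (M div 3)" using M3(1) by presburger
  have y3: "y ^ 3 = w" unfolding y_def p.w_def fls_X_intpow_power using M3int by simp
  define h where "h a = (y * dlog a) $$ (- 1)" for a
  \<comment> \<open>For e = 1 the root \<alpha> is invariant under every rotation, so only exponents
    divisible by \<open>M\<close> survive, and M/3 is not one of them.\<close>
  have "h \<alpha> = 0"
  proof -
    have h\<alpha>: "h \<alpha> = dlog \<alpha> $$ (int (M div 3) - 1)" unfolding h_def y_def X_intpow_mult_nth by simp
    have "rot \<eta> \<alpha> = \<alpha>" using p.rot_e[OF ab(1)] deg(1) by simp
    then have "h \<alpha> = \<eta> powi int (M div 3) * h \<alpha>"
      using rot_dlog_nth[OF p.\<eta>(1), of \<alpha> "int (M div 3)"] h\<alpha> by simp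
    moreover have "\<not> int M dvd int (M div 3)" using M3 by (simp add: nat_dvd_not_less)
    then have "\<eta> powi int (M div 3) \<noteq> 1" using p.\<eta>(2) by blast
    ultimately show ?thesis by (metis mult_cancel_right1)
  qed
  moreover have "h \<alpha> + h \<beta> = 2 * h s1"
  proof -
    have "h \<alpha> + h \<beta> = (y * (dlog \<alpha> + dlog \<beta>)) $$ (- 1)" by (simp add: h_def distrib_left)
    also have "y * (dlog \<alpha> + dlog \<beta>) = y * dlog s1 + y * dlog s1" unfolding dl by (simp add: algebra_simps)
    finally show ?thesis by (simp add: h_def)
  qed
  ultimately have hh: "h \<beta> = 2 * h s1" by simp
  obtain g where g: "g ^ 3 = fps_of_poly Q" using fps_nth_root_exists[of "fps_of_poly Q" 3] q.P0 by auto
  obtain g' where g': "g' ^ 3 = fps_of_poly (reflect_poly P)"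
    using fps_nth_root_exists[of "fps_of_poly (reflect_poly P)" 3] p.P_nz by auto
  have gnz: "g \<noteq> 0" "g' \<noteq> 0" using g g' q.P_nz p.P_nz by (auto simp: power_0_left)
  have "h s1 ^ 3 = (of_int (fls_subdegree s1) * g $ 1) ^ 3"
    unfolding h_def
  proof (rule residue_small_root_fractional[where P = Q])
    show "ev Q s1 = s1 ^ (3 * 1) * y ^ 3" using q.T_props(4)[OF s1S] unfolding y3 deg(3) by simp
    show "s1 \<noteq> 0" by (rule q.T_props(3)[OF s1S])
    show "0 < fls_subdegree s1" "(0::nat) < 3" "g ^ 3 = fps_of_poly Q" "g \<noteq> 0"
      using sub1 M3(2) g gnz(1) by simp_all
  qed
  then have hs: "h s1 ^ 3 = of_nat (M div 3) ^ 3 * (g $ 1) ^ 3" unfolding sub1 by (simp add: power_mult_distrib)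
  have \<beta>0: "\<beta> \<noteq> 0" by (rule p.B_props(3)[OF ab(2)])
  have sub\<beta>: "fls_subdegree (inverse \<beta>) = int (M div 3)" using p.B_props(4)[OF ab(2)] \<beta>0 deg(2) by simp
  have "h (inverse \<beta>) ^ 3 = (of_int (fls_subdegree (inverse \<beta>)) * g' $ 1) ^ 3"
    unfolding h_def
  proof (rule residue_small_root_fractional[where P = "reflect_poly P"])
    show "ev (reflect_poly P) (inverse \<beta>) = inverse \<beta> ^ (3 * 1) * y ^ 3"
      using p.inverse_root[OF \<beta>0 p.B_props(5)[OF ab(2)]] unfolding y3 deg(2) by simp
    show "inverse \<beta> \<noteq> 0" "0 < fls_subdegree (inverse \<beta>)" using \<beta>0 sub\<beta> M3(2) by simp_all
    show "(0::nat) < 3" "g' ^ 3 = fps_of_poly (reflect_poly P)" "g' \<noteq> 0" using g' gnz(2) by simp_all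
  qed
  then have "(- h \<beta>) ^ 3 = of_nat (M div 3) ^ 3 * (g' $ 1) ^ 3"
    unfolding sub\<beta> using \<beta>0 by (simp add: h_def dlog_inverse power_mult_distrib)
  moreover have "(- h \<beta>) ^ 3 = - 8 * h s1 ^ 3" unfolding hh by (simp add: power3_eq_cube)
  ultimately have "of_nat (M div 3) ^ 3 * (- 8 * (g $ 1) ^ 3) = of_nat (M div 3) ^ 3 * (g' $ 1) ^ 3"
    unfolding hs by (simp add: ac_simps)
  moreover have nz: "complex_of_nat (M div 3) ^ 3 \<noteq> 0" using M3(2) by simp
  ultimately have gg: "- 8 * (g $ 1) ^ 3 = (g' $ 1) ^ 3" using mult_left_cancel[OF nz] by blast
  have 1: "27 * (g $ 1) ^ 3 * coeff Q 0 ^ 2 = coeff Q 1 ^ 3" using fps_cube_nth[OF g] by simp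
  have 2: "27 * (g' $ 1) ^ 3 * lead_coeff P ^ 2 = coeff P (degree P - 1) ^ 3"
  proof -
    have "coeff (reflect_poly P) 1 = coeff P (degree P - 1)" using p.e by (simp add: coeff_reflect_poly)
    then show ?thesis using fps_cube_nth[OF g'] by simp
  qed
  have "27 * (g' $ 1) ^ 3 * coeff Q 0 ^ 2 = - 8 * coeff Q 1 ^ 3"
    unfolding gg[symmetric] 1[symmetric] by simp
  then have "(27 * (g' $ 1) ^ 3 * coeff Q 0 ^ 2) * lead_coeff P ^ 2 = - 8 * coeff Q 1 ^ 3 * lead_coeff P ^ 2" by simp
  moreover have "(27 * (g' $ 1) ^ 3 * coeff Q 0 ^ 2) * lead_coeff P ^ 2 = coeff P (degree P - 1) ^ 3 * coeff Q 0 ^ 2"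
    unfolding 2[symmetric] by (simp only: ac_simps)
  ultimately have eq: "coeff P (degree P - 1) ^ 3 * coeff Q 0 ^ 2 = - 8 * coeff Q 1 ^ 3 * lead_coeff P ^ 2" by simp
  obtain x where x: "x > 0" "coeff P (degree P - 1) = of_real x" using posP[of "degree P - 1"] by auto
  obtain x' where x': "x' > 0" "lead_coeff P = of_real x'" using posP[of "degree P"] by auto
  obtain z where z: "z \<ge> 0" "coeff Q 0 = of_real z" using posQ[of 0] by auto
  obtain z' where z': "z' \<ge> 0" "coeff Q 1 = of_real z'" using posQ[of 1] by auto
  have "z \<noteq> 0" using z q.P0 by auto
  then have "0 < x ^ 3 * z ^ 2" using x z by simp
  moreover have "complex_of_real (x ^ 3 * z ^ 2) = of_real (- 8 * z' ^ 3 * x' ^ 2)"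
    using eq unfolding x x' z z' by simp
  then have "x ^ 3 * z ^ 2 = - 8 * z' ^ 3 * x' ^ 2" by (simp only: of_real_eq_iff)
  moreover have "0 \<le> z' ^ 3 * x' ^ 2" using z' by simp
  ultimately show False by linarith
qed

theorem scaled_or_reflected:
  assumes ef: "e \<le> p.f"
    and posP: "\<And>i. i \<le> degree P \<Longrightarrow> \<exists>x>0. coeff P i = complex_of_real x"
    and posQ: "\<And>i. \<exists>x\<ge>0. coeff Q i = complex_of_real x"
  shows "(e' = e \<and> (\<exists>c. c \<noteq> 0 \<and> (\<forall>i. coeff P i * c ^ e = coeff Q i * c ^ i))) \<or>
    (e' = p.f \<and> (\<exists>c. c \<noteq> 0 \<and> (\<forall>i. coeff (reflect_poly P) i * c ^ p.f = coeff Q i * c ^ i)))"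
proof -
  obtain k C \<sigma> where r: "0 < k" "rel k C \<sigma>" "C \<noteq> {}" "C \<noteq> T" using rel_exists by blast
  have C: "C \<subseteq> T" "finite C" using r(2) finite_subset[OF _ p.T_props(1)] by (auto simp: rel_def)
  have cT: "card T = e + p.f" using p.T_props(2) p.f(2) by simp
  have "0 < card C" using r(3) C(2) by (simp add: card_gt_0_iff)
  moreover have "card C < e + p.f" using r(4) C(1) cT p.T_props(1) by (metis psubset_card_mono psubsetI)
  ultimately consider "card C = 1" | "card C + 1 = e + p.f" | "2 \<le> card C" "card C + 2 \<le> e + p.f" by linarith
  then show ?thesis
  proof cases
    case 1
    then show ?thesis using rel_singleton[OF r(2,1)] by blast
  next
    case 2
    then show ?thesis using rel_cosingleton[OF r(2,1)] by blast
  next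
    case 3
    show ?thesis
    \<comment> \<open>Because of e <= f, a single large root occurs only together with a single
      small one, so this split covers it.\<close>
    proof (cases "e = 1")
      case True
      from one_small_root[OF r(2,1) 3 True] have *: "p.f = 3" "e' = 3" "k = 2" "card C = 2" by auto
      then show ?thesis using no_exceptional_pair[OF _ *(4) True *(1,2) posP posQ] r(2) by blast
    next
      case False
      then have "2 \<le> e" "2 \<le> p.f" using p.e(1) ef by auto
      then show ?thesis using card_range[OF r(2,1) 3] by blast
    qed
  qed
qed

end

subsection \<open>Monodromy at a double root\<close>

lemma ev_pcompose: "ev (pcompose p q) x = ev p (ev q x)"
  by (induction p) (simp_all add: pcompose_pCons ev_pCons)

lemma ev_monom_1: "ev (monom 1 n) x = x ^ n"
  by (induction n) (simp_all add: monom_0 monom_Suc ev_pCons)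

lemma pcompose_power_left: "pcompose (p ^ n) q = pcompose p q ^ n"
  for p q :: "'a :: comm_semiring_1 poly"
  by (induction n) (simp_all add: pcompose_mult pcompose_1)

lemma card_roots_squarefree:
  fixes p :: "complex poly"
  assumes "\<And>x. poly p x = 0 \<Longrightarrow> poly (pderiv p) x \<noteq> 0"
  shows "card {x. poly p x = 0} = degree p"
proof -
  have nz: "p \<noteq> 0" using assms by auto
  have sf: "rsquarefree p" unfolding rsquarefree_roots using assms by blast
  have "count (proots p) x = (if x \<in> {x. poly p x = 0} then 1 else 0)" for x
  proof -
    have "order x p = 0 \<or> order x p = 1" using sf by (simp add: rsquarefree_def)
    then show ?thesis using nz order_root[of p x] by auto
  qed
  then have "proots p = mset_set {x. poly p x = 0}"
    using poly_roots_finite[OF nz] by (intro multiset_eqI) (simp add: count_mset_set')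
  then show ?thesis using size_proots_complex[of p] by simp
qed

text \<open>After moving the root to 0, D(t)/t^k has order \<open>n\<close> there and can be
  inverted up to an n-th root. Leaving \<open>c\<close> free gives all branches needed later: c = u
  and c = -u at the double root, c = u^2 at a simple one.\<close>

lemma branch_at_root:
  fixes D V :: "complex poly"
  assumes D: "D = [:- \<rho>, 1:] ^ n * V" and V: "poly V \<rho> \<noteq> 0" and \<rho>: "\<rho> \<noteq> 0" and n: "0 < n"
  shows "\<exists>b. b $ 0 = 0 \<and> b $ 1 \<noteq> 0 \<and> (\<forall>c. c $ 0 = 0 \<longrightarrow>
    ev D (fps_to_fls (fps_const \<rho> + (b oo c))) = fps_to_fls (fps_const \<rho> + (b oo c)) ^ k * fps_to_fls (c ^ n))"
proof -
  define Vs where "Vs = fps_of_poly (pcompose V [:\<rho>, 1:])"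
  define E where "E = fps_of_poly ([:\<rho>, 1:] ^ k)"
  define Ds where "Ds = fps_of_poly (pcompose D [:\<rho>, 1:])"
  have V0: "Vs $ 0 \<noteq> 0" unfolding Vs_def using V by (simp add: poly_0_coeff_0[symmetric] poly_pcompose)
  have E0: "E $ 0 \<noteq> 0" unfolding E_def using \<rho> by (simp add: poly_0_coeff_0[symmetric])
  have "pcompose [:- \<rho>, 1:] [:\<rho>, 1:] = [:0, 1:]" by (simp add: pcompose_pCons)
  then have "pcompose D [:\<rho>, 1:] = [:0, 1:] ^ n * pcompose V [:\<rho>, 1:]"
    unfolding D by (simp add: pcompose_mult pcompose_power_left)
  then have Ds: "Ds = fps_X ^ n * Vs" unfolding Ds_def Vs_def
    by (simp add: fps_of_poly_mult fps_of_poly_power fps_of_poly_pCons)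
  define G where "G = fps_X ^ n * (Vs * inverse E)"
  have u: "(Vs * inverse E) $ 0 \<noteq> 0" using V0 E0 by simp
  have unz: "Vs * inverse E \<noteq> 0" using u by auto
  have Gnz: "G \<noteq> 0" unfolding G_def using unz by (intro no_zero_divisors) simp_all
  have "subdegree G = n" unfolding G_def
    using unz subdegree_eq_0[OF u] by (subst subdegree_mult) simp_all
  note G = Gnz this
  have GE: "G * E = Ds" unfolding G_def Ds using E0 by (simp add: mult.assoc inverse_mult_eq_1)
  obtain b where b: "b $ 0 = 0" "b $ 1 \<noteq> 0" "G oo b = fps_X ^ n" using fps_branch[OF G n] by blast
  have "ev D (fps_to_fls (fps_const \<rho> + (b oo c))) = fps_to_fls (fps_const \<rho> + (b oo c)) ^ k * fps_to_fls (c ^ n)"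
    if c: "c $ 0 = 0" for c
  proof -
    define b' where "b' = b oo c"
    have b'0: "b' $ 0 = 0" using b(1) by (simp add: b'_def)
    have X: "cst \<rho> + fps_to_fls b' = ev [:\<rho>, 1:] (fps_to_fls b')" by (simp add: ev_pCons)
    have sum: "fps_to_fls (fps_const \<rho> + b') = ev [:\<rho>, 1:] (fps_to_fls b')"
      by (simp add: ev_pCons fps_const_to_fls)
    have "G oo b' = fps_X ^ n oo c" unfolding b'_def fps_compose_assoc[OF c b(1)] b(3) ..
    also have "\<dots> = c ^ n" unfolding fps_compose_power[OF c, symmetric] by (simp add: c)
    finally have Gc: "G oo b' = c ^ n" .
    have "ev D (ev [:\<rho>, 1:] (fps_to_fls b')) = fps_to_fls (Ds oo b')"
      unfolding ev_pcompose[symmetric] Ds_def by (rule ev_fps[OF b'0])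
    also have "Ds oo b' = c ^ n * (E oo b')"
      unfolding GE[symmetric] fps_compose_mult_distrib[OF b'0] Gc ..
    also have "fps_to_fls (c ^ n * (E oo b')) = fps_to_fls (E oo b') * fps_to_fls (c ^ n)"
      by (simp add: fls_times_fps_to_fls mult.commute)
    also have "fps_to_fls (E oo b') = ev [:\<rho>, 1:] (fps_to_fls b') ^ k"
      unfolding E_def ev_fps[OF b'0, symmetric] by (rule ev_power)
    finally show ?thesis unfolding b'_def[symmetric] sum .
  qed
  then show ?thesis using b by blast
qed

text \<open>P - t^e has a zero of order exactly two at 1 and otherwise simple zeros. Over w = 1 +
  u^2 the two roots near 1 are a branch in u and the same branch in -u, exchanged by u -> -u; the
  roots near the simple zeros are series in u^2 and stay fixed.\<close>

lemma (in root_pair) transposition_at_double_root: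
  assumes P: "P = monom 1 e + [:- 1, 1:] ^ 2 * R" and R1: "poly R 1 \<noteq> 0"
    and sf: "\<And>x. poly R x = 0 \<Longrightarrow> poly (pderiv R) x \<noteq> 0"
  shows "\<exists>\<pi>\<in>\<Gamma>. \<exists>a1\<in>T. \<exists>a2\<in>T. a1 \<noteq> a2 \<and> \<pi> a1 = a2 \<and> \<pi> a2 = a1 \<and> (\<forall>a\<in>T. a \<noteq> a1 \<longrightarrow> a \<noteq> a2 \<longrightarrow> \<pi> a = a)"
proof -
  define D where "D = [:- 1, 1:] ^ 2 * R"
  define Y where "Y = {x. poly R x = 0}"
  have R0: "R \<noteq> 0" using R1 by auto
  have Y: "finite Y" "card Y = degree R" "1 \<notin> Y"
    using poly_roots_finite[OF R0] card_roots_squarefree[of R] sf R1 by (auto simp: Y_def)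
  have degD: "degree D = degree R + 2"
    unfolding D_def using R0 by (simp add: degree_mult_eq degree_power_eq)
  have degP: "degree P = degree R + 2"
  proof (rule ccontr)
    assume ne: "degree P \<noteq> degree R + 2"
    have "P = monom 1 e + D" by (simp add: P D_def)
    have "e < degree P" by (rule p.e(2))
    then have "coeff D (degree P) = coeff P (degree P)" unfolding \<open>P = monom 1 e + D\<close> by simp
    then have "degree P \<le> degree D" using p.P_nz by (intro le_degree) auto
    then have "e < degree D" using \<open>e < degree P\<close> by simp
    then have "coeff P (degree D) = lead_coeff D" unfolding \<open>P = monom 1 e + D\<close> by simp
    moreover have "D \<noteq> 0" using R0 by (simp add: D_def)
    ultimately have "degree D \<le> degree P" by (intro le_degree) simp
    then show False using ne degD \<open>degree P \<le> degree D\<close> by simp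
  qed
  define Z :: "complex fls" where "Z = fps_to_fls (1 + fps_X ^ 2)"
  define A where "A \<rho> b c = fps_to_fls (fps_const \<rho> + (b oo c))" for \<rho> and b c :: "complex fps"
  have evP: "ev P a = a ^ e * Z" if "ev D a = a ^ e * fps_to_fls (fps_X ^ 2)" for a
  proof -
    have "ev P a = a ^ e + ev D a" by (simp add: P D_def ev_monom_1)
    then show ?thesis unfolding that Z_def by (simp add: distrib_left)
  qed
  obtain b1 where b1: "b1 $ 0 = 0" "b1 $ 1 \<noteq> 0"
    "\<And>c. c $ 0 = 0 \<Longrightarrow> ev D (A 1 b1 c) = A 1 b1 c ^ e * fps_to_fls (c ^ 2)"
    using branch_at_root[of D 1 2 R e] R1 unfolding A_def D_def by auto
  have "\<exists>b. b $ 0 = 0 \<and> (\<forall>c. c $ 0 = 0 \<longrightarrow> ev D (A \<rho> b c) = A \<rho> b c ^ e * fps_to_fls (c ^ 1))" if \<rho>Y: "\<rho> \<in> Y" for \<rho>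
  proof -
    have r0: "poly R \<rho> = 0" using \<rho>Y by (simp add: Y_def)
    then obtain V where V: "R = [:- \<rho>, 1:] * V" by (auto simp: poly_eq_0_iff_dvd dvd_def)
    have "pderiv R = [:- \<rho>, 1:] * pderiv V + V" unfolding V pderiv_mult by (simp add: pderiv_pCons)
    then have "poly V \<rho> \<noteq> 0" using sf[OF r0] by simp
    moreover have "\<rho> \<noteq> 1" using \<rho>Y Y(3) by auto
    ultimately have V2: "poly ([:- 1, 1:] ^ 2 * V) \<rho> \<noteq> 0" by simp
    have \<rho>0: "\<rho> \<noteq> 0"
    proof
      assume "\<rho> = 0"
      then have "poly P 0 = 0" using r0 p.e(1) by (simp add: P poly_monom)
      then show False using p.P0 by (simp add: poly_0_coeff_0)
    qed
    have D: "D = [:- \<rho>, 1:] ^ 1 * ([:- 1, 1:] ^ 2 * V)" unfolding D_def V by (simp only: power_one_right ac_simps)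
    have pos: "0 < (1 :: nat)" by simp
    show ?thesis using branch_at_root[OF D V2 \<rho>0 pos, of e] unfolding A_def by blast
  qed
  then obtain b where b: "\<And>\<rho>. \<rho> \<in> Y \<Longrightarrow> b \<rho> $ 0 = 0"
    "\<And>\<rho> c. \<rho> \<in> Y \<Longrightarrow> c $ 0 = 0 \<Longrightarrow> ev D (A \<rho> (b \<rho>) c) = A \<rho> (b \<rho>) c ^ e * fps_to_fls (c ^ 1)"
    by metis
  have A0: "A \<rho> g c $$ 0 = \<rho>" if "g $ 0 = 0" "c $ 0 = 0" for \<rho> g c using that by (simp add: A_def)
  \<comment> \<open>This is -u, written as a constant times the variable to match the definition of
    \<open>rot\<close>.\<close>
  define m where "m = fps_const (- 1 :: complex) * fps_X"
  have m: "m \<noteq> 0" "m $ 0 = 0" "m oo m = fps_X" "(fps_X ^ 2 :: complex fps) oo m = fps_X ^ 2"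
  proof -
    have m': "m = - fps_X" unfolding m_def by (simp flip: fps_const_neg)
    show "m \<noteq> 0" "m $ 0 = 0" unfolding m' by simp_all
    then show "m oo m = fps_X" unfolding m' by (simp add: fps_compose_uminus)
    show "(fps_X ^ 2 :: complex fps) oo m = fps_X ^ 2"
      using \<open>m $ 0 = 0\<close> unfolding m' by (simp add: fps_compose_power[symmetric])
  qed
  have rotA: "rot (- 1) (A \<rho> g c) = A \<rho> g (c oo m)" if "c $ 0 = 0" for \<rho> g c
  proof -
    have "(fps_const \<rho> + (g oo c)) oo m = fps_const \<rho> + (g oo (c oo m))"
      unfolding fps_compose_assoc[OF m(2) that] by (simp add: fps_compose_add_distrib)
    then show ?thesis
      unfolding rot_def A_def m_def[symmetric] fls_compose_fps_to_fls[OF m(1,2)] by (rule arg_cong)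
  qed
  define X where "X = insert (A 1 b1 fps_X) (insert (A 1 b1 m) ((\<lambda>\<rho>. A \<rho> (b \<rho>) (fps_X ^ 2)) ` Y))"
  have X1: "A 1 b1 fps_X $$ 0 = 1" "A 1 b1 m $$ 0 = 1" using A0 b1(1) m(2) by simp_all
  have XY: "A \<rho> (b \<rho>) (fps_X ^ 2) $$ 0 = \<rho>" if "\<rho> \<in> Y" for \<rho> using A0 b(1)[OF that] by simp
  have ne: "A 1 b1 fps_X \<noteq> A 1 b1 m"
  proof
    assume "A 1 b1 fps_X = A 1 b1 m"
    then have "b1 = b1 oo m" by (simp add: A_def)
    then have "b1 $ 1 = (b1 oo m) $ 1" by simp
    then show False using b1(1,2) by (simp add: m_def fps_compose_linear)
  qed
  have notin: "A 1 b1 fps_X \<notin> (\<lambda>\<rho>. A \<rho> (b \<rho>) (fps_X ^ 2)) ` Y" "A 1 b1 m \<notin> (\<lambda>\<rho>. A \<rho> (b \<rho>) (fps_X ^ 2)) ` Y"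
  proof -
    have img: "a $$ 0 \<in> Y" if "a \<in> (\<lambda>\<rho>. A \<rho> (b \<rho>) (fps_X ^ 2)) ` Y" for a
    proof -
      from that obtain \<rho> where "\<rho> \<in> Y" "a = A \<rho> (b \<rho>) (fps_X ^ 2)" by (rule imageE)
      then show ?thesis using XY by simp
    qed
    show "A 1 b1 fps_X \<notin> (\<lambda>\<rho>. A \<rho> (b \<rho>) (fps_X ^ 2)) ` Y" "A 1 b1 m \<notin> (\<lambda>\<rho>. A \<rho> (b \<rho>) (fps_X ^ 2)) ` Y"
      using img X1 Y(3) by metis+
  qed
  have "inj_on (\<lambda>\<rho>. A \<rho> (b \<rho>) (fps_X ^ 2)) Y" by (rule inj_onI) (metis XY)
  then have cX: "card X = degree P"
    unfolding X_def using ne notin Y degP by (simp add: card_image)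
  have evX: "ev P a = a ^ e * Z" if a: "a \<in> X" for a
  proof (rule evP)
    have "m = - fps_X" unfolding m_def by (simp flip: fps_const_neg)
    then have m2: "m ^ 2 = fps_X ^ 2" by (simp add: power2_eq_square)
    consider "a = A 1 b1 fps_X" | "a = A 1 b1 m" | \<rho> where "\<rho> \<in> Y" "a = A \<rho> (b \<rho>) (fps_X ^ 2)"
      using a unfolding X_def by blast
    then show "ev D a = a ^ e * fps_to_fls (fps_X ^ 2)"
    proof cases
      case 1
      show ?thesis unfolding 1 by (rule b1(3)) simp
    next
      case 2
      show ?thesis unfolding 2 b1(3)[OF m(2)] m2 ..
    next
      case 3
      show ?thesis using b(2)[OF 3(1), of "fps_X ^ 2"] unfolding 3(2) by simp
    qed
  qed
  have Z: "Z \<notin> range cst"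
  proof
    assume "Z \<in> range cst"
    then obtain c where "Z = cst c" by blast
    then have "Z $$ 2 = cst c $$ 2" by simp
    then show False by (simp add: Z_def)
  qed
  have "(1 + fps_X ^ 2) oo m = 1 + fps_X ^ 2" by (simp add: fps_compose_add_distrib m(4))
  then have "rot (- 1) Z = Z"
    unfolding rot_def Z_def m_def[symmetric] fls_compose_fps_to_fls[OF m(1,2)] by (rule arg_cong)
  moreover have "rot (- 1) (A 1 b1 fps_X) = A 1 b1 m" "rot (- 1) (A 1 b1 m) = A 1 b1 fps_X"
    using rotA[of fps_X] rotA[OF m(2)] m by simp_all
  moreover have "rot (- 1) a = a" if aX: "a \<in> X" and aX_ne: "a \<noteq> A 1 b1 fps_X" "a \<noteq> A 1 b1 m" for a
  proof -
    obtain \<rho> where "\<rho> \<in> Y" "a = A \<rho> (b \<rho>) (fps_X ^ 2)" using aX aX_ne unfolding X_def by blast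
    then show ?thesis using rotA[of "fps_X ^ 2"] m(4) by simp
  qed
  ultimately show ?thesis
    using transposition_from_place[OF Z _ cX evX, of "- 1" "A 1 b1 fps_X" "A 1 b1 m"] Y(1) ne
    by (simp add: X_def)
qed

section \<open>Polynomial functions on the space of shapes\<close>

definition polyfun :: "((int \<Rightarrow> complex) \<Rightarrow> complex) \<Rightarrow> bool" where
  "polyfun h \<longleftrightarrow> (\<exists>P. \<forall>\<kappa>. h \<kappa> = poly_value P \<kappa>)"

lemma polyfun_const: "polyfun (\<lambda>\<kappa>. c)"
  unfolding polyfun_def
  by (rule exI[of _ "Poly_Mapping.single 0 c"]) (simp add: monom_value_def)

lemma polyfun_coord: "polyfun (\<lambda>\<kappa>. \<kappa> k)"
  unfolding polyfun_def
  by (rule exI[of _ "Poly_Mapping.single (Poly_Mapping.single k 1) 1"]) (simp add: monom_value_def)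

lemma polyfun_add: "polyfun g \<Longrightarrow> polyfun h \<Longrightarrow> polyfun (\<lambda>\<kappa>. g \<kappa> + h \<kappa>)"
  unfolding polyfun_def by (metis poly_value_add)

lemma polyfun_mult: "polyfun g \<Longrightarrow> polyfun h \<Longrightarrow> polyfun (\<lambda>\<kappa>. g \<kappa> * h \<kappa>)"
  unfolding polyfun_def by (metis poly_value_mult)

lemma polyfun_diff: "polyfun g \<Longrightarrow> polyfun h \<Longrightarrow> polyfun (\<lambda>\<kappa>. g \<kappa> - h \<kappa>)"
  using polyfun_add[of g "\<lambda>\<kappa>. (- 1) * h \<kappa>"] polyfun_mult[OF polyfun_const, of h "- 1"] by simp

lemma polyfun_sum: "(\<And>i. i \<in> A \<Longrightarrow> polyfun (h i)) \<Longrightarrow> polyfun (\<lambda>\<kappa>. \<Sum>i\<in>A. h i \<kappa>)"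
  by (induction A rule: infinite_finite_induct) (auto intro: polyfun_const polyfun_add)

lemma polyfun_prod: "(\<And>i. i \<in> A \<Longrightarrow> polyfun (h i)) \<Longrightarrow> polyfun (\<lambda>\<kappa>. \<Prod>i\<in>A. h i \<kappa>)"
  by (induction A rule: infinite_finite_induct) (auto intro: polyfun_const polyfun_mult)

lemma polyfun_power: "polyfun h \<Longrightarrow> polyfun (\<lambda>\<kappa>. h \<kappa> ^ n)"
  by (induction n) (auto intro: polyfun_const polyfun_mult)

lemma polyfun_if: "polyfun g \<Longrightarrow> polyfun h \<Longrightarrow> polyfun (\<lambda>\<kappa>. if b then g \<kappa> else h \<kappa>)"
  by (cases b) simp_all

lemma polyfun_poly_value: "polyfun (poly_value P)"
  unfolding polyfun_def by blast

lemma polyfun_reflect: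
  assumes "polyfun h"
  shows "polyfun (\<lambda>\<kappa>. h (\<lambda>k. \<kappa> (- k)))"
proof -
  obtain P where P: "\<And>\<kappa>. h \<kappa> = poly_value P \<kappa>" using assms unfolding polyfun_def by blast
  have "polyfun (\<lambda>\<kappa>. poly_value P (\<lambda>k. \<kappa> (- k)))"
  proof (induction P rule: coord_poly_induct)
    case (single m c)
    show ?case unfolding poly_value_single monom_value_def
      by (intro polyfun_mult polyfun_const polyfun_prod polyfun_power polyfun_coord)
  qed (simp_all add: poly_value_add polyfun_const polyfun_add)
  then show ?thesis by (simp add: P)
qed

lemma polyfun_on_line:
  assumes "polyfun h"
  shows "\<exists>p. \<forall>x. h (\<lambda>k. \<kappa> k + x * \<delta> k) = poly p x"
proof -
  obtain P where P: "\<And>\<kappa>. h \<kappa> = poly_value P \<kappa>" using assms unfolding polyfun_def by blast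
  have "\<exists>p. \<forall>x. poly_value P (\<lambda>k. \<kappa> k + x * \<delta> k) = poly p x"
  proof (induction P rule: coord_poly_induct)
    case zero
    show ?case by (rule exI[of _ 0]) simp
  next
    case (single m c)
    show ?case
      by (rule exI[of _ "[:c:] * (\<Prod>k\<in>Poly_Mapping.keys m. [:\<kappa> k, \<delta> k:] ^ Poly_Mapping.lookup m k)"])
        (simp add: monom_value_def poly_prod)
  next
    case (add A B)
    then obtain a b where "\<forall>x. poly_value A (\<lambda>k. \<kappa> k + x * \<delta> k) = poly a x"
      "\<forall>x. poly_value B (\<lambda>k. \<kappa> k + x * \<delta> k) = poly b x" by blast
    then show ?case by (intro exI[of _ "a + b"]) (simp add: poly_value_add)
  qed
  then show ?thesis by (simp add: P)
qed

section \<open>Irreducibility of the space of shapes\<close>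

lemma X_space_line:
  assumes "\<kappa> \<in> X_space e f" "\<kappa>' \<in> X_space e f"
  shows "(\<lambda>k. \<kappa> k + x * (\<kappa>' k - \<kappa> k)) \<in> X_space e f"
  using assms
  by (simp add: X_space_def sum.distrib sum_subtractf right_diff_distrib distrib_left
      mult.left_commute[of _ x] flip: sum_distrib_left)

text \<open>On the line through the two points both functions are nonzero polynomials in one
  variable, so together they have finitely many zeros on it.\<close>

lemma polyfun_common_nonzero:
  assumes "polyfun g" "polyfun h" "\<kappa> \<in> X_space e f" "g \<kappa> \<noteq> 0" "\<kappa>' \<in> X_space e f" "h \<kappa>' \<noteq> 0"
  shows "\<exists>\<mu>\<in>X_space e f. g \<mu> \<noteq> 0 \<and> h \<mu> \<noteq> 0"
proof -
  define l where "l x = (\<lambda>k. \<kappa> k + x * (\<kappa>' k - \<kappa> k))" for x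
  obtain p where p: "\<And>x. g (l x) = poly p x" using polyfun_on_line[OF assms(1), where \<kappa> = \<kappa> and \<delta> = "\<lambda>k. \<kappa>' k - \<kappa> k"] unfolding l_def by blast
  obtain q where q: "\<And>x. h (l x) = poly q x" using polyfun_on_line[OF assms(2), where \<kappa> = \<kappa> and \<delta> = "\<lambda>k. \<kappa>' k - \<kappa> k"] unfolding l_def by blast
  have "l 0 = \<kappa>" "l 1 = \<kappa>'" by (simp_all add: l_def)
  then have "p \<noteq> 0" "q \<noteq> 0" using p[of 0] q[of 1] assms(4,6) by auto
  then have "finite {x. poly (p * q) x = 0}" by (intro poly_roots_finite) simp
  then obtain x where "poly (p * q) x \<noteq> 0"
    using infinite_UNIV_char_0[where 'a = complex] by (metis (mono_tags, lifting) UNIV_eq_I mem_Collect_eq)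
  then have "g (l x) \<noteq> 0 \<and> h (l x) \<noteq> 0" using p q by simp
  moreover have "l x \<in> X_space e f" unfolding l_def by (rule X_space_line[OF assms(3,5)])
  ultimately show ?thesis by blast
qed

lemma polyfun_prod_nonzero:
  assumes "finite J" "X_space e f \<noteq> {}" "\<And>j. j \<in> J \<Longrightarrow> polyfun (h j)"
    and "\<And>j. j \<in> J \<Longrightarrow> \<exists>\<kappa>\<in>X_space e f. h j \<kappa> \<noteq> 0"
  shows "\<exists>\<kappa>\<in>X_space e f. (\<Prod>j\<in>J. h j \<kappa>) \<noteq> 0"
  using assms
proof (induction J)
  case empty
  then show ?case by auto
next
  case (insert j J)
  obtain \<kappa> where \<kappa>: "\<kappa> \<in> X_space e f" "(\<Prod>j\<in>J. h j \<kappa>) \<noteq> 0" using insert by blast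
  obtain \<kappa>' where \<kappa>': "\<kappa>' \<in> X_space e f" "h j \<kappa>' \<noteq> 0" using insert.prems(3) by blast
  have "polyfun (\<lambda>\<kappa>. \<Prod>j\<in>J. h j \<kappa>)" using insert.prems(2) by (intro polyfun_prod) simp
  then obtain \<mu> where "\<mu> \<in> X_space e f" "(\<Prod>j\<in>J. h j \<mu>) \<noteq> 0" "h j \<mu> \<noteq> 0"
    using polyfun_common_nonzero[where g = "\<lambda>\<kappa>. \<Prod>j\<in>J. h j \<kappa>" and h = "h j", OF _ _ \<kappa> \<kappa>'] insert.prems(2)[of j] by blast
  then show ?case using insert.hyps by (intro bexI[of _ \<mu>]) simp_all
qed

text \<open>Density is irreducibility: every nonempty open set contains a point where some
  polynomial is nonzero, and that polynomial and \<open>h\<close> are nonzero at a common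
  point.\<close>

lemma nonvanishing_open_dense:
  assumes h: "polyfun h" and \<kappa>0: "\<kappa>0 \<in> X_space e f" "h \<kappa>0 \<noteq> 0"
  defines "U \<equiv> {\<kappa> \<in> X_space e f. h \<kappa> \<noteq> 0}"
  shows "openin (zariski (X_space e f)) U" "zariski (X_space e f) closure_of U = X_space e f"
proof -
  obtain P where P: "\<And>\<kappa>. h \<kappa> = poly_value P \<kappa>" using h unfolding polyfun_def by blast
  show "openin (zariski (X_space e f)) U"
    unfolding openin_zariski_iff U_def by (rule exI[of _ "{P}"]) (simp add: P)
  show "zariski (X_space e f) closure_of U = X_space e f"
  proof (rule subset_antisym)
    show "zariski (X_space e f) closure_of U \<subseteq> X_space e f"
      using closure_of_subset_topspace[of "zariski (X_space e f)" U] by simp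
    show "X_space e f \<subseteq> zariski (X_space e f) closure_of U"
    proof
      fix \<kappa> assume \<kappa>: "\<kappa> \<in> X_space e f"
      have "\<exists>\<mu>\<in>U. \<mu> \<in> V" if V: "\<kappa> \<in> V" "openin (zariski (X_space e f)) V" for V
      proof -
        obtain S where S: "V = {\<kappa> \<in> X_space e f. \<exists>P\<in>S. poly_value P \<kappa> \<noteq> 0}"
          using V(2) unfolding openin_zariski_iff by blast
        then obtain R where R: "R \<in> S" "poly_value R \<kappa> \<noteq> 0" using V(1) by blast
        obtain \<mu> where "\<mu> \<in> X_space e f" "poly_value R \<mu> \<noteq> 0" "h \<mu> \<noteq> 0"
          using polyfun_common_nonzero[OF polyfun_poly_value h \<kappa> R(2) \<kappa>0] by blast
        then show ?thesis using R(1) unfolding S U_def by blast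
      qed
      then show "\<kappa> \<in> zariski (X_space e f) closure_of U"
        using \<kappa> by (auto simp: in_closure_of)
    qed
  qed
qed

section \<open>Polynomials with a prescribed double value at one\<close>

definition shape_poly :: "nat \<Rightarrow> nat \<Rightarrow> (int \<Rightarrow> complex) \<Rightarrow> complex poly" where
  "shape_poly e f \<kappa> = (\<Sum>i\<le>e + f. monom (\<kappa> (int i - int e)) i)"

lemma coeff_shape_poly: "coeff (shape_poly e f \<kappa>) i = (if i \<le> e + f then \<kappa> (int i - int e) else 0)"
  by (simp add: shape_poly_def coeff_sum)

lemma degree_shape_poly:
  assumes "\<kappa> (int f) \<noteq> 0"
  shows "degree (shape_poly e f \<kappa>) = e + f"
proof (rule antisym)
  show "degree (shape_poly e f \<kappa>) \<le> e + f" by (rule degree_le) (simp add: coeff_shape_poly)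
  show "e + f \<le> degree (shape_poly e f \<kappa>)" by (rule le_degree) (simp add: coeff_shape_poly assms)
qed

lemma sum_shift_int: "(\<Sum>k = - int e..int f. g k) = (\<Sum>i\<le>e + f. g (int i - int e))"
  by (rule sum.reindex_bij_witness[of _ "\<lambda>i. int i - int e" "\<lambda>k. nat (k + int e)"]) auto

lemma poly_shape_poly_one: "poly (shape_poly e f \<kappa>) 1 = (\<Sum>k = - int e..int f. \<kappa> k)"
  by (simp add: shape_poly_def poly_sum poly_monom sum_shift_int)

lemma pderiv_sum_monom: "pderiv (\<Sum>i\<in>A. monom (c i) (h i)) = (\<Sum>i\<in>A. monom (of_nat (h i) * c i) (h i - 1))"
  by (induction A rule: infinite_finite_induct) (simp_all add: pderiv_add pderiv_monom)

lemma poly_pderiv_shape_poly_one: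
  "poly (pderiv (shape_poly e f \<kappa>)) 1 = (\<Sum>k = - int e..int f. of_int k * \<kappa> k) + of_nat e * (\<Sum>k = - int e..int f. \<kappa> k)"
proof -
  have "poly (pderiv (shape_poly e f \<kappa>)) 1 = (\<Sum>i\<le>e + f. of_nat i * \<kappa> (int i - int e))"
    by (simp add: shape_poly_def pderiv_sum_monom poly_sum poly_monom)
  also have "\<dots> = (\<Sum>i\<le>e + f. of_int (int i - int e) * \<kappa> (int i - int e) + of_nat e * \<kappa> (int i - int e))"
    by (intro sum.cong) (auto simp: algebra_simps)
  finally show ?thesis by (simp only: sum.distrib sum_shift_int flip: sum_distrib_left)
qed

lemma double_root_factor:
  fixes p :: "complex poly"
  assumes "poly p a = 0" "poly (pderiv p) a = 0"
  shows "\<exists>r. p = [:- a, 1:] ^ 2 * r"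
proof -
  obtain q where q: "p = [:- a, 1:] * q" using assms(1) by (auto simp: poly_eq_0_iff_dvd dvd_def)
  have "pderiv p = [:- a, 1:] * pderiv q + q" unfolding q pderiv_mult by (simp add: pderiv_pCons)
  then have "poly q a = 0" using assms(2) by simp
  then obtain r where "q = [:- a, 1:] * r" by (auto simp: poly_eq_0_iff_dvd dvd_def)
  then show ?thesis unfolding q by (intro exI[of _ r]) (simp only: power2_eq_square mult.assoc)
qed

text \<open>Total mass 1 and drift 0 say that the Laurent polynomial takes the value 1 at t = 1 with
  vanishing derivative, that is, P - t^e has at least a double zero there.\<close>

lemma X_space_iff:
  "(\<exists>r. shape_poly e f \<kappa> = monom 1 e + [:- 1, 1:] ^ 2 * r) \<longleftrightarrow>
    (\<Sum>k = - int e..int f. \<kappa> k) = 1 \<and> (\<Sum>k = - int e..int f. of_int k * \<kappa> k) = 0"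
proof -
  let ?D = "shape_poly e f \<kappa> - monom 1 e"
  have 1: "poly ?D 1 = (\<Sum>k = - int e..int f. \<kappa> k) - 1"
    by (simp add: poly_shape_poly_one poly_monom)
  have 2: "poly (pderiv ?D) 1 = (\<Sum>k = - int e..int f. of_int k * \<kappa> k) + of_nat e * (\<Sum>k = - int e..int f. \<kappa> k) - of_nat e"
    by (simp add: pderiv_diff poly_pderiv_shape_poly_one pderiv_monom poly_monom)
  have "(\<exists>r. shape_poly e f \<kappa> = monom 1 e + [:- 1, 1:] ^ 2 * r) \<longleftrightarrow> (\<exists>r. ?D = [:- 1, 1:] ^ 2 * r)"
    by (simp add: algebra_simps)
  also have "\<dots> \<longleftrightarrow> poly ?D 1 = 0 \<and> poly (pderiv ?D) 1 = 0"
  proof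
    assume "\<exists>r. ?D = [:- 1, 1:] ^ 2 * r"
    then obtain r where "?D = [:- 1, 1:] ^ 2 * r" by blast
    then show "poly ?D 1 = 0 \<and> poly (pderiv ?D) 1 = 0" by (simp add: pderiv_mult pderiv_power)
  next
    assume "poly ?D 1 = 0 \<and> poly (pderiv ?D) 1 = 0"
    then show "\<exists>r. ?D = [:- 1, 1:] ^ 2 * r" using double_root_factor[of ?D 1] by simp
  qed
  finally show ?thesis unfolding 1 2 by auto
qed

section \<open>Shapes from polynomials, and the cofactor of the double root\<close>

definition shape_of :: "nat \<Rightarrow> complex poly \<Rightarrow> int \<Rightarrow> complex" where
  "shape_of e p k = (if - int e \<le> k then coeff p (nat (k + int e)) else 0)"

lemma shape_poly_shape_of: "degree p \<le> e + f \<Longrightarrow> shape_poly e f (shape_of e p) = p"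
  by (rule poly_eqI) (auto simp: coeff_shape_poly shape_of_def coeff_eq_0)

lemma shape_of_in_X_space:
  assumes "p = monom 1 e + [:- 1, 1:] ^ 2 * r" "degree p \<le> e + f"
  shows "shape_of e p \<in> X_space e f"
proof -
  have "shape_of e p k = 0" if "k \<notin> {- int e..int f}" for k
    using that assms(2) by (auto simp: shape_of_def intro!: coeff_eq_0)
  then show ?thesis
    using X_space_iff[of e f "shape_of e p"] assms shape_poly_shape_of[OF assms(2)] unfolding X_space_def by auto
qed

text \<open>Division by \<open>Y - 1\<close> amounts to taking partial sums up to sign, so these are the coefficients
  of the cofactor of the double root.\<close>

definition cofactor_coeff :: "nat \<Rightarrow> nat \<Rightarrow> (int \<Rightarrow> complex) \<Rightarrow> nat \<Rightarrow> complex" where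
  "cofactor_coeff e f \<kappa> j = (\<Sum>l\<le>j. \<Sum>i\<le>l. (if i \<le> e + f then \<kappa> (int i - int e) else 0) - (if i = e then 1 else 0))"

lemma partial_sums_linear_factor:
  fixes p :: "'a :: comm_ring_1 poly"
  shows "(\<Sum>i\<le>j. coeff ([:- 1, 1:] * p) i) = - coeff p j"
  by (induction j) (simp_all add: coeff_pCons)

lemma cofactor_coeff:
  assumes "shape_poly e f \<kappa> = monom 1 e + [:- 1, 1:] ^ 2 * r"
  shows "cofactor_coeff e f \<kappa> j = coeff r j"
proof -
  have "(if i \<le> e + f then \<kappa> (int i - int e) else 0) - (if i = e then 1 else 0) = coeff ([:- 1, 1:] * ([:- 1, 1:] * r)) i" for i
  proof -
    have "[:- 1, 1:] ^ 2 * r = [:- 1, 1:] * ([:- 1, 1:] * r)" by (simp only: power2_eq_square mult.assoc)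
    then have "coeff (shape_poly e f \<kappa>) i = coeff (monom 1 e) i + coeff ([:- 1, 1:] * ([:- 1, 1:] * r)) i"
      by (simp only: assms coeff_add)
    moreover have "coeff (monom 1 e) i = (if i = e then 1 else (0 :: complex))" by auto
    ultimately show ?thesis by (simp only: coeff_shape_poly add_diff_cancel_left')
  qed
  then have "cofactor_coeff e f \<kappa> j = (\<Sum>l\<le>j. \<Sum>i\<le>l. coeff ([:- 1, 1:] * ([:- 1, 1:] * r)) i)"
    by (simp only: cofactor_coeff_def)
  also have "\<dots> = - (\<Sum>l\<le>j. coeff ([:- 1, 1:] * r) l)" by (simp only: partial_sums_linear_factor sum_negf)
  finally show ?thesis by (simp only: partial_sums_linear_factor minus_minus)
qed

lemma polyfun_cofactor_coeff: "polyfun (\<lambda>\<kappa>. cofactor_coeff e f \<kappa> j)"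
proof -
  have "polyfun (\<lambda>\<kappa>. (if i \<le> e + f then \<kappa> (int i - int e) else 0) - (if i = e then 1 else 0))" for i
    by (cases "i \<le> e + f") (auto intro!: polyfun_diff polyfun_const polyfun_coord)
  then show ?thesis unfolding cofactor_coeff_def by (intro polyfun_sum)
qed

section \<open>A discriminant\<close>

text \<open>The Sylvester matrix of \<open>\<Sum>\<^sub>j r\<^sub>j Y\<^sup>j\<close> and its derivative, where the formal degree \<open>n\<close> keeps the
  size independent of \<open>r\<close>.\<close>

definition disc_mat :: "nat \<Rightarrow> (nat \<Rightarrow> complex) \<Rightarrow> complex mat" where
  "disc_mat n r = mat (2 * n - 1) (2 * n - 1) (\<lambda>(i, j).
     if i < n - 1 then (if i \<le> j then r (j - i) else 0)
     else (if i - (n - 1) \<le> j then of_nat (Suc (j - (i - (n - 1)))) * r (Suc (j - (i - (n - 1)))) else 0))"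

lemma disc_mat_carrier: "disc_mat n r \<in> carrier_mat (2 * n - 1) (2 * n - 1)"
  by (simp add: disc_mat_def)

lemma poly_shifted_sum:
  fixes p :: "complex poly"
  assumes "degree p + i < N"
  shows "(\<Sum>j<N. (if i \<le> j then coeff p (j - i) else 0) * x ^ j) = x ^ i * poly p x"
proof -
  have "(\<Sum>j<N. (if i \<le> j then coeff p (j - i) else 0) * x ^ j) = (\<Sum>j\<in>{i..<N}. coeff p (j - i) * x ^ j)"
    by (intro sum.mono_neutral_cong_right) auto
  also have "\<dots> = (\<Sum>j<N - i. coeff p j * x ^ (j + i))"
    by (rule sum.reindex_bij_witness[of _ "\<lambda>j. j + i" "\<lambda>j. j - i"]) auto
  also have "\<dots> = x ^ i * (\<Sum>j<N - i. coeff p j * x ^ j)"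
    by (simp add: sum_distrib_left power_add mult_ac)
  also have "(\<Sum>j<N - i. coeff p j * x ^ j) = (\<Sum>j\<le>degree p. coeff p j * x ^ j)"
    using assms by (intro sum.mono_neutral_right) (auto simp: coeff_eq_0)
  finally show ?thesis by (simp add: poly_altdef)
qed

text \<open>The vector of the powers of a common root \<open>x\<close> lies in the kernel, and its
  first entry is 1.\<close>

lemma det_disc_mat_common_root:
  assumes deg: "degree r \<le> n" and n: "0 < n" and root: "poly r x = 0" "poly (pderiv r) x = 0"
  shows "det (disc_mat n (coeff r)) = 0"
proof -
  let ?N = "2 * n - 1"
  let ?A = "disc_mat n (coeff r)"
  define v where "v = vec ?N (\<lambda>j. x ^ j)"
  have deg': "degree (pderiv r) \<le> n - 1" using deg by (simp add: degree_pderiv)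
  have "?A *\<^sub>v v = 0\<^sub>v ?N"
  proof (rule eq_vecI)
    fix i assume "i < dim_vec (0\<^sub>v ?N :: complex vec)"
    then have i: "i < ?N" by simp
    have "vec_index (?A *\<^sub>v v) i = (\<Sum>j<?N. index_mat ?A (i, j) * x ^ j)"
      using i by (simp add: scalar_prod_def v_def disc_mat_def atLeast0LessThan)
    also have "\<dots> = 0"
    proof (cases "i < n - 1")
      case True
      have "(\<Sum>j<?N. index_mat ?A (i, j) * x ^ j) = (\<Sum>j<?N. (if i \<le> j then coeff r (j - i) else 0) * x ^ j)"
        using i True by (intro sum.cong) (auto simp: disc_mat_def)
      also have "\<dots> = x ^ i * poly r x" using True deg by (intro poly_shifted_sum) simp
      finally show ?thesis using root by simp
    next
      case False
      have "(\<Sum>j<?N. index_mat ?A (i, j) * x ^ j) =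
          (\<Sum>j<?N. (if i - (n - 1) \<le> j then coeff (pderiv r) (j - (i - (n - 1))) else 0) * x ^ j)"
        using i False by (intro sum.cong) (auto simp: disc_mat_def coeff_pderiv)
      also have "\<dots> = x ^ (i - (n - 1)) * poly (pderiv r) x"
        using i False deg' n by (intro poly_shifted_sum) linarith
      finally show ?thesis using root by simp
    qed
    finally show "vec_index (?A *\<^sub>v v) i = vec_index (0\<^sub>v ?N) i" using i by simp
  qed (simp add: disc_mat_def)
  moreover have "v \<noteq> 0\<^sub>v ?N"
  proof
    assume "v = 0\<^sub>v ?N"
    then have "vec_index v 0 = vec_index (0\<^sub>v ?N) 0" by simp
    then show False using n by (simp add: v_def)
  qed
  moreover have "v \<in> carrier_vec ?N" by (simp add: v_def)
  ultimately show ?thesis using det_0_iff_vec_prod_zero[OF disc_mat_carrier] by blast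
qed

text \<open>For Y^n + 1 with derivative n Y^(n-1) the matrix is upper triangular with entries 1 and
  n on the diagonal; for n = 0 it is empty.\<close>

lemma det_disc_mat_nonzero: "det (disc_mat n (coeff (monom 1 n + 1))) \<noteq> 0"
proof (cases "n = 0")
  case False
  have A: "disc_mat n (coeff (monom 1 n + 1)) \<in> carrier_mat (2 * n - 1) (2 * n - 1)" by (rule disc_mat_carrier)
  have "upper_triangular (disc_mat n (coeff (monom 1 n + 1)))"
    unfolding upper_triangular_def by (auto simp: disc_mat_def coeff_pCons one_pCons split: nat.splits)
  then have "det (disc_mat n (coeff (monom 1 n + 1))) = prod_list (diag_mat (disc_mat n (coeff (monom 1 n + 1))))"
    by (rule det_upper_triangular[OF _ A])
  moreover have "0 \<notin> set (diag_mat (disc_mat n (coeff (monom 1 n + 1))))"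
    using False by (auto simp: diag_mat_def disc_mat_def)
  ultimately show ?thesis by (simp add: prod_list_zero_iff)
qed (simp add: disc_mat_def)

lemma polyfun_det_disc_mat:
  assumes "\<And>j. polyfun (\<lambda>\<kappa>. r \<kappa> j)"
  shows "polyfun (\<lambda>\<kappa>. det (disc_mat n (r \<kappa>)))"
proof -
  define N where "N = 2 * n - 1"
  have entry: "polyfun (\<lambda>\<kappa>. index_mat (disc_mat n (r \<kappa>)) (i, j))" if "i < N" "j < N" for i j
    using that assms unfolding N_def by (simp add: disc_mat_def) (intro polyfun_if polyfun_const polyfun_mult)
  have less: "\<pi> i < N" if "\<pi> permutes {0..<N}" "i \<in> {0..<N}" for \<pi> i
    using permutes_in_image[OF that(1), of i] that(2) by simp
  have "det (disc_mat n (r \<kappa>)) = (\<Sum>\<pi>\<in>{\<pi>. \<pi> permutes {0..<N}}.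
      signof \<pi> * (\<Prod>i = 0..<N. index_mat (disc_mat n (r \<kappa>)) (i, \<pi> i)))" for \<kappa>
    unfolding N_def by (rule det_def'[OF disc_mat_carrier])
  moreover have "polyfun (\<lambda>\<kappa>. \<Sum>\<pi>\<in>{\<pi>. \<pi> permutes {0..<N}}.
      signof \<pi> * (\<Prod>i = 0..<N. index_mat (disc_mat n (r \<kappa>)) (i, \<pi> i)))"
    by (intro polyfun_sum polyfun_mult polyfun_const polyfun_prod entry) (auto intro: less)
  ultimately show ?thesis by simp
qed

section \<open>Coefficients of roots of a power series\<close>

text \<open>If \<open>g ^ m = F\<close> then \<open>m F g' = F' g\<close>. The resulting recursion for the coefficients of \<open>g\<close> is
  cleared of denominators.\<close>

fun root_coeff :: "nat \<Rightarrow> (nat \<Rightarrow> complex) \<Rightarrow> nat \<Rightarrow> complex" where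
  "root_coeff m a k = (if k = 0 then 1 else
     (\<Sum>i = 1..k. (of_nat i - of_nat m * of_nat (k - i)) / (of_nat m * of_nat k) * a i * a 0 ^ (i - 1) *
       (if 1 \<le> i then root_coeff m a (k - i) else 0)))"

declare root_coeff.simps [simp del]

lemma root_coeff_0: "root_coeff m a 0 = 1"
  by (simp add: root_coeff.simps)

lemma root_coeff_rec:
  assumes "0 < k"
  shows "root_coeff m a k = (\<Sum>i = 1..k. (of_nat i - of_nat m * of_nat (k - i)) / (of_nat m * of_nat k) *
    a i * a 0 ^ (i - 1) * root_coeff m a (k - i))"
  using assms by (subst root_coeff.simps) (auto intro!: sum.cong)

lemma root_coeff:
  fixes g F :: "complex fps"
  assumes g: "g ^ m = F" and m: "0 < m"
  shows "(F $ 0) ^ k * g $ k = g $ 0 * root_coeff m (fps_nth F) k"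
proof (induction k rule: less_induct)
  case (less k)
  show ?case
  proof (cases "k = 0")
    case False
    define c where "c i = (of_nat i - of_nat m * of_nat (k - i) :: complex)" for i
    have "fps_deriv F * g = fps_const (of_nat m) * (F * fps_deriv g)"
    proof -
      have "fps_deriv F = fps_const (of_nat m) * fps_deriv g * g ^ (m - 1)" unfolding g[symmetric] by (rule fps_deriv_power)
      moreover have "F = g ^ (m - 1) * g" unfolding g[symmetric] using m by (metis power_minus_mult)
      ultimately show ?thesis by (simp add: mult_ac)
    qed
    then have "(fps_deriv F * g) $ (k - 1) = (fps_const (of_nat m) * (F * fps_deriv g)) $ (k - 1)" by simp
    moreover have "(fps_deriv F * g) $ (k - 1) = (\<Sum>i\<le>k. of_nat i * F $ i * g $ (k - i))"
    proof -
      obtain l where l: "k = Suc l" using False by (cases k) auto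
      have "(\<Sum>i\<le>k. of_nat i * F $ i * g $ (k - i)) = (\<Sum>i\<le>l. of_nat (Suc i) * F $ (Suc i) * g $ (l - i))"
        unfolding l by (subst sum.atMost_Suc_shift) simp
      then show ?thesis unfolding l by (simp add: fps_mult_nth atLeast0AtMost)
    qed
    moreover have "(fps_const (of_nat m) * (F * fps_deriv g)) $ (k - 1) = (\<Sum>i\<le>k. of_nat m * of_nat (k - i) * F $ i * g $ (k - i))"
    proof -
      obtain l where l: "k = Suc l" using False by (cases k) auto
      have "(\<Sum>i\<le>k. of_nat m * of_nat (k - i) * F $ i * g $ (k - i)) = (\<Sum>i\<le>l. of_nat m * of_nat (Suc l - i) * F $ i * g $ (Suc l - i))"
        unfolding l by simp
      also have "\<dots> = (\<Sum>i\<le>l. of_nat m * (F $ i * (of_nat (Suc (l - i)) * g $ Suc (l - i))))"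
        by (intro sum.cong) (auto simp: Suc_diff_le mult_ac)
      finally have C: "(\<Sum>i\<le>k. of_nat m * of_nat (k - i) * F $ i * g $ (k - i)) =
          (\<Sum>i\<le>l. of_nat m * (F $ i * (of_nat (Suc (l - i)) * g $ Suc (l - i))))" by (simp only: l)
      have D: "(F * fps_deriv g) $ l = (\<Sum>i\<le>l. F $ i * (of_nat (Suc (l - i)) * g $ Suc (l - i)))"
        by (simp add: fps_mult_nth atLeast0AtMost)
      have "(fps_const (of_nat m) * (F * fps_deriv g)) $ (k - 1) = of_nat m * (F * fps_deriv g) $ l"
        unfolding l by (simp only: diff_Suc_1 fps_mult_left_const_nth)
      then show ?thesis unfolding D sum_distrib_left C .
    qed
    ultimately have "(\<Sum>i\<le>k. c i * (F $ i * g $ (k - i))) = 0"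
      by (simp add: c_def left_diff_distrib sum_subtractf mult.assoc)
    moreover have "{..k} = insert 0 {1..k}" by auto
    ultimately have "c 0 * (F $ 0 * g $ k) + (\<Sum>i = 1..k. c i * (F $ i * g $ (k - i))) = 0" by simp
    moreover have "c 0 = - (of_nat m * of_nat k)" by (simp add: c_def)
    ultimately have main: "of_nat m * of_nat k * (F $ 0 * g $ k) = (\<Sum>i = 1..k. c i * (F $ i * g $ (k - i)))"
      by (simp add: algebra_simps)
    have mk: "(of_nat m * of_nat k :: complex) \<noteq> 0" using m False by simp
    have "of_nat m * of_nat k * ((F $ 0) ^ k * g $ k) = (F $ 0) ^ (k - 1) * (of_nat m * of_nat k * (F $ 0 * g $ k))"
      using False by (cases k) (simp_all add: mult_ac)
    also have "\<dots> = (\<Sum>i = 1..k. (F $ 0) ^ (k - 1) * (c i * (F $ i * g $ (k - i))))"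
      unfolding main by (rule sum_distrib_left)
    also have "\<dots> = (\<Sum>i = 1..k. g $ 0 * (c i * F $ i * (F $ 0) ^ (i - 1) * root_coeff m (fps_nth F) (k - i)))"
    proof (rule sum.cong[OF refl])
      fix i assume i: "i \<in> {1..k}"
      \<comment> \<open>The power of F_0 is shared between the factor of the recursion and the
        induction hypothesis at k - i.\<close>
      then have "(F $ 0) ^ (k - 1) = (F $ 0) ^ (i - 1) * (F $ 0) ^ (k - i)" by (simp flip: power_add)
      then have "(F $ 0) ^ (k - 1) * (c i * (F $ i * g $ (k - i))) = c i * F $ i * (F $ 0) ^ (i - 1) * ((F $ 0) ^ (k - i) * g $ (k - i))"
        by (simp only: ac_simps)
      also have "(F $ 0) ^ (k - i) * g $ (k - i) = g $ 0 * root_coeff m (fps_nth F) (k - i)"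
        by (rule less.IH) (use i in auto)
      finally show "(F $ 0) ^ (k - 1) * (c i * (F $ i * g $ (k - i))) = g $ 0 * (c i * F $ i * (F $ 0) ^ (i - 1) * root_coeff m (fps_nth F) (k - i))"
        by (simp only: ac_simps)
    qed
    also have "\<dots> = of_nat m * of_nat k * (g $ 0 * root_coeff m (fps_nth F) k)"
      unfolding root_coeff_rec[OF False[unfolded neq0_conv]] sum_distrib_left c_def[symmetric]
      using mk by (intro sum.cong refl) (simp add: field_simps)
    finally show ?thesis using mk by simp
  qed (simp add: root_coeff_0)
qed

lemma polyfun_root_coeff:
  assumes "\<And>i. polyfun (\<lambda>\<kappa>. a \<kappa> i)"
  shows "polyfun (\<lambda>\<kappa>. root_coeff m (a \<kappa>) k)"
proof (induction k rule: less_induct)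
  case (less k)
  show ?case
  proof (cases "k = 0")
    case False
    then have k: "0 < k" by simp
    show ?thesis unfolding root_coeff_rec[OF k]
      by (intro polyfun_sum polyfun_mult polyfun_const polyfun_power assms less.IH) auto
  qed (simp add: root_coeff_0 polyfun_const)
qed

lemma root_coeff_zero:
  assumes "0 < k" "\<And>i. 1 \<le> i \<Longrightarrow> i \<le> k \<Longrightarrow> a i = 0"
  shows "root_coeff m a k = 0"
  unfolding root_coeff_rec[OF assms(1)] by (rule sum.neutral) (use assms(2) in auto)

lemma root_coeff_single:
  assumes "0 < k" "\<And>i. 1 \<le> i \<Longrightarrow> i < k \<Longrightarrow> a i = 0"
  shows "root_coeff m a k = a k * a 0 ^ (k - 1) / of_nat m"
proof -
  have "root_coeff m a k = (\<Sum>i\<in>{k}. (of_nat i - of_nat m * of_nat (k - i)) / (of_nat m * of_nat k) *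
      a i * a 0 ^ (i - 1) * root_coeff m a (k - i))"
    unfolding root_coeff_rec[OF assms(1)] by (intro sum.mono_neutral_right) (use assms in auto)
  then show ?thesis using assms(1) by (simp add: root_coeff_0)
qed

text \<open>Up to powers of \<open>a 0\<close> and \<open>b 0\<close>, the difference of the m-th
  powers of two coefficients: number e/m of an m-th root of the series with coefficients
  \<open>a\<close>, and number f/m of one for \<open>b\<close>. The m-th powers turn the constant
  terms of the chosen roots into \<open>a 0\<close> and \<open>b 0\<close>, which makes the
  expression polynomial.\<close>

definition indec_fun :: "nat \<Rightarrow> nat \<Rightarrow> nat \<Rightarrow> (nat \<Rightarrow> complex) \<Rightarrow> (nat \<Rightarrow> complex) \<Rightarrow> complex" where
  "indec_fun e f m a b = a 0 * root_coeff m a (e div m) ^ m * b 0 ^ (f div m * m)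
     - b 0 * root_coeff m b (f div m) ^ m * a 0 ^ (e div m * m)"

lemma indec_fun_nonzero:
  fixes g g' F F' :: "complex fps"
  assumes "g ^ m = F" "g' ^ m = F'" "0 < m" "indec_fun e f m (fps_nth F) (fps_nth F') \<noteq> 0"
  shows "(g $ (e div m)) ^ m \<noteq> (g' $ (f div m)) ^ m"
proof
  assume eq: "(g $ (e div m)) ^ m = (g' $ (f div m)) ^ m"
  have key: "(F $ 0) ^ (k * m) * (g $ k) ^ m = F $ 0 * root_coeff m (fps_nth F) k ^ m"
    if "g ^ m = F" for g F :: "complex fps" and k
  proof -
    have "F $ 0 = (g $ 0) ^ m" unfolding that[symmetric] by (rule fps_nth_power_0)
    have "(F $ 0) ^ (k * m) * (g $ k) ^ m = ((F $ 0) ^ k * g $ k) ^ m" by (simp add: power_mult_distrib power_mult)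
    also have "\<dots> = (g $ 0) ^ m * root_coeff m (fps_nth F) k ^ m"
      unfolding root_coeff[OF that assms(3)] by (rule power_mult_distrib)
    finally show ?thesis unfolding \<open>F $ 0 = (g $ 0) ^ m\<close> .
  qed
  have "indec_fun e f m (fps_nth F) (fps_nth F') =
      (F $ 0) ^ (e div m * m) * (g $ (e div m)) ^ m * (F' $ 0) ^ (f div m * m) -
      (F' $ 0) ^ (f div m * m) * (g' $ (f div m)) ^ m * (F $ 0) ^ (e div m * m)"
    unfolding indec_fun_def key[OF assms(1)] key[OF assms(2)] ..
  also have "\<dots> = 0" unfolding eq by simp
  finally show False using assms(4) by simp
qed

section \<open>Return probabilities as constant terms\<close>

definition walk_pmf :: "int pmf \<Rightarrow> nat \<Rightarrow> int pmf" where
  "walk_pmf p n = map_pmf (\<lambda>x. \<Sum>i = 1..n. x i) (Pi_pmf {1..n} 0 (\<lambda>_. p))"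

lemma return_prob_walk_pmf: "return_prob p n = pmf (walk_pmf p n) 0"
  unfolding return_prob_def walk_pmf_def pmf_map by (simp add: vimage_def)

lemma walk_pmf_0: "walk_pmf p 0 = return_pmf 0"
  by (simp add: walk_pmf_def)

lemma walk_pmf_Suc: "walk_pmf p (Suc n) = bind_pmf p (\<lambda>y. map_pmf ((+) y) (walk_pmf p n))"
proof -
  have ins: "{1..Suc n} = insert (Suc n) {1..n}" by auto
  have sum: "(\<Sum>i\<in>insert (Suc n) {1..n}. (g(Suc n := y)) i) = y + (\<Sum>i = 1..n. g i)" for g :: "nat \<Rightarrow> int" and y
    by (subst sum.insert) (auto intro!: sum.cong)
  have "walk_pmf p (Suc n) = map_pmf (\<lambda>x. \<Sum>i\<in>insert (Suc n) {1..n}. x i)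
      (bind_pmf p (\<lambda>y. bind_pmf (Pi_pmf {1..n} 0 (\<lambda>_. p)) (\<lambda>g. return_pmf (g(Suc n := y)))))"
    unfolding walk_pmf_def ins by (subst Pi_pmf_insert') auto
  also have "\<dots> = bind_pmf p (\<lambda>y. bind_pmf (Pi_pmf {1..n} 0 (\<lambda>_. p)) (\<lambda>g. return_pmf (y + (\<Sum>i = 1..n. g i))))"
    unfolding map_bind_pmf map_return_pmf sum ..
  finally show ?thesis by (simp add: walk_pmf_def map_pmf_comp) (simp add: map_pmf_def)
qed

lemma pmf_walk_Suc:
  assumes "finite A" "set_pmf p \<subseteq> A"
  shows "pmf (walk_pmf p (Suc n)) k = (\<Sum>y\<in>A. pmf p y * pmf (walk_pmf p n) (k - y))"
proof -
  have shift: "pmf (map_pmf ((+) y) W) k = pmf W (k - y)" for y and W :: "int pmf"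
    using pmf_map_inj'[of "(+) y" W "k - y"] by simp
  have "pmf (walk_pmf p (Suc n)) k = (\<Sum>y\<in>A. pmf (walk_pmf p n) (k - y) * pmf p y)"
    unfolding walk_pmf_Suc pmf_bind shift by (rule integral_measure_pmf_real) (use assms in auto)
  then show ?thesis by (simp add: mult.commute)
qed

text \<open>Generating functions of independent sums multiply; the offset e n comes from clearing
  the factor t^(-e) once per step.\<close>

lemma pmf_walk_coeff:
  assumes "set_pmf p \<subseteq> {- int e..int f}"
  shows "complex_of_real (pmf (walk_pmf p n) k) =
    (if 0 \<le> k + int (e * n) then coeff (shape_poly e f (shape p) ^ n) (nat (k + int (e * n))) else 0)"
proof (induction n arbitrary: k)
  case 0
  then show ?case by (auto simp: walk_pmf_0 indicator_def coeff_1)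
next
  case (Suc n)
  define K where "K = k + int (e * Suc n)"
  define h where "h i = shape p (int i - int e)" for i
  define c where "c i = coeff (shape_poly e f (shape p) ^ n) i" for i
  have "complex_of_real (pmf (walk_pmf p (Suc n)) k) =
      (\<Sum>y = - int e..int f. shape p y * complex_of_real (pmf (walk_pmf p n) (k - y)))"
    by (subst pmf_walk_Suc[OF _ assms]) (simp_all add: shape_def)
  also have "\<dots> = (\<Sum>i\<le>e + f. h i * complex_of_real (pmf (walk_pmf p n) (k - (int i - int e))))"
    unfolding sum_shift_int h_def ..
  also have "\<dots> = (\<Sum>i\<le>e + f. h i * (if int i \<le> K then c (nat (K - int i)) else 0))"
  proof (rule sum.cong[OF refl])
    fix i
    have Ki: "k - (int i - int e) + int (e * n) = K - int i" by (simp add: K_def)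
    show "h i * complex_of_real (pmf (walk_pmf p n) (k - (int i - int e))) = h i * (if int i \<le> K then c (nat (K - int i)) else 0)"
      unfolding Suc.IH c_def Ki by simp
  qed
  also have "\<dots> = (if 0 \<le> K then coeff (shape_poly e f (shape p) ^ Suc n) (nat K) else 0)"
  proof (cases "0 \<le> K")
    case True
    define N where "N = nat K"
    have K: "K = int N" using True by (simp add: N_def)
    have "(\<Sum>i\<le>e + f. h i * (if int i \<le> K then c (nat (K - int i)) else 0)) =
        (\<Sum>i\<le>N. (if i \<le> e + f then h i else 0) * c (N - i))"
    proof -
      have "(\<Sum>i\<le>e + f. h i * (if int i \<le> K then c (nat (K - int i)) else 0)) = (\<Sum>i\<in>{..e + f} \<inter> {..N}. h i * c (N - i))"
        unfolding K by (rule sum.mono_neutral_cong_right) (auto simp flip: of_nat_diff)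
      also have "\<dots> = (\<Sum>i\<le>N. (if i \<le> e + f then h i else 0) * c (N - i))"
        by (rule sum.mono_neutral_cong_left) auto
      finally show ?thesis .
    qed
    also have "\<dots> = coeff (shape_poly e f (shape p) ^ Suc n) N"
      unfolding power_Suc coeff_mult coeff_shape_poly h_def c_def ..
    finally show ?thesis using True by (simp only: N_def if_True)
  next
    case False
    then show ?thesis by (auto intro!: sum.neutral)
  qed
  finally show ?case by (simp only: K_def)
qed

lemma return_prob_coeff:
  assumes "set_pmf p \<subseteq> {- int e..int f}"
  shows "complex_of_real (return_prob p n) = coeff (shape_poly e f (shape p) ^ n) (e * n)"
  unfolding return_prob_walk_pmf pmf_walk_coeff[OF assms] by (simp del: of_nat_mult)

text \<open>Without negative steps, returning to 0 means not moving at all, so the n-th return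
  probability is the n-th power of the first.\<close>

lemma return_prob_one_sided:
  assumes "finite (set_pmf q)" "set_pmf q \<subseteq> {0..}"
  shows "return_prob q 2 = return_prob q 1 ^ 2"
proof -
  have "set_pmf q \<subseteq> {- int 0..int (nat (Max (set_pmf q)))}"
  proof
    fix x assume "x \<in> set_pmf q"
    then have "0 \<le> x" "x \<le> Max (set_pmf q)" using assms Max_ge[OF assms(1)] by auto
    then show "x \<in> {- int 0..int (nat (Max (set_pmf q)))}" by simp
  qed
  from return_prob_coeff[OF this]
  have "complex_of_real (return_prob q n) = coeff (shape_poly 0 (nat (Max (set_pmf q))) (shape q)) 0 ^ n" for n
    by (simp add: coeff_0_power)
  from this[of 1] this[of 2] have "complex_of_real (return_prob q 2) = complex_of_real (return_prob q 1 ^ 2)" by simp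
  then show ?thesis by (simp only: of_real_eq_iff)
qed

text \<open>A step 1 followed by -1 adds to the square of the first return probability. In contrast
  to the one-sided case, this lets the spectrum detect that a walk has steps of both signs.\<close>

lemma return_prob_two_sided:
  assumes "finite (set_pmf p)" "1 \<in> set_pmf p" "- 1 \<in> set_pmf p"
  shows "return_prob p 1 ^ 2 < return_prob p 2"
proof -
  define A where "A = insert 0 (set_pmf p)"
  have A: "finite A" "set_pmf p \<subseteq> A" using assms by (auto simp: A_def)
  have 1: "pmf (walk_pmf p (Suc 0)) k = pmf p k" for k
  proof -
    have Ak: "finite (A \<union> {k})" "set_pmf p \<subseteq> A \<union> {k}" using A by auto
    have "pmf (walk_pmf p (Suc 0)) k = (\<Sum>y\<in>A \<union> {k}. if k = y then pmf p y else 0)"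
      unfolding pmf_walk_Suc[OF Ak] walk_pmf_0 by (intro sum.cong) (auto simp: indicator_def)
    also have "\<dots> = pmf p k" using Ak(1) by (subst sum.delta') auto
    finally show ?thesis .
  qed
  have 2: "return_prob p 2 = (\<Sum>y\<in>A. pmf p y * pmf p (- y))"
  proof -
    have "pmf (walk_pmf p (Suc (Suc 0))) 0 = (\<Sum>y\<in>A. pmf p y * pmf (walk_pmf p (Suc 0)) (0 - y))"
      by (rule pmf_walk_Suc[OF A])
    then show ?thesis unfolding return_prob_walk_pmf numeral_2_eq_2 1 by simp
  qed
  have "pmf p 0 ^ 2 + pmf p 1 * pmf p (- 1) = (\<Sum>y\<in>{0, 1}. pmf p y * pmf p (- y))"
    by (simp add: power2_eq_square)
  also have "\<dots> \<le> (\<Sum>y\<in>A. pmf p y * pmf p (- y))"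
    using A assms by (intro sum_mono2) (auto simp: A_def)
  finally have "pmf p 0 ^ 2 + pmf p 1 * pmf p (- 1) \<le> return_prob p 2" by (simp only: 2)
  moreover have "0 < pmf p 1 * pmf p (- 1)" using assms by (intro mult_pos_pos pmf_positive)
  moreover have "return_prob p 1 = pmf p 0" unfolding return_prob_walk_pmf One_nat_def 1 ..
  ultimately show ?thesis by simp
qed

lemma pmf_map_uminus: "pmf (map_pmf uminus p) k = pmf p (- k)" for p :: "int pmf"
  using pmf_map_inj'[of uminus p "- k"] by simp

lemma return_prob_reflect: "spectrum (map_pmf uminus p) = spectrum p"
proof -
  have "uminus = (*) (- 1 :: int)" by (simp add: fun_eq_iff)
  then show ?thesis using spectrum_dilate[of "- 1" p] by simp
qed

section \<open>Rigidity of exponential tilts\<close>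

text \<open>By Bezout. It excludes nontrivial scalings for a walk whose steps generate the
  integers.\<close>

lemma powi_Gcd_eq_1:
  fixes c :: complex and K :: "int set"
  assumes "finite K" "c \<noteq> 0" "\<And>k. k \<in> K \<Longrightarrow> c powi k = 1"
  shows "c powi (Gcd K) = 1"
  using assms(1,3)
proof (induction K)
  case (insert a K)
  obtain u v where uv: "u * a + v * Gcd K = gcd a (Gcd K)" using bezout_int by blast
  have 1: "c powi a = 1" "c powi Gcd K = 1" using insert by auto
  have "c powi (u * a + v * Gcd K) = (c powi a) powi u * (c powi Gcd K) powi v"
    using assms(2) by (simp add: power_int_add mult.commute[of u] mult.commute[of v] power_int_mult)
  then show ?case unfolding Gcd_insert uv 1 by simp
qed simp

text \<open>Comparison at the step 1 makes \<open>c\<close> real and positive, so q_k = r_k e^(k l)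
  for a real l. Total masses and zero drift make the sum of r_k (e^(k l) - 1 - k l) vanish. All
  terms are nonnegative, and the one at k = 1 gives l = 0.\<close>

lemma tilt_trivial:
  fixes r q :: "int pmf"
  assumes fin: "finite (set_pmf r)" and drift: "(\<Sum>k\<in>set_pmf r. of_int k * pmf r k) = 0"
    and r1: "1 \<in> set_pmf r" and c: "c \<noteq> 0" and eq: "\<And>k. shape r k = shape q k * c powi k"
  shows "q = r"
proof -
  have pos: "0 < pmf r 1" using r1 by (rule pmf_positive)
  have q1: "complex_of_real (pmf r 1) = complex_of_real (pmf q 1) * c" using eq[of 1] by (simp add: shape_def)
  then have "pmf q 1 \<noteq> 0" using pos by auto
  then have q1pos: "0 < pmf q 1" by (simp add: pmf_nonneg less_le)
  define x where "x = pmf r 1 / pmf q 1"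
  have x: "0 < x" using pos q1pos by (simp add: x_def)
  have cx: "c = complex_of_real x" using q1 q1pos by (simp add: x_def field_simps)
  have rq: "pmf r k = pmf q k * x powi k" for k
  proof -
    have "complex_of_real (pmf r k) = complex_of_real (pmf q k * x powi k)"
      using eq[of k] by (simp add: shape_def cx of_real_power_int)
    then show ?thesis by (simp only: of_real_eq_iff)
  qed
  define l where "l = - ln x"
  have xl: "x powi k = exp (- (of_int k * l))" for k
  proof -
    have "x powi k = exp (ln x) powi k" using x by simp
    then show ?thesis unfolding exp_power_int by (simp add: l_def)
  qed
  have qr: "pmf q k = pmf r k * exp (of_int k * l)" for k
    unfolding rq xl by (simp add: exp_minus)
  have "set_pmf q = set_pmf r" using qr by (auto simp: set_pmf_iff)
  then have "(\<Sum>k\<in>set_pmf r. pmf r k * exp (of_int k * l)) = 1"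
    using sum_pmf_eq_1[OF fin, of q] by (simp add: qr)
  moreover have "(\<Sum>k\<in>set_pmf r. pmf r k) = 1" using sum_pmf_eq_1[OF fin, of r] by simp
  moreover have "(\<Sum>k\<in>set_pmf r. pmf r k * (of_int k * l)) = 0"
  proof -
    have "(\<Sum>k\<in>set_pmf r. pmf r k * (of_int k * l)) = (\<Sum>k\<in>set_pmf r. of_int k * pmf r k) * l"
      unfolding sum_distrib_right by (intro sum.cong) auto
    then show ?thesis using drift by simp
  qed
  ultimately have "(\<Sum>k\<in>set_pmf r. pmf r k * (exp (of_int k * l) - 1 - of_int k * l)) = 0"
    by (simp add: right_diff_distrib sum_subtractf)
  moreover have nn: "0 \<le> pmf r k * (exp (of_int k * l) - 1 - of_int k * l)" for k
  proof -
    have "0 \<le> exp (of_int k * l) - 1 - of_int k * l" using exp_ge_add_one_self[of "of_int k * l"] by linarith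
    then show ?thesis by (simp add: pmf_nonneg)
  qed
  ultimately have "\<forall>k\<in>set_pmf r. pmf r k * (exp (of_int k * l) - 1 - of_int k * l) = 0"
    using sum_nonneg_eq_0_iff[OF fin, of "\<lambda>k. pmf r k * (exp (of_int k * l) - 1 - of_int k * l)"] by blast
  from bspec[OF this r1] have "exp l - 1 - l = 0" using pos by simp
  then have "exp l = 1" using ln_eq_minus_one[of "exp l"] by simp
  then have l0: "l = 0" by simp
  show ?thesis by (rule pmf_eqI) (simp add: qr l0)
qed

lemma scaled_shapes:
  assumes r: "set_pmf r \<subseteq> {- int a..int b}" and q: "set_pmf q \<subseteq> {- int a..int b'}" and c: "c \<noteq> 0"
    and eq: "\<And>i. coeff (shape_poly a b (shape r)) i * c ^ a = coeff (shape_poly a b' (shape q)) i * c ^ i"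
  shows "shape r k = shape q k * c powi k"
proof (cases "- int a \<le> k")
  case True
  define i where "i = nat (k + int a)"
  have i: "int i - int a = k" using True by (simp add: i_def)
  have out: "shape r' k = 0" if "set_pmf r' \<subseteq> {- int a..int b}" "a + b < i" for r' b
  proof -
    have "int b < k" using i that(2) by linarith
    then have "k \<notin> set_pmf r'" using that(1) by auto
    then show ?thesis by (simp add: shape_def set_pmf_iff)
  qed
  have "coeff (shape_poly a b (shape r)) i = shape r k"
    using out[OF r] by (auto simp: coeff_shape_poly i)
  moreover have "coeff (shape_poly a b' (shape q)) i = shape q k"
    using out[OF q] by (auto simp: coeff_shape_poly i)
  moreover have "c ^ i = c powi k * c ^ a"
  proof -
    have "c ^ i = c powi (k + int a)" using i by (metis diff_add_cancel power_int_of_nat)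
    then show ?thesis using c by (simp add: power_int_add)
  qed
  ultimately have "shape r k * c ^ a = (shape q k * c powi k) * c ^ a" using eq[of i] by simp
  then show ?thesis using c by simp
next
  case False
  then have "k \<notin> set_pmf r" "k \<notin> set_pmf q" using r q by auto
  then show ?thesis by (simp add: shape_def set_pmf_iff)
qed

section \<open>Generic walks are determined by their spectrum\<close>

lemma reflect_shape_poly:
  assumes "\<kappa> (int f) \<noteq> 0"
  shows "reflect_poly (shape_poly e f \<kappa>) = shape_poly f e (\<lambda>k. \<kappa> (- k))"
proof (rule poly_eqI)
  fix i
  show "coeff (reflect_poly (shape_poly e f \<kappa>)) i = coeff (shape_poly f e (\<lambda>k. \<kappa> (- k))) i"
    unfolding coeff_reflect_poly degree_shape_poly[of \<kappa> f e, OF assms]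
    by (auto simp: coeff_shape_poly of_nat_diff intro!: arg_cong[of _ _ \<kappa>])
qed

lemma generic_determined:
  fixes p :: "int pmf"
  assumes ef: "0 < e" "0 < f" "e \<le> f" and p: "is_random_walk p" and X: "shape p \<in> X_space e f"
    and full: "\<And>k. k \<in> {- int e..int f} \<Longrightarrow> shape p k \<noteq> 0"
    and disc: "det (disc_mat (e + f - 2) (cofactor_coeff e f (shape p))) \<noteq> 0"
    and at_one: "(\<Sum>j\<le>e + f - 2. cofactor_coeff e f (shape p) j) \<noteq> 0"
    and indec: "\<And>m. 2 \<le> m \<Longrightarrow> m dvd e \<Longrightarrow> m dvd f \<Longrightarrow>
      indec_fun e f m (coeff (shape_poly e f (shape p))) (coeff (shape_poly f e (\<lambda>k. shape p (- k)))) \<noteq> 0"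
  shows "determined_by_spectrum p"
  unfolding determined_by_spectrum_def
proof (intro allI impI)
  fix q :: "int pmf"
  assume q: "is_random_walk q" "generates_Z q" "spectrum q = spectrum p"
  have fin: "finite (set_pmf p)" "finite (set_pmf q)" using p q(1) by (simp_all add: is_random_walk_def)
  have supp: "set_pmf p = {- int e..int f}"
  proof (rule Set.set_eqI)
    fix k
    have "k \<notin> {- int e..int f} \<Longrightarrow> shape p k = 0" using X unfolding X_space_def by blast
    moreover have "k \<in> set_pmf p \<longleftrightarrow> shape p k \<noteq> 0" by (simp add: shape_def set_pmf_iff)
    ultimately show "k \<in> set_pmf p \<longleftrightarrow> k \<in> {- int e..int f}" using full[of k] by blast
  qed
  have I: "return_prob q n = return_prob p n" for n
  proof (cases n)
    case 0
    then show ?thesis by (simp add: return_prob_walk_pmf walk_pmf_0)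
  next
    case (Suc m)
    then show ?thesis using fun_cong[OF q(3), of m] by (simp add: spectrum_def)
  qed
  \<comment> \<open>The first two return probabilities show that \<open>q\<close> has steps of both
    signs, so both of its end degrees are positive and the series expansions apply to it.\<close>
  have two: "return_prob q 1 ^ 2 \<noteq> return_prob q 2"
    unfolding I using return_prob_two_sided[OF fin(1)] supp ef by auto
  have "\<not> set_pmf q \<subseteq> {0..}" using return_prob_one_sided[OF fin(2)] two by auto
  then have neg: "\<exists>k\<in>set_pmf q. k < 0" by force
  have "\<not> set_pmf q \<subseteq> {..0}"
  proof
    assume le: "set_pmf q \<subseteq> {..0}"
    have J: "return_prob (map_pmf uminus q) (Suc n) = return_prob q (Suc n)" for n
      using fun_cong[OF return_prob_reflect[of q], of n] by (simp add: spectrum_def)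
    have "return_prob (map_pmf uminus q) 2 = return_prob (map_pmf uminus q) 1 ^ 2"
      by (rule return_prob_one_sided) (use fin le in auto)
    then show False using two J[of 0] J[of 1] by (simp add: numeral_2_eq_2)
  qed
  then have posq: "\<exists>k\<in>set_pmf q. 0 < k" by force
  define e' where "e' = nat (- Min (set_pmf q))"
  define f' where "f' = nat (Max (set_pmf q))"
  have ne: "set_pmf q \<noteq> {}" by (rule set_pmf_not_empty)
  have Min: "Min (set_pmf q) \<in> set_pmf q" "Min (set_pmf q) < 0"
    using neg Min_in[OF fin(2) ne] Min_le[OF fin(2)] by (auto intro: le_less_trans)
  have Max: "Max (set_pmf q) \<in> set_pmf q" "0 < Max (set_pmf q)"
    using posq Max_in[OF fin(2) ne] Max_ge[OF fin(2)] by (auto intro: less_le_trans)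
  have e'f': "0 < e'" "0 < f'" "- int e' = Min (set_pmf q)" "int f' = Max (set_pmf q)"
    using Min Max by (simp_all add: e'_def f'_def)
  have suppq: "set_pmf q \<subseteq> {- int e'..int f'}"
    using Min_le[OF fin(2)] Max_ge[OF fin(2)] unfolding e'f' by auto
  define P where "P = shape_poly e f (shape p)"
  define Q where "Q = shape_poly e' f' (shape q)"
  have endq: "shape q (- int e') \<noteq> 0" "shape q (int f') \<noteq> 0"
    using Min(1) Max(1) unfolding e'f'(3,4) by (simp_all add: shape_def set_pmf_iff)
  have degP: "degree P = e + f" unfolding P_def by (rule degree_shape_poly) (rule full, simp)
  have degQ: "degree Q = e' + f'" unfolding Q_def by (rule degree_shape_poly) (rule endq)
  have P0: "coeff P 0 \<noteq> 0" using full[of "- int e"] by (simp add: P_def coeff_shape_poly)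
  have Q0: "coeff Q 0 \<noteq> 0" using endq by (simp add: Q_def coeff_shape_poly)
  have P1: "coeff P (Suc e) \<noteq> 0" using full[of 1] ef by (simp add: P_def coeff_shape_poly)
  \<comment> \<open>A common multiple of all four end degrees, so that the roots of both equations
    are series in the same \<open>u\<close>.\<close>
  define M where "M = e * f * e' * f'"
  have M: "0 < M" "e dvd M" "degree P - e dvd M" "e' dvd M" "degree Q - e' dvd M"
    using ef e'f' by (simp_all add: M_def degP degQ)
  obtain \<eta> :: complex where \<eta>: "\<eta> \<noteq> 0" "\<And>n :: int. \<eta> powi n = 1 \<longleftrightarrow> int M dvd n"
    using primitive_root_exists[OF M(1)] by blast
  obtain t t' where t: "branch_roots P e M \<eta> t t'"
    using branch_roots_exists[OF ef(1) _ P0 M(1-3) \<eta>] degP ef by auto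
  obtain s s' where s: "branch_roots Q e' M \<eta> s s'"
    using branch_roots_exists[OF e'f'(1) _ Q0 M(1,4,5) \<eta>] degQ e'f' by auto
  interpret rp: root_pair P Q e e' M \<eta> t t' s s'
    by (rule root_pair.intro[OF t s])
  have pf: "rp.p.f = f" "rp.q.f = f'" by (simp_all add: rp.p.f_def rp.q.f_def degP degQ)
  obtain R where R: "P = monom 1 e + [:- 1, 1:] ^ 2 * R"
    using X X_space_iff[of e f "shape p"] unfolding X_space_def P_def by blast
  have cof: "cofactor_coeff e f (shape p) = coeff R"
    using cofactor_coeff[OF R[unfolded P_def]] by (simp add: fun_eq_iff)
  have degR: "degree R \<le> e + f - 2"
  proof (cases "R = 0")
    case False
    have "[:- 1, 1:] ^ 2 * R = P - monom 1 e" by (simp add: R)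
    then have "degree ([:- 1, 1:] ^ 2 * R) \<le> e + f"
      using degree_diff_le[of P "e + f" "monom 1 e"] degP degree_monom_le[of "1 :: complex" e] by simp
    then show ?thesis using False by (simp add: degree_mult_eq degree_power_eq)
  qed simp
  have R1: "poly R 1 \<noteq> 0"
  proof -
    have "poly R 1 = (\<Sum>j\<le>degree R. coeff R j)" by (simp add: poly_altdef)
    also have "\<dots> = (\<Sum>j\<le>e + f - 2. coeff R j)"
      using degR by (intro sum.mono_neutral_left) (auto simp: coeff_eq_0)
    finally show ?thesis using at_one unfolding cof by simp
  qed
  have sf: "poly (pderiv R) x \<noteq> 0" if "poly R x = 0" for x
  \<comment> \<open>For e = f = 1 the cofactor is a nonzero constant; the kernel vector of the
    discriminant matrix requires a positive formal degree.\<close>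
  proof (cases "e + f - 2 = 0")
    case True
    then obtain a where "R = [:a:]" using degR by (metis degree_eq_zeroE le_zero_eq)
    then show ?thesis using that R1 by simp
  next
    case False
    then show ?thesis using det_disc_mat_common_root[OF degR _ that] disc unfolding cof by auto
  qed
  have reflP: "reflect_poly P = shape_poly f e (\<lambda>k. shape p (- k))"
    unfolding P_def by (rule reflect_shape_poly) (rule full, simp)
  interpret wp: walk_pair P Q e e' M \<eta> t t' s s'
  proof unfold_locales
    fix c :: complex assume c: "c \<noteq> 0" "\<And>i. coeff P i * c ^ e = coeff P i * c ^ i"
    \<comment> \<open>The step 1 has positive probability, so the coefficient at e + 1 gives c^e =
      c^(e+1).\<close>
    from c(2)[of "Suc e"] show "c = 1" using P1 c(1) by simp
  next
    fix c :: complex assume c: "c \<noteq> 0" "\<And>i. coeff Q i * c ^ e' = coeff Q i * c ^ i"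
    \<comment> \<open>The invariance makes c^k = 1 for every step k of \<open>q\<close>; it then
      holds for their greatest common divisor, which is 1.\<close>
    have "c powi k = 1" if k: "k \<in> set_pmf q" for k
    proof -
      have kk: "- int e' \<le> k" "k \<le> int f'" using suppq k by auto
      define i where "i = nat (k + int e')"
      have i: "int i = k + int e'" using kk by (simp add: i_def)
      have "coeff Q i = shape q k" using i kk by (simp add: Q_def coeff_shape_poly)
      then have "coeff Q i \<noteq> 0" using k by (simp add: shape_def set_pmf_iff)
      then have "c ^ e' = c ^ i" using c(2)[of i] by simp
      also have "c ^ i = c powi (k + int e')" using i by (metis power_int_of_nat)
      also have "\<dots> = c powi k * c ^ e'" using c(1) by (simp add: power_int_add)
      finally show ?thesis using c(1) by simp
    qed
    then have "c powi (Gcd (set_pmf q)) = 1" by (rule powi_Gcd_eq_1[OF fin(2) c(1)])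
    then show "c = 1" using q(2) by (simp add: generates_Z_def)
  next
    show "\<exists>\<pi>\<in>rp.\<Gamma>. \<exists>a1\<in>rp.T. \<exists>a2\<in>rp.T. a1 \<noteq> a2 \<and> \<pi> a1 = a2 \<and> \<pi> a2 = a1 \<and>
        (\<forall>a\<in>rp.T. a \<noteq> a1 \<longrightarrow> a \<noteq> a2 \<longrightarrow> \<pi> a = a)"
      by (rule rp.transposition_at_double_root[OF R R1 sf])
  next
    fix m and g g' :: "complex fps"
    assume m: "2 \<le> m" "m dvd e" "m dvd rp.p.f" and g: "g ^ m = fps_of_poly P" "g' ^ m = fps_of_poly (reflect_poly P)"
    have nth: "fps_nth (fps_of_poly h) = coeff h" for h :: "complex poly" by (simp add: fun_eq_iff)
    have nz: "indec_fun e f m (fps_nth (fps_of_poly P)) (fps_nth (fps_of_poly (reflect_poly P))) \<noteq> 0"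
      unfolding nth reflP unfolding P_def using m unfolding pf by (intro indec)
    show "(g $ (e div m)) ^ m \<noteq> (g' $ (rp.p.f div m)) ^ m"
      unfolding pf by (rule indec_fun_nonzero[OF g _ nz]) (use m(1) in simp)
  next
    fix n
    show "coeff (P ^ n) (e * n) = coeff (Q ^ n) (e' * n)"
      unfolding P_def Q_def return_prob_coeff[OF suppq, symmetric] I
      by (rule return_prob_coeff[symmetric]) (simp add: supp)
  qed
  have posP: "\<exists>x>0. coeff P i = complex_of_real x" if "i \<le> degree P" for i
  proof -
    have "int i - int e \<in> set_pmf p" using that unfolding degP supp by simp
    then have "0 < pmf p (int i - int e)" by (rule pmf_positive)
    then show ?thesis using that unfolding degP by (auto simp: P_def coeff_shape_poly shape_def)
  qed
  have posQ: "\<exists>x\<ge>0. coeff Q i = complex_of_real x" for i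
  proof (cases "i \<le> e' + f'")
    case True
    then show ?thesis by (intro exI[of _ "pmf q (int i - int e')"]) (simp add: Q_def coeff_shape_poly shape_def pmf_nonneg)
  next
    case False
    then show ?thesis by (intro exI[of _ 0]) (simp add: Q_def coeff_shape_poly)
  qed
  have drift: "(\<Sum>k\<in>set_pmf p. of_int k * pmf p k) = 0"
  proof -
    have "complex_of_real (\<Sum>k\<in>set_pmf p. of_int k * pmf p k) = (\<Sum>k = - int e..int f. of_int k * shape p k)"
      unfolding supp by (simp add: shape_def)
    also have "\<dots> = 0" using X by (simp add: X_space_def)
    finally show ?thesis by (simp only: of_real_eq_0_iff)
  qed
  have "e \<le> rp.p.f" using ef pf by simp
  then consider c where "e' = e" "c \<noteq> 0" "\<And>i. coeff P i * c ^ e = coeff Q i * c ^ i"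
    | c where "e' = f" "c \<noteq> 0" "\<And>i. coeff (reflect_poly P) i * c ^ f = coeff Q i * c ^ i"
    using wp.scaled_or_reflected[OF _ posP posQ] unfolding pf by blast
  then show "walk_equiv p q"
  proof cases
    case 1
    have sc: "shape p k = shape q k * c powi k" for k
      by (rule scaled_shapes[of p e f q f' c]) (use 1 supp suppq in \<open>auto simp: P_def Q_def\<close>)
    have "q = p" by (rule tilt_trivial[OF fin(1) drift _ 1(2) sc]) (use supp ef in auto)
    then show ?thesis by (simp add: walk_equiv_def)
  next
    case 2
    define r where "r = map_pmf uminus p"
    have setr: "set_pmf r = {- int f..int e}"
    proof (rule Set.set_eqI)
      fix k
      show "k \<in> set_pmf r \<longleftrightarrow> k \<in> {- int f..int e}"
        unfolding set_pmf_iff r_def pmf_map_uminus unfolding set_pmf_iff[symmetric] supp by auto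
    qed
    have shr: "shape r = (\<lambda>k. shape p (- k))" by (simp add: fun_eq_iff shape_def r_def pmf_map_uminus)
    have "shape r k = shape q k * c powi k" for k
      by (rule scaled_shapes[of r f e q f' c]) (use 2 setr suppq in \<open>auto simp: Q_def reflP shr\<close>)
    moreover have "(\<Sum>k\<in>set_pmf r. of_int k * pmf r k) = 0"
    proof -
      have "(\<Sum>k\<in>set_pmf r. of_int k * pmf r k) = (\<Sum>k\<in>set_pmf p. - (of_int k * pmf p k))"
        unfolding setr supp
        by (rule sum.reindex_bij_witness[of _ uminus uminus]) (auto simp: r_def pmf_map_uminus)
      then show ?thesis using drift by (simp add: sum_negf)
    qed
    moreover have "finite (set_pmf r)" "1 \<in> set_pmf r" unfolding setr using ef by auto
    ultimately have "q = r" using tilt_trivial[OF _ _ _ 2(2)] by blast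
    then show ?thesis by (simp add: walk_equiv_def r_def)
  qed
qed

section \<open>Nonvanishing of the genericity conditions\<close>

lemma X_space_point:
  fixes r :: "complex poly"
  assumes "degree r + 2 \<le> e + f"
  defines "p \<equiv> monom 1 e + [:- 1, 1:] ^ 2 * r"
  shows "shape_of e p \<in> X_space e f" "shape_poly e f (shape_of e p) = p"
    "cofactor_coeff e f (shape_of e p) = coeff r"
proof -
  have "degree ([:- 1, 1:] ^ 2 * r) \<le> degree ([:- 1, 1:] ^ 2 :: complex poly) + degree r" by (rule degree_mult_le)
  also have "degree ([:- 1, 1:] ^ 2 :: complex poly) = 2" by (simp add: degree_power_eq)
  finally have "degree ([:- 1, 1:] ^ 2 * r) \<le> e + f" using assms(1) by simp
  then have deg: "degree p \<le> e + f" unfolding p_def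
    using degree_monom_le[of "1 :: complex" e] by (intro degree_add_le) auto
  show 1: "shape_poly e f (shape_of e p) = p" by (rule shape_poly_shape_of[OF deg])
  show "shape_of e p \<in> X_space e f" by (rule shape_of_in_X_space[OF p_def[THEN meta_eq_to_obj_eq] deg])
  show "cofactor_coeff e f (shape_of e p) = coeff r"
    using cofactor_coeff[of e f "shape_of e p" r] 1 unfolding p_def by (simp add: fun_eq_iff)
qed

text \<open>The point t^e + (t - 1)^2 t^j works away from the middle coordinate, as 1, -2 and 1 are
  all nonzero; t^e alone serves the middle one.\<close>

lemma coordinate_nonzero:
  assumes ef: "0 < e" "0 < f" and k: "k \<in> {- int e..int f}"
  shows "\<exists>\<kappa>\<in>X_space e f. \<kappa> k \<noteq> 0"
proof -
  define i where "i = nat (k + int e)"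
  have i: "k = int i - int e" "i \<le> e + f" using k by (auto simp: i_def)
  have "\<exists>r. degree r + 2 \<le> e + f \<and> coeff (monom 1 e + [:- 1, 1:] ^ 2 * r) i \<noteq> (0 :: complex)"
  proof (cases "i = e")
    case True
    then show ?thesis using ef by (intro exI[of _ 0]) simp
  next
    case False
    \<comment> \<open>The cofactor may have degree at most e + f - 2; with this cap \<open>i\<close>
      is one of j, j + 1, j + 2.\<close>
    define j where "j = min i (e + f - 2)"
    have ij: "i = j \<or> i = j + 1 \<or> i = j + 2" using i(2) ef by (auto simp: j_def)
    have sq: "[:- 1, 1:] ^ 2 = [:1, - 2, 1 :: complex:]" by (simp add: power2_eq_square)
    have "coeff (monom 1 e) i = (0 :: complex)" using False by simp
    then have "coeff (monom 1 e + [:- 1, 1:] ^ 2 * monom 1 j) i = coeff (monom 1 j * [:1, - 2, 1 :: complex:]) i"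
      unfolding coeff_add sq by (metis add_0 mult.commute)
    also have "\<dots> \<noteq> (0 :: complex)" using ij by (auto simp: coeff_monom_mult coeff_pCons split: nat.splits)
    finally show ?thesis using ef degree_monom_le[of "1 :: complex" j]
      by (intro exI[of _ "monom 1 j"]) (auto simp: degree_monom_eq j_def)
  qed
  then obtain r where r: "degree r + 2 \<le> e + f" "coeff (monom 1 e + [:- 1, 1:] ^ 2 * r) i \<noteq> (0 :: complex)" by blast
  have "shape_of e (monom 1 e + [:- 1, 1:] ^ 2 * r) k \<noteq> 0"
    using r(2) k by (simp add: shape_of_def i_def)
  then show ?thesis using X_space_point(1)[OF r(1)] by blast
qed

text \<open>The witness has masses 1, 1, -1 - x, x at -e, e/m - e, 0, f. At the left end the first
  coefficient after the constant one is number e/m, and it passes to the m-th root as 1/m. At the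
  right end the coefficients 1 to f/m vanish, so the corresponding coefficient of the root is
  0.\<close>

lemma indec_nonzero:
  assumes ef: "0 < e" "0 < f" and m: "2 \<le> m" "m dvd e" "m dvd f"
  shows "\<exists>\<kappa>\<in>X_space e f. indec_fun e f m (coeff (shape_poly e f \<kappa>)) (coeff (shape_poly f e (\<lambda>k. \<kappa> (- k)))) \<noteq> 0"
proof -
  define N where "N = e div m"
  have N: "0 < N" "N < e" using ef m by (auto simp: N_def div_greater_zero_iff dvd_imp_le)
  have f: "0 < f div m" "f div m < f" using ef m by (auto simp: div_greater_zero_iff dvd_imp_le)
  \<comment> \<open>Solves the drift equation -e + (N - e) + f x = 0; the mass at 0 does not affect
    the drift and adjusts the total to 1.\<close>
  define x :: complex where "x = (2 * of_nat e - of_nat N) / of_nat f"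
  have x0: "x \<noteq> 0"
  proof -
    have eq: "2 * of_nat e - of_nat N = complex_of_nat (2 * e - N)" using N by (simp add: of_nat_diff)
    have "2 * e - N \<noteq> 0" using N by presburger
    then show ?thesis using ef unfolding x_def eq by (simp only: divide_eq_0_iff of_nat_eq_0_iff) simp
  qed
  define d where "d j a k = (if k = j then a else 0)" for j k :: int and a :: complex
  define \<kappa> where "\<kappa> k = d (- int e) 1 k + d (int N - int e) 1 k + d (int f) x k + d 0 (- 1 - x) k" for k
  have sums: "(\<Sum>k = - int e..int f. h k * d j a k) = h j * a" if "- int e \<le> j" "j \<le> int f" for h j a
  proof -
    have "(\<Sum>k = - int e..int f. h k * d j a k) = (\<Sum>k = - int e..int f. if k = j then h k * a else 0)"
      by (intro sum.cong) (auto simp: d_def)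
    then show ?thesis using that by simp
  qed
  have total: "(\<Sum>k = - int e..int f. h k * \<kappa> k) =
      h (- int e) + h (int N - int e) + h (int f) * x + h 0 * (- 1 - x)" for h :: "int \<Rightarrow> complex"
    unfolding \<kappa>_def distrib_left sum.distrib using N by (simp add: sums)
  have "\<kappa> \<in> X_space e f"
  proof -
    have "\<kappa> k = 0" if "k \<notin> {- int e..int f}" for k using that N by (auto simp: \<kappa>_def d_def)
    moreover have "(\<Sum>k = - int e..int f. \<kappa> k) = 1" using total[of "\<lambda>_. 1"] by simp
    moreover have "(\<Sum>k = - int e..int f. of_int k * \<kappa> k) = 0"
      using total[of of_int] ef by (simp add: x_def)
    ultimately show ?thesis by (simp add: X_space_def)
  qed
  moreover have "indec_fun e f m (coeff (shape_poly e f \<kappa>)) (coeff (shape_poly f e (\<lambda>k. \<kappa> (- k)))) \<noteq> 0"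
  proof -
    define a where "a = coeff (shape_poly e f \<kappa>)"
    define b where "b = coeff (shape_poly f e (\<lambda>k. \<kappa> (- k)))"
    have a: "a 0 = 1" "a N = 1" "\<And>i. 1 \<le> i \<Longrightarrow> i < N \<Longrightarrow> a i = 0"
      using N ef by (auto simp: a_def coeff_shape_poly \<kappa>_def d_def)
    have b: "b 0 = x" "\<And>i. 1 \<le> i \<Longrightarrow> i \<le> f div m \<Longrightarrow> b i = 0"
      using N ef f by (auto simp: b_def coeff_shape_poly \<kappa>_def d_def)
    have ra: "root_coeff m a N = 1 / of_nat m" using root_coeff_single[OF N(1) a(3)] a by simp
    have rb: "root_coeff m b (f div m) = 0" by (rule root_coeff_zero[OF f(1) b(2)])
    have z: "(0 :: complex) ^ m = 0" using m(1) by simp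
    have "indec_fun e f m a b \<noteq> 0"
      unfolding indec_fun_def N_def[symmetric] a(1) b(1) ra rb z using m(1) x0 by simp
    then show ?thesis unfolding a_def b_def .
  qed
  ultimately show ?thesis by blast
qed

lemma polyfun_coeff_shape_poly: "polyfun (\<lambda>\<kappa>. coeff (shape_poly e f \<kappa>) i)"
  unfolding coeff_shape_poly by (intro polyfun_if polyfun_coord polyfun_const)

lemma polyfun_indec:
  "polyfun (\<lambda>\<kappa>. indec_fun e f m (coeff (shape_poly e f \<kappa>)) (coeff (shape_poly f e (\<lambda>k. \<kappa> (- k)))))"
  unfolding indec_fun_def
  by (intro polyfun_diff polyfun_mult polyfun_power polyfun_root_coeff polyfun_coeff_shape_poly
      polyfun_reflect[OF polyfun_coeff_shape_poly])

lemma generic_condition_ordered: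
  assumes ef: "0 < e" "0 < f" "e \<le> f"
  shows "\<exists>h. polyfun h \<and> (\<exists>\<kappa>\<in>X_space e f. h \<kappa> \<noteq> 0) \<and>
    (\<forall>p. is_random_walk p \<longrightarrow> shape p \<in> X_space e f \<longrightarrow> h (shape p) \<noteq> 0 \<longrightarrow> determined_by_spectrum p)"
proof -
  define disc where "disc \<kappa> = det (disc_mat (e + f - 2) (cofactor_coeff e f \<kappa>))" for \<kappa>
  define at_one where "at_one \<kappa> = (\<Sum>j\<le>e + f - 2. cofactor_coeff e f \<kappa> j)" for \<kappa>
  define indec where
    "indec m \<kappa> = indec_fun e f m (coeff (shape_poly e f \<kappa>)) (coeff (shape_poly f e (\<lambda>k. \<kappa> (- k))))" for m \<kappa>
  \<comment> \<open>Finitely many conditions, as every admissible \<open>m\<close> divides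
    \<open>e\<close>; by irreducibility their product is nonzero somewhere on the space.\<close>
  define J where "J = {disc, at_one} \<union> (\<lambda>k \<kappa>. \<kappa> k) ` {- int e..int f} \<union> indec ` {m. 2 \<le> m \<and> m dvd e \<and> m dvd f}"
  have finJ: "finite J"
    unfolding J_def using ef finite_subset[of "{m. 2 \<le> m \<and> m dvd e \<and> m dvd f}" "{..e}"]
    by (auto simp: dvd_imp_le)
  have pt: "degree (monom 1 (e + f - 2) + 1 :: complex poly) + 2 \<le> e + f" "degree (1 :: complex poly) + 2 \<le> e + f"
  proof -
    have "degree (monom 1 (e + f - 2) + 1 :: complex poly) \<le> e + f - 2"
      by (rule degree_add_le) (simp_all add: degree_monom_le)
    then show "degree (monom 1 (e + f - 2) + 1 :: complex poly) + 2 \<le> e + f" using ef by linarith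
    show "degree (1 :: complex poly) + 2 \<le> e + f" using ef by simp
  qed
  have "polyfun disc" unfolding disc_def by (intro polyfun_det_disc_mat polyfun_cofactor_coeff)
  moreover have "\<exists>\<kappa>\<in>X_space e f. disc \<kappa> \<noteq> 0"
    using X_space_point(1,3)[OF pt(1)] det_disc_mat_nonzero[of "e + f - 2"] unfolding disc_def by metis
  moreover have "polyfun at_one" unfolding at_one_def by (intro polyfun_sum polyfun_cofactor_coeff)
  moreover have "\<exists>\<kappa>\<in>X_space e f. at_one \<kappa> \<noteq> 0"
  proof -
    have "(\<Sum>j\<le>e + f - 2. coeff (1 :: complex poly) j) = 1" by (simp add: coeff_1)
    then show ?thesis using X_space_point(1,3)[OF pt(2)] unfolding at_one_def by (metis zero_neq_one)
  qed
  moreover have "\<exists>\<kappa>\<in>X_space e f. indec m \<kappa> \<noteq> 0" if "2 \<le> m" "m dvd e" "m dvd f" for m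
    unfolding indec_def by (rule indec_nonzero[OF ef(1,2) that])
  moreover have "polyfun (indec m)" for m unfolding indec_def by (rule polyfun_indec)
  ultimately have J: "\<And>j. j \<in> J \<Longrightarrow> polyfun j" "\<And>j. j \<in> J \<Longrightarrow> \<exists>\<kappa>\<in>X_space e f. j \<kappa> \<noteq> 0"
    using coordinate_nonzero[OF ef(1,2)] polyfun_coord unfolding J_def by blast+
  define h where "h \<kappa> = (\<Prod>j\<in>J. j \<kappa>)" for \<kappa> :: "int \<Rightarrow> complex"
  have "X_space e f \<noteq> {}" using X_space_point(1)[OF pt(2)] by blast
  then have "\<exists>\<kappa>\<in>X_space e f. h \<kappa> \<noteq> 0"
    unfolding h_def by (rule polyfun_prod_nonzero[OF finJ]) (use J in auto)
  moreover have "polyfun h" unfolding h_def by (intro polyfun_prod J(1))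
  moreover have "determined_by_spectrum p"
    if "is_random_walk p" "shape p \<in> X_space e f" "h (shape p) \<noteq> 0" for p
  proof -
    have nz: "j (shape p) \<noteq> 0" if "j \<in> J" for j
      using \<open>h (shape p) \<noteq> 0\<close> that finJ by (auto simp: h_def)
    show ?thesis
    proof (rule generic_determined[OF ef \<open>is_random_walk p\<close> \<open>shape p \<in> X_space e f\<close>])
      show "shape p k \<noteq> 0" if "k \<in> {- int e..int f}" for k
        using nz[of "\<lambda>\<kappa>. \<kappa> k"] that unfolding J_def by blast
      show "det (disc_mat (e + f - 2) (cofactor_coeff e f (shape p))) \<noteq> 0"
        using nz[of disc] unfolding J_def disc_def by blast
      show "(\<Sum>j\<le>e + f - 2. cofactor_coeff e f (shape p) j) \<noteq> 0"
        using nz[of at_one] unfolding J_def at_one_def by blast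
      show "indec_fun e f m (coeff (shape_poly e f (shape p))) (coeff (shape_poly f e (\<lambda>k. shape p (- k)))) \<noteq> 0"
        if "2 \<le> m" "m dvd e" "m dvd f" for m
        using nz[of "indec m"] that unfolding J_def indec_def by blast
    qed
  qed
  ultimately show ?thesis by blast
qed

section \<open>Reflection of walks and the general case\<close>

lemma X_space_reflect:
  assumes "\<kappa> \<in> X_space f e"
  shows "(\<lambda>k. \<kappa> (- k)) \<in> X_space e f"
proof -
  have sum: "(\<Sum>k = - int e..int f. h (- k)) = (\<Sum>k = - int f..int e. h k)" for h :: "int \<Rightarrow> complex"
    by (rule sum.reindex_bij_witness[of _ uminus uminus]) auto
  have "(\<Sum>k = - int e..int f. \<kappa> (- k)) = 1" using sum[of \<kappa>] assms by (simp add: X_space_def)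
  moreover have "(\<Sum>k = - int e..int f. of_int k * \<kappa> (- k)) = 0"
    using sum[of "\<lambda>k. - (of_int k * \<kappa> k)"] assms by (simp add: X_space_def sum_negf)
  moreover have "\<kappa> (- k) = 0" if "k \<notin> {- int e..int f}" for k
    using assms that by (auto simp: X_space_def)
  ultimately show ?thesis unfolding X_space_def by blast
qed

lemma determined_reflect:
  assumes "determined_by_spectrum (map_pmf uminus p)"
  shows "determined_by_spectrum p"
proof -
  have "map_pmf uminus (map_pmf uminus p) = p" by (simp add: map_pmf_comp)
  then show ?thesis
    using assms unfolding determined_by_spectrum_def return_prob_reflect walk_equiv_def by auto
qed

text \<open>Replacing t by 1/t exchanges \<open>e\<close> and \<open>f\<close> and changes neither
  spectra nor equivalence, which reduces the claim to e <= f.\<close>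

lemma generic_condition:
  assumes ef: "0 < e" "0 < f"
  shows "\<exists>h. polyfun h \<and> (\<exists>\<kappa>\<in>X_space e f. h \<kappa> \<noteq> 0) \<and>
    (\<forall>p. is_random_walk p \<longrightarrow> shape p \<in> X_space e f \<longrightarrow> h (shape p) \<noteq> 0 \<longrightarrow> determined_by_spectrum p)"
proof (cases "e \<le> f")
  case True
  then show ?thesis by (rule generic_condition_ordered[OF ef])
next
  case False
  then have "f \<le> e" by simp
  then obtain h \<kappa> where h: "polyfun h" "\<kappa> \<in> X_space f e" "h \<kappa> \<noteq> 0"
    "\<And>p. is_random_walk p \<Longrightarrow> shape p \<in> X_space f e \<Longrightarrow> h (shape p) \<noteq> 0 \<Longrightarrow> determined_by_spectrum p"
    using generic_condition_ordered[OF ef(2,1)] by blast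
  define h' where "h' \<kappa> = h (\<lambda>k. \<kappa> (- k))" for \<kappa>
  have "polyfun h'" unfolding h'_def by (rule polyfun_reflect[OF h(1)])
  moreover have "h' (\<lambda>k. \<kappa> (- k)) \<noteq> 0" using h(3) by (simp add: h'_def)
  moreover have "(\<lambda>k. \<kappa> (- k)) \<in> X_space e f" by (rule X_space_reflect[OF h(2)])
  moreover have "determined_by_spectrum p"
    if p: "is_random_walk p" "shape p \<in> X_space e f" "h' (shape p) \<noteq> 0" for p
  proof (rule determined_reflect, rule h(4))
    have sh: "shape (map_pmf uminus p) = (\<lambda>k. shape p (- k))" by (simp add: fun_eq_iff shape_def pmf_map_uminus)
    show "is_random_walk (map_pmf uminus p)" using p(1) by (simp add: is_random_walk_def)
    show "shape (map_pmf uminus p) \<in> X_space f e" unfolding sh by (rule X_space_reflect[OF p(2)])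
    show "h (shape (map_pmf uminus p)) \<noteq> 0" using p(3) unfolding sh h'_def .
  qed
  ultimately show ?thesis by blast
qed

theorem theorem1p4:
  fixes e f :: nat
  assumes "e > 0" and "f > 0"
  shows "\<exists>U. openin (zariski (X_space e f)) U \<and>
             zariski (X_space e f) closure_of U = X_space e f \<and>
             (\<forall>p. is_random_walk p \<longrightarrow> shape p \<in> U \<longrightarrow> determined_by_spectrum p)"
proof -
  obtain h \<kappa> where h: "polyfun h" "\<kappa> \<in> X_space e f" "h \<kappa> \<noteq> 0"
    "\<And>p. is_random_walk p \<Longrightarrow> shape p \<in> X_space e f \<Longrightarrow> h (shape p) \<noteq> 0 \<Longrightarrow> determined_by_spectrum p"
    using generic_condition[OF assms] by blast
  show ?thesis
    by (rule exI[of _ "{\<kappa> \<in> X_space e f. h \<kappa> \<noteq> 0}"])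
      (use nonvanishing_open_dense[OF h(1-3)] h(4) in simp)
qed

end
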